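(* Let $G$ be an abelian group, and let $\mathcal{D}$ be a real algebra isomorphic to $M_n(\mathbb{R})$ (respectively $M_n(\mathbb{H})$). If there is a division $G$-grading $\Gamma$ on $\mathcal{D}$ with homogeneous components of dimension $1$, then $n=2^m$ for some integer $m\ge 0$ and the support of $\Gamma$ is a subgroup $T$ of $G$ isomorphic to $\mathbb{Z}_2^{2m}$ (respectively $\mathbb{Z}_2^{2m+2}$). The isomorphism classes of such gradings are in one-to-one correspondence with the pairs $(T,\mu)$ formed by a subgroup $T$ of $G$ isomorphic to $\mathbb{Z}_2^{2m}$ (respectively $\mathbb{Z}_2^{2m+2}$), and a quadratic form $\mu$ on $T$ of type I and Arf invariant $+1$ (respectively $-1$). All such gradings belong to one equivalence class, represented by the product grading on $M_2(\mathbb{R})\otimes\cdots\otimes M_2(\mathbb{R})\cong M_n(\mathbb{R})$ ($m$ factors, grading group $(\mathbb{Z}_2^2)^m$; for $m=0$ this is $\mathbb{R}$ with the trivial grading) (respectively by the product grading on $M_2(\mathbb{R})\otimes\cdots\otimes M_2(\mathbb{R})\otimes\mathbb{H}\cong M_n(\mathbb{H})$, with $m$ factors $M_2(\mathbb{R})$, grading group $(\mathbb{Z}_2^2)^{m+1}$), where each factor $M_2(\mathbb{R})$ and $\mathbb{H}$ carries its $\mathbb{Z}_2^2$-grading described in the context.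
   Context: Algebras are associative; tensor products are over $\mathbb{R}$. A $G$-grading on an algebra $\mathcal{D}$ is a decomposition $\mathcal{D}=\bigoplus_{g\in G}\mathcal{D}_g$ into subspaces with $\mathcal{D}_g\mathcal{D}_h\subseteq\mathcal{D}_{gh}$. Its support is $\{g\in G\mid \mathcal{D}_g\ne0\}$. It is a division grading if $\mathcal{D}$ is unital and every nonzero homogeneous element is invertible; the support is then a subgroup and all nonzero homogeneous components have the same dimension ("homogeneous components of dimension $d$" refers to the nonzero ones). Two $G$-gradings, on $\mathcal{D}$ and $\mathcal{D}'$, are isomorphic if there is an algebra isomorphism $\varphi:\mathcal{D}\to\mathcal{D}'$ with $\varphi(\mathcal{D}_g)=\mathcal{D}'_g$ for all $g\in G$. A $G$-grading $\Gamma$ on $\mathcal{D}$ and an $H$-grading $\Gamma'$ on $\mathcal{D}'$ are equivalent if there are an algebra isomorphism $\varphi:\mathcal{D}\to\mathcal{D}'$ and a bijection $\alpha:\mathrm{supp}(\Gamma)\to\mathrm{supp}(\Gamma')$ with $\varphi(\mathcal{D}_t)=\mathcal{D}'_{\alpha(t)}$ for all $t\in\mathrm{supp}(\Gamma)$. Product grading: if $\mathcal{D}$ is $G$-graded and $\mathcal{D}'$ is $H$-graded, $\mathcal{D}\otimes\mathcal{D}'$ is $G\times H$-graded by $(\mathcal{D}\otimes\mathcal{D}')_{(g,h)}=\mathcal{D}_g\otimes\mathcal{D}'_h$. Quadratic forms (multiplicative notation): for an elementary abelian $2$-group $T$, a quadratic form is a map $\mu:T\to\{\pm1\}$ with $\mu(e)=+1$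 such that $\beta(u,v):=\mu(uv)\mu(u)^{-1}\mu(v)^{-1}$ is multiplicative in each variable; $\beta$ is its associated alternating bicharacter. Its radical is $\mathrm{rad}(\beta)=\{t\in T\mid\beta(u,t)=+1\ \forall u\in T\}$. The form $\mu$ has type I if $\mathrm{rad}(\beta)=\{e\}$. Arf invariant: if $\mu$ has type I on a finite $T$, there is an $\mathbb{F}_2$-basis $\{a_1,b_1,\dots,a_r,b_r\}$ of $T$ with $\beta(a_i,b_i)=\beta(b_i,a_i)=-1$ and all other $\beta$-products of basis elements $+1$. Let $q(+1,+1)=q(+1,-1)=q(-1,+1)=+1$ and $q(-1,-1)=-1$. Then $\mathrm{Arf}(\mu)=\prod_{i=1}^r q(\mu(a_i),\mu(b_i))$, which is independent of the basis. $\mathbb{Z}_2^2$-gradings with one-dimensional components: $\mathbb{H}=\mathbb{R}1\oplus\mathbb{R}i\oplus\mathbb{R}j\oplus\mathbb{R}k$, and $$M_2(\mathbb{R})=\mathbb{R}\begin{pmatrix}1&0\\0&1\end{pmatrix}\oplus\mathbb{R}\begin{pmatrix}0&1\\1&0\end{pmatrix}\oplus\mathbb{R}\begin{pmatrix}-1&0\\0&1\end{pmatrix}\oplus\mathbb{R}\begin{pmatrix}0&-1\\1&0\end{pmatrix},$$ the four summands having, in each case, degrees $(\bar0,\bar0),(\bar1,\bar0),(\bar0,\bar1),(\bar1,\bar1)$ respectively. *)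

theory Defs
  imports "HOL-Algebra.Product_Groups" "HOL-Algebra.QuotRing" "Jordan_Normal_Form.Matrix"
begin

section \<open>Real algebras\<close>

definition real_field :: "real ring" where
  "real_field = \<lparr>carrier = UNIV, monoid.mult = (*), one = 1, ring.zero = 0, ring.add = (+)\<rparr>"

text \<open>The locale \<^locale>\<open>algebra\<close> requires commutativity, so unital associative algebras
  over the reals are built from \<^locale>\<open>ring\<close> and \<^locale>\<open>module\<close>.\<close>

definition real_alg :: "(real, 'a, 'm) module_scheme \<Rightarrow> bool" where
  "real_alg A \<longleftrightarrow> ring A \<and> module real_field A \<and>
     (\<forall>c. \<forall>x\<in>carrier A. \<forall>y\<in>carrier A.
        (c \<odot>\<^bsub>A\<^esub> x) \<otimes>\<^bsub>A\<^esub> y = c \<odot>\<^bsub>A\<^esub> (x \<otimes>\<^bsub>A\<^esub> y) \<and>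
        x \<otimes>\<^bsub>A\<^esub> (c \<odot>\<^bsub>A\<^esub> y) = c \<odot>\<^bsub>A\<^esub> (x \<otimes>\<^bsub>A\<^esub> y))"

definition alg_iso ::
    "(real, 'a, 'm) module_scheme \<Rightarrow> (real, 'b, 'k) module_scheme \<Rightarrow> ('a \<Rightarrow> 'b) set" where
  "alg_iso A B = {\<phi> \<in> ring_iso A B. \<forall>c. \<forall>x\<in>carrier A. \<phi> (c \<odot>\<^bsub>A\<^esub> x) = c \<odot>\<^bsub>B\<^esub> \<phi> x}"

definition alg_isomorphic ::
    "(real, 'a, 'm) module_scheme \<Rightarrow> (real, 'b, 'k) module_scheme \<Rightarrow> bool" where
  "alg_isomorphic A B \<longleftrightarrow> alg_iso A B \<noteq> {}"

definition lin_subspace :: "(real, 'a, 'm) module_scheme \<Rightarrow> 'a set \<Rightarrow> bool" where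
  "lin_subspace A V \<longleftrightarrow> V \<subseteq> carrier A \<and> \<zero>\<^bsub>A\<^esub> \<in> V \<and>
     (\<forall>x\<in>V. \<forall>y\<in>V. x \<oplus>\<^bsub>A\<^esub> y \<in> V) \<and> (\<forall>c. \<forall>x\<in>V. c \<odot>\<^bsub>A\<^esub> x \<in> V)"

definition line :: "(real, 'a, 'm) module_scheme \<Rightarrow> 'a \<Rightarrow> 'a set" where
  "line A x = range (\<lambda>c. c \<odot>\<^bsub>A\<^esub> x)"

definition one_dimensional :: "(real, 'a, 'm) module_scheme \<Rightarrow> 'a set \<Rightarrow> bool" where
  "one_dimensional A V \<longleftrightarrow> (\<exists>x\<in>carrier A. x \<noteq> \<zero>\<^bsub>A\<^esub> \<and> V = line A x)"


section \<open>Gradings\<close>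

text \<open>A grading is an extensional function on the carrier of \<open>G\<close>, so that gradings
  with the same components are equal.\<close>

definition grading ::
    "('g, 'k) monoid_scheme \<Rightarrow> (real, 'a, 'm) module_scheme \<Rightarrow> ('g \<Rightarrow> 'a set) \<Rightarrow> bool" where
  "grading G D \<Gamma> \<longleftrightarrow>
     \<Gamma> \<in> (\<Pi>\<^sub>E g\<in>carrier G. {V. lin_subspace D V}) \<and>
     (\<forall>x\<in>carrier D. \<exists>!u. u \<in> (\<Pi>\<^sub>E g\<in>carrier G. \<Gamma> g) \<and>
        finite {g \<in> carrier G. u g \<noteq> \<zero>\<^bsub>D\<^esub>} \<and>
        x = (\<Oplus>\<^bsub>D\<^esub>g\<in>{g \<in> carrier G. u g \<noteq> \<zero>\<^bsub>D\<^esub>}. u g)) \<and>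
     (\<forall>g\<in>carrier G. \<forall>h\<in>carrier G. \<forall>x\<in>\<Gamma> g. \<forall>y\<in>\<Gamma> h. x \<otimes>\<^bsub>D\<^esub> y \<in> \<Gamma> (g \<otimes>\<^bsub>G\<^esub> h))"

definition support ::
    "('g, 'k) monoid_scheme \<Rightarrow> (real, 'a, 'm) module_scheme \<Rightarrow> ('g \<Rightarrow> 'a set) \<Rightarrow> 'g set" where
  "support G D \<Gamma> = {g \<in> carrier G. \<Gamma> g \<noteq> {\<zero>\<^bsub>D\<^esub>}}"

definition division_grading ::
    "('g, 'k) monoid_scheme \<Rightarrow> (real, 'a, 'm) module_scheme \<Rightarrow> ('g \<Rightarrow> 'a set) \<Rightarrow> bool" where
  "division_grading G D \<Gamma> \<longleftrightarrow>
     grading G D \<Gamma> \<and> (\<forall>g\<in>carrier G. \<Gamma> g - {\<zero>\<^bsub>D\<^esub>} \<subseteq> Units D)"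

definition div_gradings1 ::
    "('g, 'k) monoid_scheme \<Rightarrow> (real, 'a, 'm) module_scheme \<Rightarrow> ('g \<Rightarrow> 'a set) set" where
  "div_gradings1 G D =
     {\<Gamma>. division_grading G D \<Gamma> \<and> (\<forall>g\<in>support G D \<Gamma>. one_dimensional D (\<Gamma> g))}"

definition graded_isomorphic ::
    "('g, 'k) monoid_scheme \<Rightarrow> (real, 'a, 'm) module_scheme \<Rightarrow> ('g \<Rightarrow> 'a set) \<Rightarrow>
     (real, 'b, 'n) module_scheme \<Rightarrow> ('g \<Rightarrow> 'b set) \<Rightarrow> bool" where
  "graded_isomorphic G D \<Gamma> D' \<Gamma>' \<longleftrightarrow> (\<exists>\<phi>\<in>alg_iso D D'. \<forall>g\<in>carrier G. \<phi> ` \<Gamma> g = \<Gamma>' g)"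

definition graded_equivalent ::
    "('g, 'k) monoid_scheme \<Rightarrow> (real, 'a, 'm) module_scheme \<Rightarrow> ('g \<Rightarrow> 'a set) \<Rightarrow>
     ('h, 'l) monoid_scheme \<Rightarrow> (real, 'b, 'n) module_scheme \<Rightarrow> ('h \<Rightarrow> 'b set) \<Rightarrow> bool" where
  "graded_equivalent G D \<Gamma> H D' \<Gamma>' \<longleftrightarrow>
     (\<exists>\<phi>\<in>alg_iso D D'. \<exists>\<alpha>. bij_betw \<alpha> (support G D \<Gamma>) (support H D' \<Gamma>') \<and>
        (\<forall>t\<in>support G D \<Gamma>. \<phi> ` \<Gamma> t = \<Gamma>' (\<alpha> t)))"

definition iso_classes1 ::
    "('g, 'k) monoid_scheme \<Rightarrow> (real, 'a, 'm) module_scheme \<Rightarrow> ('g \<Rightarrow> 'a set) set set" where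
  "iso_classes1 G D = div_gradings1 G D //
     {(\<Gamma>, \<Gamma>'). \<Gamma> \<in> div_gradings1 G D \<and> \<Gamma>' \<in> div_gradings1 G D \<and> graded_isomorphic G D \<Gamma> D \<Gamma>'}"


section \<open>Quadratic forms and the Arf invariant\<close>

definition Z2_power :: "nat \<Rightarrow> (nat \<Rightarrow> int) monoid" where
  "Z2_power k = product_group {..<k} (\<lambda>_. integer_mod_group 2)"

definition elementary_abelian_2_group :: "('t, 'k) monoid_scheme \<Rightarrow> bool" where
  "elementary_abelian_2_group T \<longleftrightarrow> comm_group T \<and> (\<forall>t\<in>carrier T. t \<otimes>\<^bsub>T\<^esub> t = \<one>\<^bsub>T\<^esub>)"

definition polarization :: "('t, 'k) monoid_scheme \<Rightarrow> ('t \<Rightarrow> real) \<Rightarrow> 't \<Rightarrow> 't \<Rightarrow> real" where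
  "polarization T \<mu> u v = \<mu> (u \<otimes>\<^bsub>T\<^esub> v) * inverse (\<mu> u) * inverse (\<mu> v)"

definition quadratic_form :: "('t, 'k) monoid_scheme \<Rightarrow> ('t \<Rightarrow> real) \<Rightarrow> bool" where
  "quadratic_form T \<mu> \<longleftrightarrow>
     elementary_abelian_2_group T \<and> \<mu> \<in> carrier T \<rightarrow>\<^sub>E {1, -1} \<and> \<mu> \<one>\<^bsub>T\<^esub> = 1 \<and>
     (\<forall>u\<in>carrier T. \<forall>v\<in>carrier T. \<forall>w\<in>carrier T.
        polarization T \<mu> (u \<otimes>\<^bsub>T\<^esub> v) w = polarization T \<mu> u w * polarization T \<mu> v w \<and>
        polarization T \<mu> u (v \<otimes>\<^bsub>T\<^esub> w) = polarization T \<mu> u v * polarization T \<mu> u w)"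

definition radical :: "('t, 'k) monoid_scheme \<Rightarrow> ('t \<Rightarrow> 't \<Rightarrow> real) \<Rightarrow> 't set" where
  "radical T \<beta> = {t \<in> carrier T. \<forall>u\<in>carrier T. \<beta> u t = 1}"

definition type_I :: "('t, 'k) monoid_scheme \<Rightarrow> ('t \<Rightarrow> real) \<Rightarrow> bool" where
  "type_I T \<mu> \<longleftrightarrow> radical T (polarization T \<mu>) = {\<one>\<^bsub>T\<^esub>}"

text \<open>The second conjunct says that the family \<open>a\<^sub>0, b\<^sub>0, \<dots>, a\<^sub>r\<^sub>-\<^sub>1, b\<^sub>r\<^sub>-\<^sub>1\<close> is a basis over
  the field with two elements: a linear combination is a product over a subfamily, and every
  element is such a product in a unique way.\<close>

definition symplectic_basis ::
    "('t, 'k) monoid_scheme \<Rightarrow> ('t \<Rightarrow> 't \<Rightarrow> real) \<Rightarrow> nat \<Rightarrow> (nat \<Rightarrow> 't) \<Rightarrow> (nat \<Rightarrow> 't) \<Rightarrow> bool" where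
  "symplectic_basis T \<beta> r a b \<longleftrightarrow>
     (\<forall>i<r. a i \<in> carrier T \<and> b i \<in> carrier T) \<and>
     (\<forall>t\<in>carrier T. \<exists>!p. p \<in> Pow {..<r} \<times> Pow {..<r} \<and>
        t = (\<Otimes>\<^bsub>T\<^esub>i\<in>fst p. a i) \<otimes>\<^bsub>T\<^esub> (\<Otimes>\<^bsub>T\<^esub>i\<in>snd p. b i)) \<and>
     (\<forall>i<r. \<forall>j<r. \<beta> (a i) (a j) = 1 \<and> \<beta> (b i) (b j) = 1 \<and>
        \<beta> (a i) (b j) = (if i = j then -1 else 1) \<and>
        \<beta> (b j) (a i) = (if i = j then -1 else 1))"

definition arf_q :: "real \<Rightarrow> real \<Rightarrow> real" where
  "arf_q x y = (if x = -1 \<and> y = -1 then -1 else 1)"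

definition Arf :: "('t, 'k) monoid_scheme \<Rightarrow> ('t \<Rightarrow> real) \<Rightarrow> real" where
  "Arf T \<mu> = (THE s. \<exists>r a b. symplectic_basis T (polarization T \<mu>) r a b \<and>
     s = (\<Prod>i<r. arf_q (\<mu> (a i)) (\<mu> (b i))))"

definition typeI_pairs ::
    "('g, 'k) monoid_scheme \<Rightarrow> nat \<Rightarrow> real \<Rightarrow> ('g set \<times> ('g \<Rightarrow> real)) set" where
  "typeI_pairs G k s = {(T, \<mu>). subgroup T G \<and> G\<lparr>carrier := T\<rparr> \<cong> Z2_power k \<and>
     quadratic_form (G\<lparr>carrier := T\<rparr>) \<mu> \<and> type_I (G\<lparr>carrier := T\<rparr>) \<mu> \<and>
     Arf (G\<lparr>carrier := T\<rparr>) \<mu> = s}"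


section \<open>Quaternions\<close>

datatype quaternion = Quaternion (qRe: real) (qI: real) (qJ: real) (qK: real)

lemma quaternion_eq_iff:
  "x = y \<longleftrightarrow> qRe x = qRe y \<and> qI x = qI y \<and> qJ x = qJ y \<and> qK x = qK y"
  by (cases x; cases y) simp

instantiation quaternion :: real_algebra_1
begin

definition "0 = Quaternion 0 0 0 0"
definition "1 = Quaternion 1 0 0 0"
definition "x + y = Quaternion (qRe x + qRe y) (qI x + qI y) (qJ x + qJ y) (qK x + qK y)"
definition "- x = Quaternion (- qRe x) (- qI x) (- qJ x) (- qK x)"
definition "x - y = Quaternion (qRe x - qRe y) (qI x - qI y) (qJ x - qJ y) (qK x - qK y)"
definition "x * y = Quaternion
  (qRe x * qRe y - qI x * qI y - qJ x * qJ y - qK x * qK y)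
  (qRe x * qI y + qI x * qRe y + qJ x * qK y - qK x * qJ y)
  (qRe x * qJ y - qI x * qK y + qJ x * qRe y + qK x * qI y)
  (qRe x * qK y + qI x * qJ y - qJ x * qI y + qK x * qRe y)"
definition "scaleR c x = Quaternion (c * qRe x) (c * qI x) (c * qJ x) (c * qK x)"

lemmas quaternion_ops = zero_quaternion_def one_quaternion_def plus_quaternion_def
  uminus_quaternion_def minus_quaternion_def times_quaternion_def scaleR_quaternion_def

instance
  by standard (simp_all add: quaternion_eq_iff quaternion_ops algebra_simps)

end


section \<open>The algebras and gradings on the factors\<close>

definition class_alg :: "'a::real_algebra_1 itself \<Rightarrow> (real, 'a) module" where
  "class_alg _ = \<lparr>carrier = UNIV, monoid.mult = (*), one = 1, ring.zero = 0, ring.add = (+), smult = (*\<^sub>R)\<rparr>"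

definition mat_alg :: "'a::real_algebra_1 itself \<Rightarrow> nat \<Rightarrow> (real, 'a mat) module" where
  "mat_alg _ n = \<lparr>carrier = carrier_mat n n, monoid.mult = (*), one = 1\<^sub>m n, ring.zero = 0\<^sub>m n n,
     ring.add = (+), smult = (\<lambda>c. map_mat ((*\<^sub>R) c))\<rparr>"

abbreviation M2R :: "(real, real mat) module" where
  "M2R \<equiv> mat_alg TYPE(real) 2"

abbreviation HH :: "(real, quaternion) module" where
  "HH \<equiv> class_alg TYPE(quaternion)"

definition Z2_squared :: "(int \<times> int) monoid" where
  "Z2_squared = integer_mod_group 2 \<times>\<times> integer_mod_group 2"

definition M2R_grading :: "int \<times> int \<Rightarrow> real mat set" where
  "M2R_grading = (\<lambda>g\<in>carrier Z2_squared. line M2R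
     (if g = (0, 0) then mat_of_rows_list 2 [[1, 0], [0, 1]]
      else if g = (1, 0) then mat_of_rows_list 2 [[0, 1], [1, 0]]
      else if g = (0, 1) then mat_of_rows_list 2 [[-1, 0], [0, 1]]
      else mat_of_rows_list 2 [[0, -1], [1, 0]]))"

definition HH_grading :: "int \<times> int \<Rightarrow> quaternion set" where
  "HH_grading = (\<lambda>g\<in>carrier Z2_squared. line HH
     (if g = (0, 0) then Quaternion 1 0 0 0
      else if g = (1, 0) then Quaternion 0 1 0 0
      else if g = (0, 1) then Quaternion 0 0 1 0
      else Quaternion 0 0 0 1))"


section \<open>Tensor products\<close>

text \<open>HOL has no type in which a tensor product with a variable number of factors is a nested
  binary one, so tensor powers are formed in one step. In both the binary case and the case of
  powers, the pure tensor of a tuple \<open>x\<close> is the evaluation \<open>f \<mapsto> f x\<close> on the set \<open>F\<close> of all real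
  multilinear forms, and the tensor product is the linear span of the pure tensors. Over a field
  this realizes the tensor product, because its elements are separated by the linear forms on it,
  and these are the multilinear forms on the factors. On functions outside \<open>F\<close> the elements of
  the span are set to \<open>0\<close>.\<close>

definition pure_tensor :: "('x \<Rightarrow> real) set \<Rightarrow> 'x \<Rightarrow> (('x \<Rightarrow> real) \<Rightarrow> real)" where
  "pure_tensor F x = (\<lambda>f. if f \<in> F then f x else 0)"

definition tensor_span :: "('x \<Rightarrow> real) set \<Rightarrow> 'x set \<Rightarrow> (('x \<Rightarrow> real) \<Rightarrow> real) set" where
  "tensor_span F X = {s. \<exists>S c. finite S \<and> S \<subseteq> X \<and>
     s = (\<lambda>f. \<Sum>x\<in>S. c x * pure_tensor F x f)}"

text \<open>The multiplication is the bilinear extension of the componentwise product \<open>p\<close> of tuples;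
  see \<open>tensor_mult_pure\<close> below.\<close>

definition tensor_alg ::
    "('x \<Rightarrow> real) set \<Rightarrow> 'x set \<Rightarrow> ('x \<Rightarrow> 'x \<Rightarrow> 'x) \<Rightarrow> 'x \<Rightarrow> (real, ('x \<Rightarrow> real) \<Rightarrow> real) module" where
  "tensor_alg F X p e = \<lparr>carrier = tensor_span F X,
     monoid.mult = (\<lambda>s t f. if f \<in> F then s (\<lambda>x. t (\<lambda>y. f (p x y))) else 0),
     one = pure_tensor F e,
     ring.zero = (\<lambda>f. 0),
     ring.add = (\<lambda>s t f. s f + t f),
     smult = (\<lambda>c s f. c * s f)\<rparr>"

definition bilinear_forms ::
    "(real, 'a, 'm) module_scheme \<Rightarrow> (real, 'b, 'k) module_scheme \<Rightarrow> ('a \<times> 'b \<Rightarrow> real) set" where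
  "bilinear_forms A B = {f.
     (\<forall>x\<in>carrier A. \<forall>x'\<in>carrier A. \<forall>y\<in>carrier B. f (x \<oplus>\<^bsub>A\<^esub> x', y) = f (x, y) + f (x', y)) \<and>
     (\<forall>x\<in>carrier A. \<forall>y\<in>carrier B. \<forall>y'\<in>carrier B. f (x, y \<oplus>\<^bsub>B\<^esub> y') = f (x, y) + f (x, y')) \<and>
     (\<forall>c. \<forall>x\<in>carrier A. \<forall>y\<in>carrier B.
        f (c \<odot>\<^bsub>A\<^esub> x, y) = c * f (x, y) \<and> f (x, c \<odot>\<^bsub>B\<^esub> y) = c * f (x, y))}"

definition tensor ::
    "(real, 'a, 'm) module_scheme \<Rightarrow> (real, 'b, 'k) module_scheme \<Rightarrow>
     (real, ('a \<times> 'b \<Rightarrow> real) \<Rightarrow> real) module" where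
  "tensor A B = tensor_alg (bilinear_forms A B) (carrier A \<times> carrier B)
     (\<lambda>x y. (fst x \<otimes>\<^bsub>A\<^esub> fst y, snd x \<otimes>\<^bsub>B\<^esub> snd y)) (\<one>\<^bsub>A\<^esub>, \<one>\<^bsub>B\<^esub>)"

definition multilinear_forms ::
    "nat \<Rightarrow> (real, 'a, 'm) module_scheme \<Rightarrow> ((nat \<Rightarrow> 'a) \<Rightarrow> real) set" where
  "multilinear_forms m A = {f. \<forall>x \<in> {..<m} \<rightarrow>\<^sub>E carrier A. \<forall>i<m. \<forall>a\<in>carrier A.
     (\<forall>b\<in>carrier A. f (x(i := a \<oplus>\<^bsub>A\<^esub> b)) = f (x(i := a)) + f (x(i := b))) \<and>
     (\<forall>c. f (x(i := c \<odot>\<^bsub>A\<^esub> a)) = c * f (x(i := a)))}"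

definition tensor_power ::
    "nat \<Rightarrow> (real, 'a, 'm) module_scheme \<Rightarrow> (real, ((nat \<Rightarrow> 'a) \<Rightarrow> real) \<Rightarrow> real) module" where
  "tensor_power m A = tensor_alg (multilinear_forms m A) ({..<m} \<rightarrow>\<^sub>E carrier A)
     (\<lambda>x y. \<lambda>i\<in>{..<m}. x i \<otimes>\<^bsub>A\<^esub> y i) (\<lambda>i\<in>{..<m}. \<one>\<^bsub>A\<^esub>)"

definition tensor_grading ::
    "('g, 'k) monoid_scheme \<Rightarrow> (real, 'a, 'm) module_scheme \<Rightarrow> ('g \<Rightarrow> 'a set) \<Rightarrow>
     ('h, 'l) monoid_scheme \<Rightarrow> (real, 'b, 'n) module_scheme \<Rightarrow> ('h \<Rightarrow> 'b set) \<Rightarrow>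
     'g \<times> 'h \<Rightarrow> (('a \<times> 'b \<Rightarrow> real) \<Rightarrow> real) set" where
  "tensor_grading G A \<Gamma> H B \<Delta> = (\<lambda>z\<in>carrier (G \<times>\<times> H).
     tensor_span (bilinear_forms A B) (\<Gamma> (fst z) \<times> \<Delta> (snd z)))"

definition tensor_power_grading ::
    "nat \<Rightarrow> ('g, 'k) monoid_scheme \<Rightarrow> (real, 'a, 'm) module_scheme \<Rightarrow> ('g \<Rightarrow> 'a set) \<Rightarrow>
     (nat \<Rightarrow> 'g) \<Rightarrow> (((nat \<Rightarrow> 'a) \<Rightarrow> real) \<Rightarrow> real) set" where
  "tensor_power_grading m G A \<Gamma> = (\<lambda>g\<in>carrier (product_group {..<m} (\<lambda>_. G)).
     tensor_span (multilinear_forms m A) (\<Pi>\<^sub>E i\<in>{..<m}. \<Gamma> (g i)))"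

lemma tensor_alg_mult_pure:
  assumes "\<And>f. f \<in> F \<Longrightarrow> (\<lambda>y. f (p x y)) \<in> F"
    and "\<And>f. f \<in> F \<Longrightarrow> (\<lambda>x. pure_tensor F y (\<lambda>y. f (p x y))) \<in> F"
  shows "pure_tensor F x \<otimes>\<^bsub>tensor_alg F X p e\<^esub> pure_tensor F y = pure_tensor F (p x y)"
  using assms by (auto simp: tensor_alg_def pure_tensor_def fun_eq_iff)

lemma tensor_mult_pure:
  assumes A: "real_alg A" and B: "real_alg B"
    and x: "x \<in> carrier A \<times> carrier B" and y: "y \<in> carrier A \<times> carrier B"
  shows "pure_tensor (bilinear_forms A B) x \<otimes>\<^bsub>tensor A B\<^esub> pure_tensor (bilinear_forms A B) y =
    pure_tensor (bilinear_forms A B) (fst x \<otimes>\<^bsub>A\<^esub> fst y, snd x \<otimes>\<^bsub>B\<^esub> snd y)"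
proof -
  interpret A: ring A + MA: module real_field A using A by (auto simp: real_alg_def)
  interpret B: ring B + MB: module real_field B using B by (auto simp: real_alg_def)
  have sA [simp]: "c \<odot>\<^bsub>A\<^esub> a \<in> carrier A" if "a \<in> carrier A" for a c
    using MA.smult_closed[of c a] that by (simp add: real_field_def)
  have sB [simp]: "c \<odot>\<^bsub>B\<^esub> b \<in> carrier B" if "b \<in> carrier B" for b c
    using MB.smult_closed[of c b] that by (simp add: real_field_def)
  note [simp] = A[unfolded real_alg_def] B[unfolded real_alg_def] A.l_distr A.r_distr B.l_distr B.r_distr
  let ?F = "bilinear_forms A B"
  let ?p = "\<lambda>x y. (fst x \<otimes>\<^bsub>A\<^esub> fst y, snd x \<otimes>\<^bsub>B\<^esub> snd y)"
  have l: "(\<lambda>y. f (?p x y)) \<in> ?F" if "f \<in> ?F" "x \<in> carrier A \<times> carrier B" for f x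
    using that by (auto simp: bilinear_forms_def)
  have r: "(\<lambda>x. pure_tensor ?F y (\<lambda>y. f (?p x y))) \<in> ?F" if f: "f \<in> ?F" for f
  proof -
    have "pure_tensor ?F y (\<lambda>y. f (?p x y)) = f (?p x y)" if "x \<in> carrier A \<times> carrier B" for x
      using l[OF f that] by (simp add: pure_tensor_def)
    then show ?thesis
      using f y by (auto simp: bilinear_forms_def)
  qed
  show ?thesis
    unfolding tensor_def by (rule tensor_alg_mult_pure) (use l x r in auto)
qed

abbreviation M2R_power :: "nat \<Rightarrow> (real, ((nat \<Rightarrow> real mat) \<Rightarrow> real) \<Rightarrow> real) module" where
  "M2R_power m \<equiv> tensor_power m M2R"

abbreviation M2R_power_group :: "nat \<Rightarrow> (nat \<Rightarrow> int \<times> int) monoid" where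
  "M2R_power_group m \<equiv> product_group {..<m} (\<lambda>_. Z2_squared)"

abbreviation M2R_power_grading ::
    "nat \<Rightarrow> (nat \<Rightarrow> int \<times> int) \<Rightarrow> (((nat \<Rightarrow> real mat) \<Rightarrow> real) \<Rightarrow> real) set" where
  "M2R_power_grading m \<equiv> tensor_power_grading m Z2_squared M2R M2R_grading"

end

(* Choose a nonzero vector X_t in each nonzero component. Then X_s X_t = sigma s t X_st, and X_s, X_t
   commute up to beta s t = sigma s t / sigma t s. As the center of D is R, beta is nondegenerate;
   as T is finite and beta is real, beta = 1 or -1, so T is an elementary 2-group. After rescaling,
   X_t^2 = mu t = 1 or -1, and mu is a quadratic form of type I with polarization beta.

   The trace form of D is diagonal in the X_t with signs mu t. By Sylvester's law of inertia its
   signature, which is n for M_n(R) and -2n for M_n(H), equals the sum of the values of mu, and this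
   sum is sqrt |T| times the Arf invariant. Since |T| = dim D, this determines n and Arf mu.

   Forms with the same |T| and Arf invariant are isometric by normal symplectic bases. If two gradings
   have isometric forms, their cocycles sigma differ by a symmetric cocycle with trivial diagonal,
   which is a coboundary, so the algebras are isomorphic compatibly with the isometry. Every pair
   (T, mu) is realized by transporting the product grading along an isometry. *)

theory Submission
  imports Defs
begin

section \<open>Algebras in coordinates\<close>

text \<open>Everything is compared through structure constants. Algebras with equal constants are
  isomorphic, even when one of them is not yet known to satisfy the axioms. The tensor products,
  whose elements are functionals on forms and whose product is an iterated evaluation, are handled
  only in this way: they receive the algebra laws from a matrix algebra with the same constants. The
  Arf invariant is awkward to read off an abstract grading, because it is defined by a basis of T
  adapted to \<beta>. The sum of \<mu> needs no basis and is visible in the trace form. For the same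
  reason the real and the quaternionic case are one argument with parameters: a set K of size dim D
  and weights e on it whose signs add up to the signature. Finite support is not part of the
  definition of a grading; it comes from the uniqueness of homogeneous decompositions and the finite
  dimension of D. Over the reals, rescaling X_t removes only the absolute value of the scalar X_t^2;
  the sign that remains is the reason why a quadratic form appears at all.\<close>

definition linear_fn :: "(real, 'a, 'm) module_scheme \<Rightarrow> ('a \<Rightarrow> real) \<Rightarrow> bool" where
  "linear_fn D h \<longleftrightarrow> (\<forall>x\<in>carrier D. \<forall>y\<in>carrier D. h (x \<oplus>\<^bsub>D\<^esub> y) = h x + h y) \<and>
     (\<forall>c. \<forall>x\<in>carrier D. h (c \<odot>\<^bsub>D\<^esub> x) = c * h x)"

definition alg_ops_closed :: "(real, 'a, 'm) module_scheme \<Rightarrow> bool" where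
  "alg_ops_closed D \<longleftrightarrow> \<zero>\<^bsub>D\<^esub> \<in> carrier D \<and> \<one>\<^bsub>D\<^esub> \<in> carrier D \<and>
     (\<forall>x\<in>carrier D. \<forall>y\<in>carrier D. x \<oplus>\<^bsub>D\<^esub> y \<in> carrier D \<and> x \<otimes>\<^bsub>D\<^esub> y \<in> carrier D) \<and>
     (\<forall>c. \<forall>x\<in>carrier D. c \<odot>\<^bsub>D\<^esub> x \<in> carrier D)"

text \<open>\<open>\<gamma>\<close> are the structure constants and \<open>\<eta>\<close> the
  coordinates of the unit. Only closure is required of the operations, not the algebra axioms: a
  tensor product gets coordinates first, and the axioms are transported to it afterwards. Coordinate
  functions are extensional on \<open>I\<close>, so that \<open>\<kappa>\<close> can be a
  bijection.\<close>

definition alg_coords :: "(real, 'a, 'm) module_scheme \<Rightarrow> 'i set \<Rightarrow> ('i \<Rightarrow> 'i \<Rightarrow> 'i \<Rightarrow> real) \<Rightarrow>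
    ('i \<Rightarrow> real) \<Rightarrow> ('a \<Rightarrow> 'i \<Rightarrow> real) \<Rightarrow> bool" where
  "alg_coords D I \<gamma> \<eta> \<kappa> \<longleftrightarrow> finite I \<and> alg_ops_closed D \<and>
     bij_betw \<kappa> (carrier D) (I \<rightarrow>\<^sub>E UNIV) \<and> (\<forall>i\<in>I. linear_fn D (\<lambda>x. \<kappa> x i)) \<and>
     (\<forall>x\<in>carrier D. \<forall>y\<in>carrier D. \<forall>u\<in>I.
        \<kappa> (x \<otimes>\<^bsub>D\<^esub> y) u = (\<Sum>s\<in>I. \<Sum>t\<in>I. \<gamma> s t u * \<kappa> x s * \<kappa> y t)) \<and>
     (\<forall>i\<in>I. \<kappa> \<zero>\<^bsub>D\<^esub> i = 0 \<and> \<kappa> \<one>\<^bsub>D\<^esub> i = \<eta> i)"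

locale coords =
  fixes D :: "(real, 'a, 'm) module_scheme" and I :: "'i set" and \<gamma> \<eta> \<kappa>
  assumes alg_coords: "alg_coords D I \<gamma> \<eta> \<kappa>"
begin

lemma finite_I [simp, intro]: "finite I"
  using alg_coords by (simp add: alg_coords_def)

lemma closed [simp, intro]:
  "\<zero>\<^bsub>D\<^esub> \<in> carrier D" "\<one>\<^bsub>D\<^esub> \<in> carrier D"
  "x \<in> carrier D \<Longrightarrow> y \<in> carrier D \<Longrightarrow> x \<oplus>\<^bsub>D\<^esub> y \<in> carrier D"
  "x \<in> carrier D \<Longrightarrow> y \<in> carrier D \<Longrightarrow> x \<otimes>\<^bsub>D\<^esub> y \<in> carrier D"
  "x \<in> carrier D \<Longrightarrow> c \<odot>\<^bsub>D\<^esub> x \<in> carrier D"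
  using alg_coords by (simp_all add: alg_coords_def alg_ops_closed_def)

lemma coords_bij: "bij_betw \<kappa> (carrier D) (I \<rightarrow>\<^sub>E UNIV)"
  and coords_linear: "i \<in> I \<Longrightarrow> linear_fn D (\<lambda>x. \<kappa> x i)"
  using alg_coords by (simp_all add: alg_coords_def)

lemma coords_ops [simp]:
  "i \<in> I \<Longrightarrow> x \<in> carrier D \<Longrightarrow> y \<in> carrier D \<Longrightarrow> \<kappa> (x \<oplus>\<^bsub>D\<^esub> y) i = \<kappa> x i + \<kappa> y i"
  "i \<in> I \<Longrightarrow> x \<in> carrier D \<Longrightarrow> \<kappa> (c \<odot>\<^bsub>D\<^esub> x) i = c * \<kappa> x i"
  "i \<in> I \<Longrightarrow> \<kappa> \<zero>\<^bsub>D\<^esub> i = 0" "i \<in> I \<Longrightarrow> \<kappa> \<one>\<^bsub>D\<^esub> i = \<eta> i"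
  using alg_coords by (simp_all add: alg_coords_def linear_fn_def)

lemma coords_mult: "x \<in> carrier D \<Longrightarrow> y \<in> carrier D \<Longrightarrow> u \<in> I \<Longrightarrow>
    \<kappa> (x \<otimes>\<^bsub>D\<^esub> y) u = (\<Sum>s\<in>I. \<Sum>t\<in>I. \<gamma> s t u * \<kappa> x s * \<kappa> y t)"
  using alg_coords by (simp add: alg_coords_def)

lemma coords_PiE: "x \<in> carrier D \<Longrightarrow> \<kappa> x \<in> I \<rightarrow>\<^sub>E UNIV"
  using coords_bij bij_betwE by blast

lemma coords_eqI:
  assumes "x \<in> carrier D" "y \<in> carrier D" "\<And>i. i \<in> I \<Longrightarrow> \<kappa> x i = \<kappa> y i"
  shows "x = y"
proof -
  have "\<kappa> x = \<kappa> y"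
    using assms by (intro PiE_ext[OF coords_PiE coords_PiE])
  then show ?thesis
    using coords_bij assms by (auto simp: bij_betw_def inj_on_def)
qed

definition of_coords :: "('i \<Rightarrow> real) \<Rightarrow> 'a" where
  "of_coords v = inv_into (carrier D) \<kappa> (restrict v I)"

lemma of_coords_closed [simp, intro]: "of_coords v \<in> carrier D"
  unfolding of_coords_def
  by (rule inv_into_into) (use coords_bij in \<open>auto simp: bij_betw_def\<close>)

lemma coords_of_coords [simp]: "i \<in> I \<Longrightarrow> \<kappa> (of_coords v) i = v i"
proof -
  have "\<kappa> (of_coords v) = restrict v I"
    unfolding of_coords_def
    by (rule f_inv_into_f) (use coords_bij in \<open>auto simp: bij_betw_def\<close>)
  then show "i \<in> I \<Longrightarrow> \<kappa> (of_coords v) i = v i" by simp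
qed

lemma of_coords_coords [simp]: "x \<in> carrier D \<Longrightarrow> of_coords (\<kappa> x) = x"
  by (rule coords_eqI) auto

definition basis_vec :: "'i \<Rightarrow> 'a" where
  "basis_vec s = of_coords (\<lambda>t. if t = s then 1 else 0)"

lemma basis_vec_closed [simp, intro]: "basis_vec s \<in> carrier D"
  by (simp add: basis_vec_def)

lemma coords_basis_vec [simp]: "t \<in> I \<Longrightarrow> \<kappa> (basis_vec s) t = (if t = s then 1 else 0)"
  by (simp add: basis_vec_def)

lemma coords_mult_basis_vec:
  assumes "s \<in> I" "t \<in> I" "u \<in> I"
  shows "\<kappa> (basis_vec s \<otimes>\<^bsub>D\<^esub> basis_vec t) u = \<gamma> s t u"
proof -
  have "\<kappa> (basis_vec s \<otimes>\<^bsub>D\<^esub> basis_vec t) u =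
      (\<Sum>s'\<in>I. \<Sum>t'\<in>I. if t' = t then if s' = s then \<gamma> s t u else 0 else 0)"
    unfolding coords_mult[OF basis_vec_closed basis_vec_closed assms(3)]
    by (intro sum.cong refl) simp
  also have "\<dots> = \<gamma> s t u"
    using assms by simp
  finally show ?thesis .
qed

lemma linear_fn_expand:
  assumes h: "linear_fn D h" and x: "x \<in> carrier D"
  shows "h x = (\<Sum>i\<in>I. \<kappa> x i * h (basis_vec i))"
proof -
  have "h (of_coords (\<lambda>i. if i \<in> S then v i else 0)) = (\<Sum>i\<in>S. v i * h (basis_vec i))"
    if "finite S" "S \<subseteq> I" for S v
    using that
  proof (induction S)
    case empty
    have "of_coords (\<lambda>i. 0) = 0 \<odot>\<^bsub>D\<^esub> of_coords (\<lambda>i. 0)"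
      by (rule coords_eqI) auto
    then have "h (of_coords (\<lambda>i. 0)) = 0 * h (of_coords (\<lambda>i. 0))"
      using h unfolding linear_fn_def by (metis of_coords_closed)
    then show ?case by simp
  next
    case (insert j S)
    have "of_coords (\<lambda>i. if i \<in> insert j S then v i else 0) =
        (v j \<odot>\<^bsub>D\<^esub> basis_vec j) \<oplus>\<^bsub>D\<^esub> of_coords (\<lambda>i. if i \<in> S then v i else 0)"
      by (rule coords_eqI) (use insert in auto)
    with insert h show ?case
      by (simp add: linear_fn_def)
  qed
  from this[OF finite_I subset_refl, of "\<kappa> x"]
  have "h (of_coords (\<lambda>i. if i \<in> I then \<kappa> x i else 0)) = (\<Sum>i\<in>I. \<kappa> x i * h (basis_vec i))" .
  moreover have "of_coords (\<lambda>i. if i \<in> I then \<kappa> x i else 0) = x"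
    by (rule coords_eqI) (use x in auto)
  ultimately show ?thesis by simp
qed

end

section \<open>Algebra isomorphisms and transport of structure\<close>

lemma alg_isoD:
  assumes "\<phi> \<in> alg_iso A B"
  shows "bij_betw \<phi> (carrier A) (carrier B)"
    and "x \<in> carrier A \<Longrightarrow> \<phi> x \<in> carrier B"
    and "x \<in> carrier A \<Longrightarrow> y \<in> carrier A \<Longrightarrow> \<phi> (x \<oplus>\<^bsub>A\<^esub> y) = \<phi> x \<oplus>\<^bsub>B\<^esub> \<phi> y"
    and "x \<in> carrier A \<Longrightarrow> y \<in> carrier A \<Longrightarrow> \<phi> (x \<otimes>\<^bsub>A\<^esub> y) = \<phi> x \<otimes>\<^bsub>B\<^esub> \<phi> y"
    and "\<phi> \<one>\<^bsub>A\<^esub> = \<one>\<^bsub>B\<^esub>"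
    and "x \<in> carrier A \<Longrightarrow> \<phi> (c \<odot>\<^bsub>A\<^esub> x) = c \<odot>\<^bsub>B\<^esub> \<phi> x"
  using assms by (auto simp: alg_iso_def ring_iso_def Ring.ring_hom_def)

lemma alg_isoI:
  assumes "bij_betw \<phi> (carrier A) (carrier B)"
    and "\<And>x y. x \<in> carrier A \<Longrightarrow> y \<in> carrier A \<Longrightarrow> \<phi> (x \<oplus>\<^bsub>A\<^esub> y) = \<phi> x \<oplus>\<^bsub>B\<^esub> \<phi> y"
    and "\<And>x y. x \<in> carrier A \<Longrightarrow> y \<in> carrier A \<Longrightarrow> \<phi> (x \<otimes>\<^bsub>A\<^esub> y) = \<phi> x \<otimes>\<^bsub>B\<^esub> \<phi> y"
    and "\<phi> \<one>\<^bsub>A\<^esub> = \<one>\<^bsub>B\<^esub>"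
    and "\<And>c x. x \<in> carrier A \<Longrightarrow> \<phi> (c \<odot>\<^bsub>A\<^esub> x) = c \<odot>\<^bsub>B\<^esub> \<phi> x"
  shows "\<phi> \<in> alg_iso A B"
  using assms by (auto simp: alg_iso_def ring_iso_def Ring.ring_hom_def bij_betw_def)

lemma real_alg_closed:
  assumes "real_alg A"
  shows "alg_ops_closed A"
proof -
  interpret ring A using assms by (simp add: real_alg_def)
  interpret M: module real_field A using assms by (simp add: real_alg_def)
  show ?thesis
    using M.smult_closed by (simp add: alg_ops_closed_def real_field_def)
qed

lemma alg_iso_trans:
  assumes "\<phi> \<in> alg_iso A B" "\<psi> \<in> alg_iso B C"
  shows "\<psi> \<circ> \<phi> \<in> alg_iso A C"
  by (rule alg_isoI) (use alg_isoD[OF assms(1)] alg_isoD[OF assms(2)] in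
      \<open>auto intro: bij_betw_trans\<close>)

lemma alg_iso_inv:
  assumes \<phi>: "\<phi> \<in> alg_iso A B" and c: "alg_ops_closed A"
  shows "inv_into (carrier A) \<phi> \<in> alg_iso B A"
proof -
  note i = alg_isoD[OF \<phi>]
  let ?g = "inv_into (carrier A) \<phi>"
  have inj: "inj_on \<phi> (carrier A)" and im: "carrier B = \<phi> ` carrier A"
    using i(1) by (auto simp: bij_betw_def)
  have g: "?g (\<phi> x) = x" if "x \<in> carrier A" for x
    using inj that by simp
  have sur: "\<exists>a\<in>carrier A. x = \<phi> a" if "x \<in> carrier B" for x
    using that im by auto
  show ?thesis
  proof (rule alg_isoI)
    show "bij_betw ?g (carrier B) (carrier A)"
      by (rule bij_betw_inv_into[OF i(1)])
  next
    fix x y assume "x \<in> carrier B" "y \<in> carrier B"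
    then obtain a b where ab: "a \<in> carrier A" "x = \<phi> a" "b \<in> carrier A" "y = \<phi> b"
      using sur by meson
    show "?g (x \<oplus>\<^bsub>B\<^esub> y) = ?g x \<oplus>\<^bsub>A\<^esub> ?g y"
      using ab c g i(3)[of a b, symmetric] by (simp add: alg_ops_closed_def)
    show "?g (x \<otimes>\<^bsub>B\<^esub> y) = ?g x \<otimes>\<^bsub>A\<^esub> ?g y"
      using ab c g i(4)[of a b, symmetric] by (simp add: alg_ops_closed_def)
  next
    show "?g \<one>\<^bsub>B\<^esub> = \<one>\<^bsub>A\<^esub>"
      using c g i(5)[symmetric] by (simp add: alg_ops_closed_def)
  next
    fix k x assume "x \<in> carrier B"
    then obtain a where ab: "a \<in> carrier A" "x = \<phi> a"
      using sur by meson
    then show "?g (k \<odot>\<^bsub>B\<^esub> x) = k \<odot>\<^bsub>A\<^esub> ?g x"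
      using c g i(6)[of a k, symmetric] by (simp add: alg_ops_closed_def)
  qed
qed

text \<open>The map to the vector with the same coordinates respects all operations, since each is
  given by the shared constants. That zero goes to zero is recorded separately:
  \<open>alg_iso\<close> does not mention it, and the target is not assumed to be a ring.\<close>

lemma alg_iso_of_coords:
  assumes D: "alg_coords D I \<gamma> \<eta> \<kappa>" and D': "alg_coords D' I \<gamma> \<eta> \<kappa>'"
  obtains \<phi> where "\<phi> \<in> alg_iso D D'" "\<And>x. x \<in> carrier D \<Longrightarrow> \<kappa>' (\<phi> x) = \<kappa> x"
    "\<phi> \<zero>\<^bsub>D\<^esub> = \<zero>\<^bsub>D'\<^esub>"
proof -
  interpret A: coords D I \<gamma> \<eta> \<kappa> by unfold_locales (rule D)
  interpret B: coords D' I \<gamma> \<eta> \<kappa>' by unfold_locales (rule D')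
  let ?\<phi> = "\<lambda>x. B.of_coords (\<kappa> x)"
  have "bij_betw ?\<phi> (carrier D) (carrier D')"
    by (rule bij_betwI[where g = "\<lambda>x. A.of_coords (\<kappa>' x)"])
      (auto intro: A.coords_eqI B.coords_eqI)
  then have "?\<phi> \<in> alg_iso D D'"
    by (rule alg_isoI; intro B.coords_eqI) (auto simp: A.coords_mult B.coords_mult)
  moreover have "\<kappa>' (?\<phi> x) = \<kappa> x" if "x \<in> carrier D" for x
    by (rule PiE_ext[OF B.coords_PiE A.coords_PiE]) (use that in auto)
  moreover have "?\<phi> \<zero>\<^bsub>D\<^esub> = \<zero>\<^bsub>D'\<^esub>"
    by (rule B.coords_eqI) auto
  ultimately show ?thesis using that by blast
qed

text \<open>Only \<open>A\<close> is known to be an algebra; all laws of \<open>B\<close> are pulled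
  back to \<open>A\<close> through the surjectivity of \<open>\<phi>\<close>. The hypothesis on zero
  is there because being in \<open>alg_iso\<close> says nothing about the zero of a structure not
  yet known to be a ring.\<close>

lemma real_alg_iso:
  assumes A: "real_alg A" and \<phi>: "\<phi> \<in> alg_iso A B" and z: "\<phi> \<zero>\<^bsub>A\<^esub> = \<zero>\<^bsub>B\<^esub>"
  shows "real_alg B"
proof -
  note i = alg_isoD[OF \<phi>]
  interpret A: ring A using A by (simp add: real_alg_def)
  interpret M: module real_field A using A by (simp add: real_alg_def)
  have c: "c \<odot>\<^bsub>A\<^esub> x \<in> carrier A" if "x \<in> carrier A" for c x
    using M.smult_closed[of c x] that by (simp add: real_field_def)
  have "\<phi> \<in> ring_iso A B" using \<phi> by (simp add: alg_iso_def)
  then have "ring (B \<lparr> zero := \<phi> \<zero>\<^bsub>A\<^esub> \<rparr>)"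
    by (rule A.ring_iso_imp_img_ring)
  then have B: "ring B" using z by simp
  interpret B: ring B by (rule B)
  have sur: "\<exists>a\<in>carrier A. x = \<phi> a" if "x \<in> carrier B" for x
    using that i(1) by (auto simp: bij_betw_def)
  have cl: "c \<odot>\<^bsub>B\<^esub> x \<in> carrier B" if "x \<in> carrier B" for c x
    using sur[OF that] i(2)[OF c] i(6) by fastforce
  have "module real_field B"
  proof (rule moduleI)
    show "cring real_field" using M.is_cring .
    show "abelian_group B" using B.is_abelian_group .
    show "a \<odot>\<^bsub>B\<^esub> x \<in> carrier B" if "x \<in> carrier B" for a x
      using cl[OF that] .
    show "(a \<oplus>\<^bsub>real_field\<^esub> b) \<odot>\<^bsub>B\<^esub> x = a \<odot>\<^bsub>B\<^esub> x \<oplus>\<^bsub>B\<^esub> b \<odot>\<^bsub>B\<^esub> x" if x: "x \<in> carrier B" for a b x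
    proof -
      obtain y where y: "y \<in> carrier A" "x = \<phi> y" using sur[OF x] by blast
      show ?thesis
        using M.smult_l_distr[of a b y] y c
        by (simp add: i(6)[symmetric] i(3)[symmetric] real_field_def)
    qed
    show "a \<odot>\<^bsub>B\<^esub> (x \<oplus>\<^bsub>B\<^esub> y) = a \<odot>\<^bsub>B\<^esub> x \<oplus>\<^bsub>B\<^esub> a \<odot>\<^bsub>B\<^esub> y"
      if xy: "x \<in> carrier B" "y \<in> carrier B" for a x y
    proof -
      obtain x' y' where y: "x' \<in> carrier A" "x = \<phi> x'" "y' \<in> carrier A" "y = \<phi> y'"
        using sur xy by meson
      show ?thesis
        using M.smult_r_distr[of a x' y'] y c
        by (simp add: i(6)[symmetric] i(3)[symmetric] real_field_def)
    qed
    show "(a \<otimes>\<^bsub>real_field\<^esub> b) \<odot>\<^bsub>B\<^esub> x = a \<odot>\<^bsub>B\<^esub> (b \<odot>\<^bsub>B\<^esub> x)" if x: "x \<in> carrier B" for a b x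
    proof -
      obtain y where y: "y \<in> carrier A" "x = \<phi> y" using sur[OF x] by blast
      show ?thesis
        using M.smult_assoc1[of a b y] y c
        by (simp add: i(6)[symmetric] real_field_def)
    qed
    show "\<one>\<^bsub>real_field\<^esub> \<odot>\<^bsub>B\<^esub> x = x" if x: "x \<in> carrier B" for x
    proof -
      obtain y where y: "y \<in> carrier A" "x = \<phi> y" using sur[OF x] by blast
      show ?thesis
        using M.smult_one[of y] y c
        by (simp add: i(6)[symmetric] real_field_def)
    qed
  qed
  moreover have "(c \<odot>\<^bsub>B\<^esub> x) \<otimes>\<^bsub>B\<^esub> y = c \<odot>\<^bsub>B\<^esub> (x \<otimes>\<^bsub>B\<^esub> y) \<and> x \<otimes>\<^bsub>B\<^esub> (c \<odot>\<^bsub>B\<^esub> y) = c \<odot>\<^bsub>B\<^esub> (x \<otimes>\<^bsub>B\<^esub> y)"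
    if xy: "x \<in> carrier B" "y \<in> carrier B" for c x y
  proof -
    obtain x' y' where y: "x' \<in> carrier A" "x = \<phi> x'" "y' \<in> carrier A" "y = \<phi> y'"
      using sur xy by meson
    show ?thesis
      using A y by (simp add: real_alg_def i(6)[symmetric] i(4)[symmetric] c)
  qed
  ultimately show ?thesis using B by (simp add: real_alg_def)
qed

lemma alg_coords_pullback:
  assumes \<phi>: "\<phi> \<in> alg_iso A B" and B: "alg_coords B I \<gamma> \<eta> \<kappa>" and A: "real_alg A"
  shows "alg_coords A I \<gamma> \<eta> (\<kappa> \<circ> \<phi>)"
proof -
  note i = alg_isoD[OF \<phi>]
  interpret B: coords B I \<gamma> \<eta> \<kappa> by unfold_locales (rule B)
  have c: "alg_ops_closed A" by (rule real_alg_closed[OF A])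
  interpret A: ring A using A by (simp add: real_alg_def)
  interpret M: module real_field A using A by (simp add: real_alg_def)
  have "\<kappa> (\<phi> \<zero>\<^bsub>A\<^esub>) j = 0" if "j \<in> I" for j
    using i(3)[of "\<zero>\<^bsub>A\<^esub>" "\<zero>\<^bsub>A\<^esub>"] i(2)[of "\<zero>\<^bsub>A\<^esub>"] that B.coords_ops(1)[of j "\<phi> \<zero>\<^bsub>A\<^esub>" "\<phi> \<zero>\<^bsub>A\<^esub>"] by simp
  then show ?thesis
    using c i bij_betw_trans[OF i(1) B.coords_bij]
    by (auto simp: alg_coords_def linear_fn_def B.coords_mult)
qed

text \<open>Change of basis: the new basis vector at \<open>t\<close> is \<open>f t\<close> times
  the old one at \<open>\<alpha> t\<close>, which divides the coordinate by \<open>f t\<close> and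
  turns the constants into those of the hypotheses. It serves for renaming indices, for normalizing
  a cocycle and for absorbing a coboundary.\<close>

lemma alg_coords_rescale:
  assumes D: "alg_coords D I' \<gamma>' \<eta>' \<kappa>'" and \<alpha>: "bij_betw \<alpha> I I'"
    and f: "\<And>i. i \<in> I \<Longrightarrow> f i \<noteq> 0"
    and \<gamma>: "\<And>s t u. s \<in> I \<Longrightarrow> t \<in> I \<Longrightarrow> u \<in> I \<Longrightarrow> f u * \<gamma> s t u = f s * f t * \<gamma>' (\<alpha> s) (\<alpha> t) (\<alpha> u)"
    and \<eta>: "\<And>t. t \<in> I \<Longrightarrow> f t * \<eta> t = \<eta>' (\<alpha> t)"
  shows "alg_coords D I \<gamma> \<eta> (\<lambda>x. \<lambda>t\<in>I. \<kappa>' x (\<alpha> t) / f t)"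
proof -
  interpret D: coords D I' \<gamma>' \<eta>' \<kappa>' by unfold_locales (rule D)
  have \<alpha>I: "\<alpha> i \<in> I'" if "i \<in> I" for i using \<alpha> that bij_betwE by blast
  have fin: "finite I" using \<alpha> D.finite_I by (simp add: bij_betw_finite)
  let ?k = "\<lambda>x. \<lambda>t\<in>I. \<kappa>' x (\<alpha> t) / f t"
  let ?a = "inv_into I \<alpha>"
  have a1: "?a (\<alpha> i) = i" if "i \<in> I" for i
    using \<alpha> that by (simp add: bij_betw_def)
  have a2: "\<alpha> (?a j) = j" "?a j \<in> I" if "j \<in> I'" for j
    using \<alpha> that by (auto simp: bij_betw_def f_inv_into_f inv_into_into)
  have "bij_betw ?k (carrier D) (I \<rightarrow>\<^sub>E UNIV)"
  proof (rule bij_betwI[where g = "\<lambda>v. D.of_coords (\<lambda>j. v (?a j) * f (?a j))"])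
    show "D.of_coords (\<lambda>j. ?k x (?a j) * f (?a j)) = x" if "x \<in> carrier D" for x
      by (rule D.coords_eqI) (use a2 f that in auto)
    show "?k (D.of_coords (\<lambda>j. v (?a j) * f (?a j))) = v" if "v \<in> I \<rightarrow>\<^sub>E UNIV" for v
      by (rule PiE_ext[OF _ that]) (use a1 \<alpha>I f in auto)
  qed auto
  moreover have "?k (x \<otimes>\<^bsub>D\<^esub> y) u = (\<Sum>s\<in>I. \<Sum>t\<in>I. \<gamma> s t u * ?k x s * ?k y t)"
    if "x \<in> carrier D" "y \<in> carrier D" "u \<in> I" for x y u
  proof -
    have "\<kappa>' (x \<otimes>\<^bsub>D\<^esub> y) (\<alpha> u) = (\<Sum>s\<in>I'. \<Sum>t\<in>I'. \<gamma>' s t (\<alpha> u) * \<kappa>' x s * \<kappa>' y t)"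
      using that \<alpha>I by (simp add: D.coords_mult)
    also have "\<dots> = (\<Sum>s\<in>I. \<Sum>t\<in>I. \<gamma>' (\<alpha> s) (\<alpha> t) (\<alpha> u) * \<kappa>' x (\<alpha> s) * \<kappa>' y (\<alpha> t))"
      by (simp add: sum.reindex_bij_betw[OF \<alpha>, symmetric])
    also have "\<dots> / f u = (\<Sum>s\<in>I. \<Sum>t\<in>I. \<gamma> s t u * ?k x s * ?k y t)"
    proof -
      have "\<gamma>' (\<alpha> s) (\<alpha> t) (\<alpha> u) * \<kappa>' x (\<alpha> s) * \<kappa>' y (\<alpha> t) / f u = \<gamma> s t u * ?k x s * ?k y t"
        if "s \<in> I" "t \<in> I" for s t
        using \<gamma>[OF that \<open>u \<in> I\<close>] f that \<open>u \<in> I\<close> by (simp add: field_simps)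
      then show ?thesis by (simp add: sum_divide_distrib)
    qed
    finally show ?thesis using that by simp
  qed
  moreover have "?k \<one>\<^bsub>D\<^esub> t = \<eta> t" if "t \<in> I" for t
    using \<eta>[OF that] f[OF that] \<alpha>I[OF that] that by (simp add: field_simps)
  ultimately show ?thesis
    using fin D \<alpha>I by (auto simp: alg_coords_def linear_fn_def add_divide_distrib)
qed

section \<open>Coordinates on tensor products\<close>

text \<open>The common core of the binary product and of the powers. \<open>X\<close> is the set of
  tuples, \<open>v b\<close> a tuple of basis vectors, \<open>g b\<close> the corresponding
  coordinate form. \<open>F_eq\<close> describes the multilinear forms without mentioning
  multilinearity: on \<open>X\<close> they are determined by their values at the basis tuples, with
  the \<open>g b\<close> as coefficient functions.\<close>

locale tensor_basis =
  fixes F :: "('x \<Rightarrow> real) set" and X :: "'x set" and B :: "'b set" and v :: "'b \<Rightarrow> 'x" and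
    g :: "'b \<Rightarrow> 'x \<Rightarrow> real"
  assumes finite_B [simp]: "finite B"
    and v_closed [simp]: "b \<in> B \<Longrightarrow> v b \<in> X"
    and F_eq: "F = {f. \<forall>x\<in>X. f x = (\<Sum>b\<in>B. g b x * f (v b))}"
    and dual: "b \<in> B \<Longrightarrow> b' \<in> B \<Longrightarrow> g b (v b') = (if b' = b then 1 else 0)"
begin

lemma F_expand: "f \<in> F \<Longrightarrow> x \<in> X \<Longrightarrow> f x = (\<Sum>b\<in>B. g b x * f (v b))"
  using F_eq by auto

lemma FI: "(\<And>x. x \<in> X \<Longrightarrow> f x = (\<Sum>b\<in>B. g b x * f (v b))) \<Longrightarrow> f \<in> F"
  using F_eq by auto

lemma sum_dual:
  assumes "c \<in> B"
  shows "(\<Sum>b\<in>B. h b * g b (v c)) = h c" "(\<Sum>b\<in>B. h b * g c (v b)) = h c"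
proof -
  have "(\<Sum>b\<in>B. h b * g b (v c)) = (\<Sum>b\<in>B. if b = c then h c else 0)"
    using assms by (intro sum.cong refl) (simp add: dual)
  then show "(\<Sum>b\<in>B. h b * g b (v c)) = h c" using assms by simp
  have "(\<Sum>b\<in>B. h b * g c (v b)) = (\<Sum>b\<in>B. if b = c then h c else 0)"
    using assms by (intro sum.cong refl) (simp add: dual)
  then show "(\<Sum>b\<in>B. h b * g c (v b)) = h c" using assms by simp
qed

lemma g_in_F [simp]: "b \<in> B \<Longrightarrow> g b \<in> F"
  by (rule FI) (simp add: sum_dual)

lemma inj_on_v: "inj_on v B"
proof (rule inj_onI)
  fix b c assume "b \<in> B" "c \<in> B" "v b = v c"
  then show "b = c" by (metis dual zero_neq_one)
qed

text \<open>An element of the span acts linearly on forms, and on \<open>X\<close> the form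
  \<open>f\<close> is the combination of the \<open>g b\<close> with coefficients
  \<open>f (v b)\<close>. Hence the values at the \<open>g b\<close> are coordinates for the tensor
  product.\<close>

lemma span_expand:
  assumes "s \<in> tensor_span F X" "f \<in> F"
  shows "s f = (\<Sum>b\<in>B. f (v b) * s (g b))"
proof -
  obtain S c where S: "finite S" "S \<subseteq> X" and s: "s = (\<lambda>f. \<Sum>x\<in>S. c x * pure_tensor F x f)"
    using assms(1) by (auto simp: tensor_span_def)
  have s': "s h = (\<Sum>x\<in>S. c x * h x)" if "h \<in> F" for h
    using that by (simp add: s pure_tensor_def)
  have "s f = (\<Sum>x\<in>S. c x * (\<Sum>b\<in>B. g b x * f (v b)))"
    using S F_expand[OF assms(2)] by (simp add: s'[OF assms(2)] subset_iff)
  also have "\<dots> = (\<Sum>b\<in>B. \<Sum>x\<in>S. f (v b) * (c x * g b x))"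
    unfolding sum_distrib_left by (subst sum.swap) (simp add: mult_ac)
  also have "\<dots> = (\<Sum>b\<in>B. f (v b) * s (g b))"
    by (simp add: s' sum_distrib_left)
  finally show ?thesis .
qed

lemma span_outside: "s \<in> tensor_span F X \<Longrightarrow> f \<notin> F \<Longrightarrow> s f = 0"
  by (auto simp: tensor_span_def pure_tensor_def)

lemma spanI:
  assumes "\<And>f. f \<in> F \<Longrightarrow> s f = (\<Sum>b\<in>B. f (v b) * w b)" "\<And>f. f \<notin> F \<Longrightarrow> s f = 0"
  shows "s \<in> tensor_span F X"
proof -
  \<comment> \<open>\<open>tensor_span\<close> sums over a set of tuples, not over indices; since
    \<open>v\<close> is injective, the weights can be carried over to the image of
    \<open>B\<close>.\<close>
  have "s f = (\<Sum>x\<in>v ` B. w (inv_into B v x) * pure_tensor F x f)" for f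
    using assms by (cases "f \<in> F") (simp_all add: sum.reindex[OF inj_on_v] inj_on_v pure_tensor_def mult.commute)
  then show ?thesis
    unfolding tensor_span_def by (intro CollectI exI[of _ "v ` B"] exI[of _ "\<lambda>x. w (inv_into B v x)"]) auto
qed

text \<open>For the homogeneous components of a product grading: if only \<open>g b\<close> can be
  nonzero on \<open>Y\<close>, the pure tensors of elements of \<open>Y\<close> all lie on the line
  through the pure tensor of \<open>v b\<close>.\<close>

lemma tensor_span_component:
  assumes "b \<in> B" "Y \<subseteq> X" "v b \<in> Y" "\<And>y b'. y \<in> Y \<Longrightarrow> b' \<in> B \<Longrightarrow> b' \<noteq> b \<Longrightarrow> g b' y = 0"
  shows "tensor_span F Y = {s \<in> tensor_span F X. \<forall>b'\<in>B. b' \<noteq> b \<longrightarrow> s (g b') = 0}"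
proof (intro equalityI subsetI)
  fix s assume "s \<in> tensor_span F Y"
  then obtain S c where S: "finite S" "S \<subseteq> Y" and s: "s = (\<lambda>f. \<Sum>x\<in>S. c x * pure_tensor F x f)"
    by (auto simp: tensor_span_def)
  have "s \<in> tensor_span F X"
    unfolding tensor_span_def using S s assms(2)
    by (intro CollectI exI[of _ S] exI[of _ c]) auto
  moreover have "s (g b') = 0" if "b' \<in> B" "b' \<noteq> b" for b'
    unfolding s using that S assms(4) by (intro sum.neutral) (auto simp: pure_tensor_def)
  ultimately show "s \<in> {s \<in> tensor_span F X. \<forall>b'\<in>B. b' \<noteq> b \<longrightarrow> s (g b') = 0}" by blast
next
  fix s assume s: "s \<in> {s \<in> tensor_span F X. \<forall>b'\<in>B. b' \<noteq> b \<longrightarrow> s (g b') = 0}"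
  have eq: "s f = s (g b) * pure_tensor F (v b) f" for f
  proof (cases "f \<in> F")
    case True
    have "s f = (\<Sum>b'\<in>B. f (v b') * s (g b'))" using s True span_expand by blast
    also have "\<dots> = (\<Sum>b'\<in>B. if b' = b then f (v b) * s (g b) else 0)"
      using s by (intro sum.cong) auto
    finally show ?thesis using assms(1) True by (simp add: pure_tensor_def)
  next
    case False
    then show ?thesis using s span_outside[of s f] by (simp add: pure_tensor_def)
  qed
  have "s = (\<lambda>f. \<Sum>x\<in>{v b}. s (g b) * pure_tensor F x f)"
    by (rule ext, subst eq) simp
  then show "s \<in> tensor_span F Y"
    unfolding tensor_span_def using assms(3)
    by (intro CollectI exI[of _ "{v b}"] exI[of _ "\<lambda>x. s (g b)"] conjI) simp_all
qed

text \<open>The product evaluates first \<open>t\<close> and then \<open>s\<close> on partial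
  functions of \<open>f (p x y)\<close>. Once these are seen to be forms themselves,
  \<open>span_expand\<close> applies twice and gives the bilinear formula.\<close>

lemma alg_coords_tensor_alg:
  assumes p: "\<And>x y. x \<in> X \<Longrightarrow> y \<in> X \<Longrightarrow> p x y \<in> X" and e: "e \<in> X"
    and \<gamma>: "\<And>x y c. x \<in> X \<Longrightarrow> y \<in> X \<Longrightarrow> c \<in> B \<Longrightarrow>
      g c (p x y) = (\<Sum>a\<in>B. \<Sum>b\<in>B. \<gamma> a b c * g a x * g b y)"
  shows "alg_coords (tensor_alg F X p e) B \<gamma> (\<lambda>b. g b e) (\<lambda>s. \<lambda>b\<in>B. s (g b))"
proof -
  let ?A = "tensor_alg F X p e" and ?C = "tensor_span F X" and ?\<kappa> = "\<lambda>s. \<lambda>b\<in>B. s (g b)"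
  \<comment> \<open>For a form \<open>f\<close> this is its value at the product of the basis tuples
    \<open>v a\<close> and \<open>v b\<close>, written through the structure constants.\<close>
  define M where "M f a b = (\<Sum>c\<in>B. \<gamma> a b c * f (v c))" for f a b
  have f_p: "f (p x y) = (\<Sum>a\<in>B. \<Sum>b\<in>B. M f a b * g a x * g b y)"
    if "f \<in> F" "x \<in> X" "y \<in> X" for f x y
  proof -
    have "f (p x y) = (\<Sum>c\<in>B. \<Sum>a\<in>B. \<Sum>b\<in>B. \<gamma> a b c * g a x * g b y * f (v c))"
      using that by (simp add: F_expand[of f "p x y"] p \<gamma> sum_distrib_right)
    also have "\<dots> = (\<Sum>a\<in>B. \<Sum>c\<in>B. \<Sum>b\<in>B. \<gamma> a b c * g a x * g b y * f (v c))"
      by (rule sum.swap)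
    also have "\<dots> = (\<Sum>a\<in>B. \<Sum>b\<in>B. \<Sum>c\<in>B. \<gamma> a b c * g a x * g b y * f (v c))"
      by (rule sum.cong[OF refl], rule sum.swap)
    finally show ?thesis by (simp add: M_def sum_distrib_right sum_distrib_left mult_ac)
  qed
  have f_pv: "f (p x (v b)) = (\<Sum>a\<in>B. M f a b * g a x)" if "f \<in> F" "x \<in> X" "b \<in> B" for f x b
    using that by (simp add: f_p sum_dual)
  have left_F: "(\<lambda>y. f (p x y)) \<in> F" if "f \<in> F" "x \<in> X" for f x
  proof (rule FI)
    fix y assume y: "y \<in> X"
    have "f (p x y) = (\<Sum>b\<in>B. \<Sum>a\<in>B. M f a b * g a x * g b y)"
      using that y by (subst f_p) (auto intro: sum.swap)
    also have "\<dots> = (\<Sum>b\<in>B. g b y * f (p x (v b)))"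
      using that by (simp add: f_pv sum_distrib_left mult_ac)
    finally show "f (p x y) = (\<Sum>b\<in>B. g b y * f (p x (v b)))" .
  qed
  have t_p: "t (\<lambda>y. f (p x y)) = (\<Sum>a\<in>B. g a x * (\<Sum>b\<in>B. M f a b * t (g b)))"
    if "f \<in> F" "t \<in> ?C" "x \<in> X" for f t x
  proof -
    have "t (\<lambda>y. f (p x y)) = (\<Sum>b\<in>B. f (p x (v b)) * t (g b))"
      using span_expand[OF that(2) left_F[OF that(1,3)]] .
    also have "\<dots> = (\<Sum>b\<in>B. \<Sum>a\<in>B. M f a b * g a x * t (g b))"
      using that by (simp add: f_pv sum_distrib_right)
    also have "\<dots> = (\<Sum>a\<in>B. \<Sum>b\<in>B. M f a b * g a x * t (g b))"
      by (rule sum.swap)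
    finally show ?thesis by (simp add: sum_distrib_left mult_ac)
  qed
  have mult: "(s \<otimes>\<^bsub>?A\<^esub> t) f = (\<Sum>a\<in>B. \<Sum>b\<in>B. M f a b * s (g a) * t (g b))"
    if "f \<in> F" "s \<in> ?C" "t \<in> ?C" for f s t
  proof -
    let ?h = "\<lambda>x. t (\<lambda>y. f (p x y))"
    have hv: "?h (v a) = (\<Sum>b\<in>B. M f a b * t (g b))" if "a \<in> B" for a
      using that \<open>f \<in> F\<close> \<open>t \<in> ?C\<close> sum_dual(1)[OF that, of "\<lambda>a. \<Sum>b\<in>B. M f a b * t (g b)"]
      by (simp add: t_p mult.commute)
    have "?h x = (\<Sum>b\<in>B. g b x * ?h (v b))" if "x \<in> X" for x
      unfolding t_p[OF \<open>f \<in> F\<close> \<open>t \<in> ?C\<close> that] by (intro sum.cong refl) (simp only: hv)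
    then have "?h \<in> F" by (rule FI)
    then have "(s \<otimes>\<^bsub>?A\<^esub> t) f = (\<Sum>a\<in>B. ?h (v a) * s (g a))"
      using span_expand[OF that(2)] that(1) by (simp add: tensor_alg_def)
    then show ?thesis by (simp add: hv sum_distrib_left mult_ac)
  qed
  have M_g: "M (g c) a b = \<gamma> a b c" if "c \<in> B" for a b c
    using that by (simp add: M_def sum_dual)
  have closed: "s \<otimes>\<^bsub>?A\<^esub> t \<in> ?C" if st: "s \<in> ?C" "t \<in> ?C" for s t
  proof (rule spanI)
    fix f assume f: "f \<in> F"
    have "(s \<otimes>\<^bsub>?A\<^esub> t) f = (\<Sum>a\<in>B. \<Sum>b\<in>B. \<Sum>c\<in>B. f (v c) * (\<gamma> a b c * s (g a) * t (g b)))"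
      by (simp add: mult f st M_def sum_distrib_left sum_distrib_right mult_ac)
    also have "\<dots> = (\<Sum>a\<in>B. \<Sum>c\<in>B. \<Sum>b\<in>B. f (v c) * (\<gamma> a b c * s (g a) * t (g b)))"
      by (rule sum.cong[OF refl], rule sum.swap)
    also have "\<dots> = (\<Sum>c\<in>B. \<Sum>a\<in>B. \<Sum>b\<in>B. f (v c) * (\<gamma> a b c * s (g a) * t (g b)))"
      by (rule sum.swap)
    finally show "(s \<otimes>\<^bsub>?A\<^esub> t) f =
        (\<Sum>c\<in>B. f (v c) * (\<Sum>a\<in>B. \<Sum>b\<in>B. \<gamma> a b c * s (g a) * t (g b)))"
      by (simp add: sum_distrib_left)
  next
    fix f assume "f \<notin> F"
    then show "(s \<otimes>\<^bsub>?A\<^esub> t) f = 0" by (simp add: tensor_alg_def)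
  qed
  have eC: "pure_tensor F e \<in> ?C"
  proof (rule spanI)
    show "pure_tensor F e f = (\<Sum>b\<in>B. f (v b) * g b e)" if "f \<in> F" for f
      using F_expand[OF that e] that by (simp add: pure_tensor_def mult.commute)
  qed (simp add: pure_tensor_def)
  have zC: "(\<lambda>f. 0) \<in> ?C" by (rule spanI[where w = "\<lambda>b. 0"]) auto
  have aC: "(\<lambda>f. s f + t f) \<in> ?C" if "s \<in> ?C" "t \<in> ?C" for s t
  proof (rule spanI)
    show "s f + t f = (\<Sum>b\<in>B. f (v b) * (s (g b) + t (g b)))" if "f \<in> F" for f
      unfolding span_expand[OF \<open>s \<in> ?C\<close> that] span_expand[OF \<open>t \<in> ?C\<close> that]
      by (simp add: sum.distrib distrib_left)
  qed (simp add: that span_outside)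
  have sC: "(\<lambda>f. c * s f) \<in> ?C" if "s \<in> ?C" for c s
  proof (rule spanI)
    show "c * s f = (\<Sum>b\<in>B. f (v b) * (c * s (g b)))" if "f \<in> F" for f
      unfolding span_expand[OF \<open>s \<in> ?C\<close> that] by (simp add: sum_distrib_left mult_ac)
  qed (simp add: that span_outside)
  have "alg_ops_closed ?A"
    using closed eC zC aC sC unfolding alg_ops_closed_def by (simp add: tensor_alg_def)
  moreover have "bij_betw ?\<kappa> ?C (B \<rightarrow>\<^sub>E UNIV)"
  proof (rule bij_betwI[where g = "\<lambda>w f. if f \<in> F then \<Sum>b\<in>B. f (v b) * w b else 0"])
    show "(\<lambda>w f. if f \<in> F then \<Sum>b\<in>B. f (v b) * w b else 0) \<in> (B \<rightarrow>\<^sub>E UNIV) \<rightarrow> ?C"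
      by (auto intro!: spanI)
    show "(\<lambda>f. if f \<in> F then \<Sum>b\<in>B. f (v b) * ?\<kappa> s b else 0) = s" if "s \<in> ?C" for s
    proof (rule ext)
      fix f
      show "(if f \<in> F then \<Sum>b\<in>B. f (v b) * ?\<kappa> s b else 0) = s f"
        using span_expand[OF that, of f] span_outside[OF that, of f] by simp
    qed
    show "?\<kappa> (\<lambda>f. if f \<in> F then \<Sum>b\<in>B. f (v b) * w b else 0) = w" if w: "w \<in> B \<rightarrow>\<^sub>E UNIV" for w
      by (rule PiE_ext[OF _ w]) (simp_all add: mult.commute[of "g _ _"] sum_dual)
  qed auto
  moreover have "(s \<otimes>\<^bsub>?A\<^esub> t) (g u) = (\<Sum>a\<in>B. \<Sum>b\<in>B. \<gamma> a b u * s (g a) * t (g b))"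
    if "s \<in> ?C" "t \<in> ?C" "u \<in> B" for s t u
    using that by (simp add: mult M_g)
  ultimately show ?thesis
    unfolding alg_coords_def linear_fn_def
    by (simp add: tensor_alg_def pure_tensor_def cong: restrict_cong)
qed

end

lemma tensor_basis_tensor:
  assumes A: "alg_coords A I \<gamma> \<eta> \<kappa>" and B: "alg_coords B J \<gamma>' \<eta>' \<kappa>'"
  shows "tensor_basis (bilinear_forms A B) (carrier A \<times> carrier B) (I \<times> J)
    (\<lambda>(i, j). (coords.basis_vec A I \<kappa> i, coords.basis_vec B J \<kappa>' j)) (\<lambda>(i, j) (x, y). \<kappa> x i * \<kappa>' y j)"
proof -
  interpret A: coords A I \<gamma> \<eta> \<kappa> by unfold_locales (rule A)
  interpret B: coords B J \<gamma>' \<eta>' \<kappa>' by unfold_locales (rule B)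
  let ?F = "bilinear_forms A B"
  have expand: "f (x, y) = (\<Sum>i\<in>I. \<Sum>j\<in>J. \<kappa> x i * \<kappa>' y j * f (A.basis_vec i, B.basis_vec j))"
    if f: "f \<in> ?F" and xy: "x \<in> carrier A" "y \<in> carrier B" for f x y
  proof -
    have "f (x, y) = (\<Sum>i\<in>I. \<kappa> x i * f (A.basis_vec i, y))"
      by (rule A.linear_fn_expand[where h = "\<lambda>x. f (x, y)"])
        (use f xy in \<open>auto simp: bilinear_forms_def linear_fn_def\<close>)
    moreover have "f (A.basis_vec i, y) = (\<Sum>j\<in>J. \<kappa>' y j * f (A.basis_vec i, B.basis_vec j))" for i
      by (rule B.linear_fn_expand[where h = "\<lambda>y. f (A.basis_vec i, y)"])
        (use f xy in \<open>auto simp: bilinear_forms_def linear_fn_def\<close>)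
    ultimately show ?thesis by (simp add: sum_distrib_left mult_ac)
  qed
  have "?F = {f. \<forall>x\<in>carrier A. \<forall>y\<in>carrier B.
      f (x, y) = (\<Sum>i\<in>I. \<Sum>j\<in>J. \<kappa> x i * \<kappa>' y j * f (A.basis_vec i, B.basis_vec j))}" (is "_ = ?R")
  proof (intro equalityI subsetI)
    fix f assume f: "f \<in> ?R"
    have e: "f (x, y) = (\<Sum>i\<in>I. \<Sum>j\<in>J. \<kappa> x i * \<kappa>' y j * f (A.basis_vec i, B.basis_vec j))"
      if "x \<in> carrier A" "y \<in> carrier B" for x y
      using f that by blast
    show "f \<in> ?F"
      unfolding bilinear_forms_def
    proof (intro CollectI conjI ballI allI)
      fix x x' y assume xy: "x \<in> carrier A" "x' \<in> carrier A" "y \<in> carrier B"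
      show "f (x \<oplus>\<^bsub>A\<^esub> x', y) = f (x, y) + f (x', y)"
        using xy by (simp add: e sum.distrib[symmetric] algebra_simps del: sum.distrib)
    next
      fix x y y' assume xy: "x \<in> carrier A" "y \<in> carrier B" "y' \<in> carrier B"
      show "f (x, y \<oplus>\<^bsub>B\<^esub> y') = f (x, y) + f (x, y')"
        using xy by (simp add: e sum.distrib[symmetric] algebra_simps del: sum.distrib)
    next
      fix c x y assume xy: "x \<in> carrier A" "y \<in> carrier B"
      show "f (c \<odot>\<^bsub>A\<^esub> x, y) = c * f (x, y)" "f (x, c \<odot>\<^bsub>B\<^esub> y) = c * f (x, y)"
        using xy by (simp_all add: e sum_distrib_left mult_ac)
    qed
  qed (use expand in blast)
  then have F: "?F = {f. \<forall>x\<in>carrier A \<times> carrier B.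
      f x = (\<Sum>b\<in>I \<times> J. (case b of (i, j) \<Rightarrow> \<lambda>(x, y). \<kappa> x i * \<kappa>' y j) x *
        f (case b of (i, j) \<Rightarrow> (A.basis_vec i, B.basis_vec j)))}"
    by (simp add: sum.cartesian_product' case_prod_beta Ball_def) blast
  show ?thesis
    by (unfold_locales; (rule F)?) (auto split: prod.splits)
qed

lemma alg_coords_tensor:
  assumes A: "alg_coords A I \<gamma> \<eta> \<kappa>" and B: "alg_coords B J \<gamma>' \<eta>' \<kappa>'"
  shows "alg_coords (tensor A B) (I \<times> J)
    (\<lambda>a b c. \<gamma> (fst a) (fst b) (fst c) * \<gamma>' (snd a) (snd b) (snd c))
    (\<lambda>a. \<eta> (fst a) * \<eta>' (snd a)) (\<lambda>s. \<lambda>(i, j)\<in>I \<times> J. s (\<lambda>(x, y). \<kappa> x i * \<kappa>' y j))"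
proof -
  interpret A: coords A I \<gamma> \<eta> \<kappa> by unfold_locales (rule A)
  interpret B: coords B J \<gamma>' \<eta>' \<kappa>' by unfold_locales (rule B)
  let ?g = "\<lambda>(i, j) (x, y). \<kappa> x i * \<kappa>' y j"
  interpret T: tensor_basis "bilinear_forms A B" "carrier A \<times> carrier B" "I \<times> J"
    "\<lambda>(i, j). (A.basis_vec i, B.basis_vec j)" ?g
    by (rule tensor_basis_tensor[OF A B])
  have "alg_coords (tensor A B) (I \<times> J)
    (\<lambda>a b c. \<gamma> (fst a) (fst b) (fst c) * \<gamma>' (snd a) (snd b) (snd c))
    (\<lambda>a. ?g a (\<one>\<^bsub>A\<^esub>, \<one>\<^bsub>B\<^esub>)) (\<lambda>s. \<lambda>b\<in>I \<times> J. s (?g b))"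
    unfolding tensor_def
  proof (rule T.alg_coords_tensor_alg)
    fix x y c assume x: "x \<in> carrier A \<times> carrier B" and y: "y \<in> carrier A \<times> carrier B"
      and c: "c \<in> I \<times> J"
    obtain x1 x2 y1 y2 c1 c2 where xyc: "x = (x1, x2)" "y = (y1, y2)" "c = (c1, c2)"
      by (meson surj_pair)
    have "\<kappa> (x1 \<otimes>\<^bsub>A\<^esub> y1) c1 * \<kappa>' (x2 \<otimes>\<^bsub>B\<^esub> y2) c2 =
      (\<Sum>a1\<in>I. \<Sum>b1\<in>I. \<Sum>a2\<in>J. \<Sum>b2\<in>J. \<gamma> a1 b1 c1 * \<kappa> x1 a1 * \<kappa> y1 b1 * (\<gamma>' a2 b2 c2 * \<kappa>' x2 a2 * \<kappa>' y2 b2))"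
      using x y c xyc
      by (simp add: A.coords_mult B.coords_mult, simp only: sum_distrib_right, simp only: sum_distrib_left)
    also have "\<dots> =
      (\<Sum>a1\<in>I. \<Sum>a2\<in>J. \<Sum>b1\<in>I. \<Sum>b2\<in>J. \<gamma> a1 b1 c1 * \<kappa> x1 a1 * \<kappa> y1 b1 * (\<gamma>' a2 b2 c2 * \<kappa>' x2 a2 * \<kappa>' y2 b2))"
      by (rule sum.cong[OF refl], rule sum.swap)
    finally show "?g c (fst x \<otimes>\<^bsub>A\<^esub> fst y, snd x \<otimes>\<^bsub>B\<^esub> snd y) =
      (\<Sum>a\<in>I \<times> J. \<Sum>b\<in>I \<times> J. \<gamma> (fst a) (fst b) (fst c) * \<gamma>' (snd a) (snd b) (snd c) * ?g a x * ?g b y)"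
      unfolding sum.cartesian_product' by (simp add: xyc mult_ac)
  qed auto
  then show ?thesis
    by (auto simp: alg_coords_def linear_fn_def case_prod_beta cong: restrict_cong)
qed

section \<open>Multilinear forms and tensor powers\<close>

lemma multilinear_formsD:
  assumes "f \<in> multilinear_forms m A" "x \<in> {..<m} \<rightarrow>\<^sub>E carrier A" "i < m"
  shows "linear_fn A (\<lambda>a. f (x(i := a)))"
  using assms unfolding multilinear_forms_def linear_fn_def by blast

lemma multilinear_formsI:
  assumes "\<And>x i. x \<in> {..<m} \<rightarrow>\<^sub>E carrier A \<Longrightarrow> i < m \<Longrightarrow> linear_fn A (\<lambda>a. f (x(i := a)))"
  shows "f \<in> multilinear_forms m A"
  using assms unfolding multilinear_forms_def linear_fn_def by blast

text \<open>A multilinear form is determined by its values at basis tuples, and the products of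
  coordinates are multilinear and dual to these tuples; so every form equals the combination of them
  with its own values as coefficients.\<close>

lemma tensor_basis_power:
  assumes A: "alg_coords A I \<gamma> \<eta> \<kappa>"
  shows "tensor_basis (multilinear_forms m A) ({..<m} \<rightarrow>\<^sub>E carrier A) ({..<m} \<rightarrow>\<^sub>E I)
    (\<lambda>b. \<lambda>i\<in>{..<m}. coords.basis_vec A I \<kappa> (b i)) (\<lambda>b x. \<Prod>i<m. \<kappa> (x i) (b i))"
proof -
  interpret A: coords A I \<gamma> \<eta> \<kappa> by unfold_locales (rule A)
  let ?F = "multilinear_forms m A" and ?X = "{..<m} \<rightarrow>\<^sub>E carrier A" and ?B = "{..<m} \<rightarrow>\<^sub>E I"
  let ?v = "\<lambda>b. \<lambda>i\<in>{..<m}. A.basis_vec (b i)" and ?g = "\<lambda>b x. \<Prod>i<m. \<kappa> (x i) (b i)"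
  have finB: "finite ?B" by (rule finite_PiE) auto
  have upd: "x(i := a) \<in> ?X" if "x \<in> ?X" "i < m" "a \<in> carrier A" for x i a
    using that by (auto simp: PiE_def Pi_def extensional_def)
  have dual: "?g b (?v b') = (if b' = b then 1 else 0)" if "b \<in> ?B" "b' \<in> ?B" for b b'
  proof -
    have "?g b (?v b') = (\<Prod>i<m. if b i = b' i then 1 else 0)"
      by (rule prod.cong[OF refl]) (use that in \<open>simp add: PiE_iff\<close>)
    also have "\<dots> = (if b' = b then 1 else 0)"
    proof (cases "b' = b")
      case False
      have "\<not> (\<forall>i\<in>{..<m}. b i = b' i)"
        using False PiE_ext[OF that] by blast
      then obtain i where "i < m" "b i \<noteq> b' i" by auto
      then have "(\<Prod>i<m. if b i = b' i then 1 else (0::real)) = 0" by (intro prod_zero) auto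
      then show ?thesis using False by simp
    qed simp
    finally show ?thesis .
  qed
  have g_lin: "linear_fn A (\<lambda>a. ?g b (x(i := a)))" if "b \<in> ?B" "i < m" for b x i
  proof -
    have "?g b (x(i := a)) = \<kappa> a (b i) * (\<Prod>j\<in>{..<m} - {i}. \<kappa> (x j) (b j))" for a
      using that(2) by (simp add: prod.remove[of "{..<m}" i])
    moreover have "b i \<in> I" using that by auto
    ultimately show ?thesis
      by (simp add: linear_fn_def algebra_simps)
  qed
  have comb_lin: "(\<lambda>x. \<Sum>b\<in>?B. ?g b x * c b) \<in> ?F" for c
  proof (rule multilinear_formsI)
    fix x i assume "i < m"
    then have "?g b (x(i := a \<oplus>\<^bsub>A\<^esub> a')) = ?g b (x(i := a)) + ?g b (x(i := a'))"
        "?g b (x(i := k \<odot>\<^bsub>A\<^esub> a)) = k * ?g b (x(i := a))"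
      if "b \<in> ?B" "a \<in> carrier A" "a' \<in> carrier A" for a a' b k
      using g_lin[of b i x] that unfolding linear_fn_def by blast+
    then show "linear_fn A (\<lambda>a. \<Sum>b\<in>?B. ?g b (x(i := a)) * c b)"
      by (simp add: linear_fn_def sum.distrib distrib_right sum_distrib_left mult.assoc
          del: fun_upd_apply cong: sum.cong)
  qed
  have agree: "f x = f' x"
    if f: "f \<in> ?F" "f' \<in> ?F" and v: "\<And>b. b \<in> ?B \<Longrightarrow> f (?v b) = f' (?v b)" and x: "x \<in> ?X" for f f' x
  proof -
    \<comment> \<open>Induction on the number \<open>k\<close> of leading entries that are still
      arbitrary; passing to \<open>Suc k\<close>, the entry at place \<open>k\<close> is expanded in
      the basis. At \<open>k = m\<close> nothing is assumed about the entries.\<close>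
    have "f x = f' x" if "x \<in> ?X" "\<And>i. k \<le> i \<Longrightarrow> i < m \<Longrightarrow> x i \<in> A.basis_vec ` I" "k \<le> m" for k x
      using that
    proof (induction k arbitrary: x)
      case 0
      then have "\<forall>i\<in>{..<m}. \<exists>j. j \<in> I \<and> x i = A.basis_vec j" by auto
      then obtain b where b: "\<And>i. i < m \<Longrightarrow> b i \<in> I \<and> x i = A.basis_vec (b i)"
        by (metis lessThan_iff)
      have "x = ?v (restrict b {..<m})"
        by (rule PiE_ext[OF 0(1)]) (use b in auto)
      moreover have "restrict b {..<m} \<in> ?B" using b by auto
      ultimately show ?case using v by metis
    next
      case (Suc k)
      then have k: "k < m" by simp
      have xk: "x k \<in> carrier A" using Suc.prems(1) k by auto
      have "f (x(k := x k)) = (\<Sum>i\<in>I. \<kappa> (x k) i * f (x(k := A.basis_vec i)))"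
        by (rule A.linear_fn_expand[OF multilinear_formsD[OF f(1) Suc.prems(1) k] xk])
      also have "\<dots> = (\<Sum>i\<in>I. \<kappa> (x k) i * f' (x(k := A.basis_vec i)))"
      proof (intro sum.cong refl arg_cong2[where f = "(*)"])
        fix i assume i: "i \<in> I"
        show "f (x(k := A.basis_vec i)) = f' (x(k := A.basis_vec i))"
        proof (rule Suc.IH)
          fix j assume "k \<le> j" "j < m"
          then show "(x(k := A.basis_vec i)) j \<in> A.basis_vec ` I"
            using Suc.prems(2)[of j] i by (cases "j = k") auto
        qed (use Suc.prems upd k in auto)
      qed
      also have "\<dots> = f' (x(k := x k))"
        by (rule A.linear_fn_expand[OF multilinear_formsD[OF f(2) Suc.prems(1) k] xk, symmetric])
      finally show ?case by simp
    qed
    from this[OF x, of m] show ?thesis by simp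
  qed
  have vX: "?v b \<in> ?X" for b by auto
  have comb_v: "(\<Sum>b'\<in>?B. ?g b' (?v b) * c b') = c b" if b: "b \<in> ?B" for b c
  proof -
    have "(\<Sum>b'\<in>?B. ?g b' (?v b) * c b') = (\<Sum>b'\<in>?B. if b' = b then c b else 0)"
      by (rule sum.cong[OF refl]) (use dual[OF _ b] in auto)
    then show ?thesis using b finB by simp
  qed
  have F: "?F = {f. \<forall>x\<in>?X. f x = (\<Sum>b\<in>?B. ?g b x * f (?v b))}"
  proof (intro equalityI subsetI CollectI ballI)
    fix f x assume fx: "f \<in> ?F" "x \<in> ?X"
    show "f x = (\<Sum>b\<in>?B. ?g b x * f (?v b))"
      by (rule agree[OF fx(1) comb_lin _ fx(2)]) (rule comb_v[symmetric])
  next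
    fix f assume f: "f \<in> {f. \<forall>x\<in>?X. f x = (\<Sum>b\<in>?B. ?g b x * f (?v b))}"
    show "f \<in> ?F"
    proof (rule multilinear_formsI)
      fix x i assume xi: "x \<in> ?X" "i < m"
      let ?h = "\<lambda>x. \<Sum>b\<in>?B. ?g b x * f (?v b)"
      have e: "f (x(i := a)) = ?h (x(i := a))" if "a \<in> carrier A" for a
        using f upd[OF xi that] by blast
      show "linear_fn A (\<lambda>a. f (x(i := a)))"
        using multilinear_formsD[OF comb_lin[of "\<lambda>b. f (?v b)"] xi] e
        unfolding linear_fn_def by simp
    qed
  qed
  show ?thesis
    by unfold_locales (use finB vX F dual in blast)+
qed

lemma alg_coords_tensor_power:
  assumes A: "alg_coords A I \<gamma> \<eta> \<kappa>"
  shows "alg_coords (tensor_power m A) ({..<m} \<rightarrow>\<^sub>E I)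
    (\<lambda>a b c. \<Prod>i<m. \<gamma> (a i) (b i) (c i)) (\<lambda>b. \<Prod>i<m. \<eta> (b i))
    (\<lambda>s. \<lambda>b\<in>{..<m} \<rightarrow>\<^sub>E I. s (\<lambda>x. \<Prod>i<m. \<kappa> (x i) (b i)))"
proof -
  interpret A: coords A I \<gamma> \<eta> \<kappa> by unfold_locales (rule A)
  let ?B = "{..<m} \<rightarrow>\<^sub>E I" and ?g = "\<lambda>b x. \<Prod>i<m. \<kappa> (x i) (b i)"
  interpret T: tensor_basis "multilinear_forms m A" "{..<m} \<rightarrow>\<^sub>E carrier A" ?B
    "\<lambda>b. \<lambda>i\<in>{..<m}. A.basis_vec (b i)" ?g
    by (rule tensor_basis_power[OF A])
  have "alg_coords (tensor_power m A) ?B (\<lambda>a b c. \<Prod>i<m. \<gamma> (a i) (b i) (c i))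
      (\<lambda>b. ?g b (\<lambda>i\<in>{..<m}. \<one>\<^bsub>A\<^esub>)) (\<lambda>s. \<lambda>b\<in>?B. s (?g b))"
    unfolding tensor_power_def
  proof (rule T.alg_coords_tensor_alg)
    fix x y c assume x: "x \<in> {..<m} \<rightarrow>\<^sub>E carrier A" and y: "y \<in> {..<m} \<rightarrow>\<^sub>E carrier A" and c: "c \<in> ?B"
    have "?g c (\<lambda>i\<in>{..<m}. x i \<otimes>\<^bsub>A\<^esub> y i) =
        (\<Prod>i<m. \<Sum>a\<in>I. \<Sum>b\<in>I. \<gamma> a b (c i) * \<kappa> (x i) a * \<kappa> (y i) b)"
      using x y c by (intro prod.cong) (auto simp: A.coords_mult PiE_iff)
    \<comment> \<open>Expanding a product of sums means choosing one summand for each factor, that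
      is, an index function in \<open>?B\<close>; this is done for \<open>a\<close> and then for
      \<open>b\<close>.\<close>
    also have "\<dots> = (\<Sum>a\<in>?B. \<Prod>i<m. \<Sum>b\<in>I. \<gamma> (a i) b (c i) * \<kappa> (x i) (a i) * \<kappa> (y i) b)"
      by (rule prod_sum_PiE) auto
    also have "\<dots> = (\<Sum>a\<in>?B. \<Sum>b\<in>?B. \<Prod>i<m. \<gamma> (a i) (b i) (c i) * \<kappa> (x i) (a i) * \<kappa> (y i) (b i))"
      by (intro sum.cong refl prod_sum_PiE) auto
    finally show "?g c (\<lambda>i\<in>{..<m}. x i \<otimes>\<^bsub>A\<^esub> y i) =
        (\<Sum>a\<in>?B. \<Sum>b\<in>?B. (\<Prod>i<m. \<gamma> (a i) (b i) (c i)) * ?g a x * ?g b y)"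
      by (simp add: prod.distrib)
  qed auto
  moreover have "?g b (\<lambda>i\<in>{..<m}. \<one>\<^bsub>A\<^esub>) = (\<Prod>i<m. \<eta> (b i))" if "b \<in> ?B" for b
    using that by (intro prod.cong) (auto simp: PiE_iff)
  ultimately show ?thesis by (simp add: alg_coords_def)
qed

section \<open>Matrix algebras\<close>

lemma cring_real_field: "cring real_field"
proof (rule cringI)
  show "abelian_group real_field"
    by (rule abelian_groupI) (auto simp: real_field_def intro: exI[of _ "- _"] left_minus)
  show "comm_monoid real_field"
    by (rule comm_monoidI) (auto simp: real_field_def)
qed (auto simp: real_field_def algebra_simps)

lemma real_alg_class_alg: "real_alg (class_alg TYPE('a::real_algebra_1))"
proof -
  have ab: "abelian_group (class_alg TYPE('a))"
    by (rule abelian_groupI) (auto simp: class_alg_def add_ac intro: exI[of _ "- _"] left_minus)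
  moreover have "ring (class_alg TYPE('a))"
    by (rule ringI[OF ab monoidI]) (auto simp: class_alg_def algebra_simps)
  moreover have "module real_field (class_alg TYPE('a))"
    by (rule moduleI[OF cring_real_field ab]) (auto simp: class_alg_def real_field_def algebra_simps)
  ultimately show ?thesis by (auto simp: real_alg_def class_alg_def)
qed

lemma real_alg_mat_alg: "real_alg (mat_alg TYPE('a::real_algebra_1) n)"
proof -
  let ?A = "mat_alg TYPE('a) n"
  have ab: "abelian_group ?A"
  proof (rule abelian_groupI)
    fix x assume "x \<in> carrier ?A"
    then show "\<exists>y\<in>carrier ?A. y \<oplus>\<^bsub>?A\<^esub> x = \<zero>\<^bsub>?A\<^esub>"
      by (intro bexI[of _ "- x"]) (auto simp: mat_alg_def)
  qed (auto simp: mat_alg_def assoc_add_mat comm_add_mat[of _ n n])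
  moreover have r: "ring ?A"
    by (rule ringI[OF ab monoidI])
      (auto simp: mat_alg_def assoc_mult_mat[of _ n n _ n _ n] add_mult_distrib_mat[of _ n n _ _ n]
        mult_add_distrib_mat[of _ n n _ n])
  moreover have "module real_field ?A"
    by (rule moduleI[OF cring_real_field ab])
      (auto simp: mat_alg_def real_field_def algebra_simps intro!: eq_matI)
  moreover have "map_mat ((*\<^sub>R) c) x * y = map_mat ((*\<^sub>R) c) (x * y)"
    "x * map_mat ((*\<^sub>R) c) y = map_mat ((*\<^sub>R) c) (x * y)"
    if "x \<in> carrier_mat n n" "y \<in> carrier_mat n n" for c and x y :: "'a mat"
    using that by (auto intro!: eq_matI simp: scalar_prod_def scaleR_right.sum)
  ultimately show ?thesis unfolding real_alg_def by (simp add: mat_alg_def)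
qed

lemma index_mult_mat_sum:
  assumes "M \<in> carrier_mat n n" "N \<in> carrier_mat n n" "i < n" "j < n"
  shows "(M * N) $$ (i, j) = (\<Sum>k<n. M $$ (i, k) * N $$ (k, j))"
  using assms by (auto simp: scalar_prod_def lessThan_atLeast0 intro!: sum.cong)

text \<open>The structure constants of the matrix units.\<close>

definition mat_gamma :: "nat \<times> nat \<Rightarrow> nat \<times> nat \<Rightarrow> nat \<times> nat \<Rightarrow> real" where
  "mat_gamma s t u = (if snd s = fst t \<and> fst s = fst u \<and> snd t = snd u then 1 else 0)"

lemma sum_mat_gamma:
  assumes "i < n" "j < n"
  shows "(\<Sum>s\<in>{..<n} \<times> {..<n}. \<Sum>t\<in>{..<n} \<times> {..<n}. mat_gamma s t (i, j) * f s t) =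
    (\<Sum>k<n. f (i, k) (k, j))"
proof -
  have "(\<Sum>s\<in>{..<n} \<times> {..<n}. \<Sum>t\<in>{..<n} \<times> {..<n}. mat_gamma s t (i, j) * f s t) =
      (\<Sum>i'<n. \<Sum>k<n. \<Sum>k'<n. \<Sum>j'<n.
        if j' = j then if k' = k then if i' = i then f (i', k) (k', j') else 0 else 0 else 0)"
    unfolding sum.cartesian_product' by (intro sum.cong refl) (simp add: mat_gamma_def)
  also have "\<dots> = (\<Sum>i'<n. \<Sum>k<n. if i' = i then f (i', k) (k, j) else 0)"
    using assms by simp
  also have "\<dots> = (\<Sum>k<n. \<Sum>i'<n. if i' = i then f (i', k) (k, j) else 0)"
    by (rule sum.swap)
  also have "\<dots> = (\<Sum>k<n. f (i, k) (k, j))"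
    using assms by simp
  finally show ?thesis .
qed

text \<open>Structure constants of matrices over an algebra with constants \<open>\<gamma>\<close>.
  The product shape is that of \<open>alg_coords_tensor\<close>, so that the tensor product of real
  matrices with an algebra is recognized as matrices over it by regrouping indices.\<close>

definition mat_struct :: "('q \<Rightarrow> 'q \<Rightarrow> 'q \<Rightarrow> real) \<Rightarrow>
    (nat \<times> nat) \<times> 'q \<Rightarrow> (nat \<times> nat) \<times> 'q \<Rightarrow> (nat \<times> nat) \<times> 'q \<Rightarrow> real" where
  "mat_struct \<gamma> a b c = mat_gamma (fst a) (fst b) (fst c) * \<gamma> (snd a) (snd b) (snd c)"

definition mat_unit :: "('q \<Rightarrow> real) \<Rightarrow> (nat \<times> nat) \<times> 'q \<Rightarrow> real" where
  "mat_unit \<eta> a = (if fst (fst a) = snd (fst a) then 1 else 0) * \<eta> (snd a)"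

abbreviation mat_index :: "nat \<Rightarrow> 'q set \<Rightarrow> ((nat \<times> nat) \<times> 'q) set" where
  "mat_index n Q \<equiv> ({..<n} \<times> {..<n}) \<times> Q"

locale class_coords =
  fixes Q :: "'q set" and \<gamma> \<eta> and \<kappa> :: "'a::real_algebra_1 \<Rightarrow> 'q \<Rightarrow> real"
  assumes class_coords: "alg_coords (class_alg TYPE('a)) Q \<gamma> \<eta> \<kappa>"
begin

sublocale C: coords "class_alg TYPE('a)" Q \<gamma> \<eta> \<kappa>
  by unfold_locales (rule class_coords)

lemma kappa_ops [simp]:
  "q \<in> Q \<Longrightarrow> \<kappa> (x + y) q = \<kappa> x q + \<kappa> y q"
  "q \<in> Q \<Longrightarrow> \<kappa> (c *\<^sub>R x) q = c * \<kappa> x q"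
  "q \<in> Q \<Longrightarrow> \<kappa> 0 q = 0" "q \<in> Q \<Longrightarrow> \<kappa> 1 q = \<eta> q"
  using C.coords_ops by (simp_all add: class_alg_def)

lemma kappa_mult:
  "q \<in> Q \<Longrightarrow> \<kappa> (x * y) q = (\<Sum>s\<in>Q. \<Sum>t\<in>Q. \<gamma> s t q * \<kappa> x s * \<kappa> y t)"
  using C.coords_mult by (simp add: class_alg_def)

lemma kappa_sum: "q \<in> Q \<Longrightarrow> \<kappa> (\<Sum>x\<in>A. f x) q = (\<Sum>x\<in>A. \<kappa> (f x) q)"
  by (induction A rule: infinite_finite_induct) simp_all

lemma alg_coords_mat:
  "alg_coords (mat_alg TYPE('a) n) (mat_index n Q) (mat_struct \<gamma>) (mat_unit \<eta>)
    (\<lambda>M. \<lambda>((i, j), q)\<in>mat_index n Q. \<kappa> (M $$ (i, j)) q)"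
proof -
  let ?A = "mat_alg TYPE('a) n" and ?I = "mat_index n Q"
  let ?k = "\<lambda>M. \<lambda>((i, j), q)\<in>?I. \<kappa> (M $$ (i, j)) q"
  have univ: "x \<in> carrier (class_alg TYPE('a))" for x by (simp add: class_alg_def)
  have "bij_betw ?k (carrier ?A) (?I \<rightarrow>\<^sub>E UNIV)"
  proof (rule bij_betwI[where g = "\<lambda>w. mat n n (\<lambda>ij. C.of_coords (\<lambda>q. w (ij, q)))"])
    show "mat n n (\<lambda>ij. C.of_coords (\<lambda>q. ?k M (ij, q))) = M" if "M \<in> carrier ?A" for M
    proof (rule eq_matI)
      fix i j assume "i < dim_row M" "j < dim_col M"
      then have ij: "i < n" "j < n" using that by (auto simp: mat_alg_def)
      then have "C.of_coords (\<lambda>q. ?k M ((i, j), q)) = M $$ (i, j)"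
        by (intro C.coords_eqI univ) simp_all
      then show "mat n n (\<lambda>ij. C.of_coords (\<lambda>q. ?k M (ij, q))) $$ (i, j) = M $$ (i, j)"
        using ij by simp
    qed (use that in \<open>auto simp: mat_alg_def\<close>)
    show "?k (mat n n (\<lambda>ij. C.of_coords (\<lambda>q. w (ij, q)))) = w" if w: "w \<in> ?I \<rightarrow>\<^sub>E UNIV" for w
      by (rule PiE_ext[OF _ w]) auto
  qed (auto simp: mat_alg_def)
  moreover have "?k (M * N) u = (\<Sum>a\<in>?I. \<Sum>b\<in>?I. mat_struct \<gamma> a b u * ?k M a * ?k N b)"
    if MN: "M \<in> carrier_mat n n" "N \<in> carrier_mat n n" and u: "u \<in> ?I" for M N u
  proof -
    obtain i j q where uu: "u = ((i, j), q)" by (metis surj_pair)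
    have ij: "i < n" "j < n" "q \<in> Q" using u uu by auto
    have "(\<Sum>a\<in>?I. \<Sum>b\<in>?I. mat_struct \<gamma> a b u * ?k M a * ?k N b) =
      (\<Sum>s\<in>{..<n} \<times> {..<n}. \<Sum>p\<in>Q. \<Sum>t\<in>{..<n} \<times> {..<n}. \<Sum>r\<in>Q.
        mat_gamma s t (i, j) * (\<gamma> p r q * \<kappa> (M $$ s) p * \<kappa> (N $$ t) r))"
      unfolding sum.cartesian_product'[of _ _ Q] uu
      by (intro sum.cong refl) (auto simp: mat_struct_def)
    also have "\<dots> = (\<Sum>s\<in>{..<n} \<times> {..<n}. \<Sum>t\<in>{..<n} \<times> {..<n}. \<Sum>p\<in>Q. \<Sum>r\<in>Q.
        mat_gamma s t (i, j) * (\<gamma> p r q * \<kappa> (M $$ s) p * \<kappa> (N $$ t) r))"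
      by (rule sum.cong[OF refl], rule sum.swap)
    also have "\<dots> = (\<Sum>s\<in>{..<n} \<times> {..<n}. \<Sum>t\<in>{..<n} \<times> {..<n}.
        mat_gamma s t (i, j) * \<kappa> (M $$ s * N $$ t) q)"
      by (simp add: kappa_mult ij sum_distrib_left)
    also have "\<dots> = (\<Sum>k<n. \<kappa> (M $$ (i, k) * N $$ (k, j)) q)"
      by (rule sum_mat_gamma[OF ij(1,2)])
    also have "\<dots> = \<kappa> ((M * N) $$ (i, j)) q"
      unfolding index_mult_mat_sum[OF MN ij(1,2)] by (rule kappa_sum[OF ij(3), symmetric])
    finally show ?thesis using u by (simp add: uu)
  qed
  ultimately show ?thesis
    using real_alg_closed[OF real_alg_mat_alg[where 'a = 'a and n = n]]
    unfolding alg_coords_def linear_fn_def by (auto simp: mat_alg_def mat_unit_def split: prod.splits)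
qed

end

section \<open>Trace forms of matrix algebras\<close>

text \<open>The hypotheses say that the trace form \<open>\<tau> (x y)\<close> is diagonal with entries \<open>e\<close> in the
  coordinates \<open>l\<close>; the coordinates \<open>\<xi>\<close> only serve to count dimensions.\<close>

definition central_trace_alg :: "(real, 'a, 'm) module_scheme \<Rightarrow> 'k set \<Rightarrow> ('k \<Rightarrow> real) \<Rightarrow> bool" where
  "central_trace_alg D K e \<longleftrightarrow> (\<exists>\<gamma> \<eta> \<xi>. alg_coords D K \<gamma> \<eta> \<xi>) \<and>
     (\<exists>\<tau> l. linear_fn D \<tau> \<and> (\<forall>x\<in>carrier D. \<forall>y\<in>carrier D. \<tau> (x \<otimes>\<^bsub>D\<^esub> y) = \<tau> (y \<otimes>\<^bsub>D\<^esub> x)) \<and>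
        \<tau> \<one>\<^bsub>D\<^esub> > 0 \<and> (\<forall>k\<in>K. linear_fn D (l k)) \<and>
        (\<forall>x\<in>carrier D. \<tau> (x \<otimes>\<^bsub>D\<^esub> x) = (\<Sum>k\<in>K. e k * (l k x)\<^sup>2))) \<and>
     (\<forall>x\<in>carrier D. (\<forall>y\<in>carrier D. x \<otimes>\<^bsub>D\<^esub> y = y \<otimes>\<^bsub>D\<^esub> x) \<longrightarrow> (\<exists>c. x = c \<odot>\<^bsub>D\<^esub> \<one>\<^bsub>D\<^esub>))"

lemma central_trace_alg_iso:
  assumes \<phi>: "\<phi> \<in> alg_iso A B" and A: "real_alg A" and B: "central_trace_alg B K e"
  shows "central_trace_alg A K e"
proof -
  note i = alg_isoD[OF \<phi>]
  have cl: "alg_ops_closed A" by (rule real_alg_closed[OF A])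
  then have c: "\<And>x y. x \<in> carrier A \<Longrightarrow> y \<in> carrier A \<Longrightarrow> x \<otimes>\<^bsub>A\<^esub> y \<in> carrier A" "\<one>\<^bsub>A\<^esub> \<in> carrier A"
    "\<And>c x. x \<in> carrier A \<Longrightarrow> c \<odot>\<^bsub>A\<^esub> x \<in> carrier A"
    by (auto simp: alg_ops_closed_def)
  have lin: "linear_fn A (h \<circ> \<phi>)" if "linear_fn B h" for h
    using that i by (simp add: linear_fn_def)
  have "\<exists>\<gamma> \<eta> \<xi>. alg_coords A K \<gamma> \<eta> \<xi>"
    using B alg_coords_pullback[OF \<phi> _ A] unfolding central_trace_alg_def by blast
  moreover obtain \<tau> l where "linear_fn B \<tau>"
      "\<forall>x\<in>carrier B. \<forall>y\<in>carrier B. \<tau> (x \<otimes>\<^bsub>B\<^esub> y) = \<tau> (y \<otimes>\<^bsub>B\<^esub> x)"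
      "\<tau> \<one>\<^bsub>B\<^esub> > 0" "\<forall>k\<in>K. linear_fn B (l k)"
      "\<forall>x\<in>carrier B. \<tau> (x \<otimes>\<^bsub>B\<^esub> x) = (\<Sum>k\<in>K. e k * (l k x)\<^sup>2)"
    using B unfolding central_trace_alg_def by blast
  then have "\<exists>\<tau> l. linear_fn A \<tau> \<and> (\<forall>x\<in>carrier A. \<forall>y\<in>carrier A. \<tau> (x \<otimes>\<^bsub>A\<^esub> y) = \<tau> (y \<otimes>\<^bsub>A\<^esub> x)) \<and>
        \<tau> \<one>\<^bsub>A\<^esub> > 0 \<and> (\<forall>k\<in>K. linear_fn A (l k)) \<and>
        (\<forall>x\<in>carrier A. \<tau> (x \<otimes>\<^bsub>A\<^esub> x) = (\<Sum>k\<in>K. e k * (l k x)\<^sup>2))"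
    using i lin by (intro exI[of _ "\<tau> \<circ> \<phi>"] exI[of _ "\<lambda>k. l k \<circ> \<phi>"]) simp
  moreover have "\<exists>c. x = c \<odot>\<^bsub>A\<^esub> \<one>\<^bsub>A\<^esub>"
    if x: "x \<in> carrier A" "\<forall>y\<in>carrier A. x \<otimes>\<^bsub>A\<^esub> y = y \<otimes>\<^bsub>A\<^esub> x" for x
  proof -
    have "\<phi> x \<otimes>\<^bsub>B\<^esub> y = y \<otimes>\<^bsub>B\<^esub> \<phi> x" if y: "y \<in> carrier B" for y
    proof -
      obtain z where "z \<in> carrier A" "y = \<phi> z" using y i(1) by (auto simp: bij_betw_def)
      then show ?thesis using x by (simp add: i(4)[symmetric])
    qed
    then obtain k where "\<phi> x = k \<odot>\<^bsub>B\<^esub> \<one>\<^bsub>B\<^esub>"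
      using B i(2)[OF x(1)] unfolding central_trace_alg_def by blast
    also have "\<dots> = \<phi> (k \<odot>\<^bsub>A\<^esub> \<one>\<^bsub>A\<^esub>)" using i(5,6) c by simp
    finally have "x = k \<odot>\<^bsub>A\<^esub> \<one>\<^bsub>A\<^esub>"
      using i(1) x(1) c by (auto simp: bij_betw_def inj_on_def)
    then show ?thesis ..
  qed
  ultimately show ?thesis unfolding central_trace_alg_def by blast
qed

text \<open>For the coefficients R and H: \<open>re\<close> is the real part, and the form
  \<open>re (x * y)\<close> is diagonal in the coordinates with signs \<open>\<epsilon>\<close>. For
  H these are 1 at the unit and -1 at i, j, k, because the latter square to -1.\<close>

locale central_class_coords = class_coords Q \<gamma> \<eta> \<kappa>
  for Q :: "'q set" and \<gamma> \<eta> and \<kappa> :: "'a::real_algebra_1 \<Rightarrow> 'q \<Rightarrow> real" +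
  fixes re :: "'a \<Rightarrow> real" and \<epsilon> :: "'q \<Rightarrow> real"
  assumes re_ops: "re (x + y) = re x + re y" "re (c *\<^sub>R x) = c * re x" "re 1 > 0"
    and re_mult: "re (x * y) = (\<Sum>q\<in>Q. \<epsilon> q * \<kappa> x q * \<kappa> y q)"
    and center: "(\<And>y. x * y = y * x) \<Longrightarrow> \<exists>c. x = c *\<^sub>R 1"
    and eps: "q \<in> Q \<Longrightarrow> \<epsilon> q = 1 \<or> \<epsilon> q = -1"
begin

text \<open>Off the diagonal, the trace of \<open>M^2\<close> involves the entries at (i, j) and (j,
  i) through twice the product of their coordinates. With
  \<open>2 a b = ((a + b)^2 - (a - b)^2) / 2\<close> the sum is stored at the index with
  \<open>i < j\<close> and the difference at the index with \<open>i > j\<close>, which explains the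
  halves and the opposite signs.\<close>

definition trace_sign :: "(nat \<times> nat) \<times> 'q \<Rightarrow> real" where
  "trace_sign k = (case k of ((i, j), q) \<Rightarrow>
     if i < j then \<epsilon> q / 2 else if i = j then \<epsilon> q else - \<epsilon> q / 2)"

lemma re_sum: "re (\<Sum>x\<in>A. f x) = (\<Sum>x\<in>A. re (f x))"
proof -
  have "re 0 = 0" using re_ops(2)[of 0 0] by simp
  then show ?thesis by (induction A rule: infinite_finite_induct) (simp_all add: re_ops)
qed

text \<open>Commuting with the matrices that have a single nonzero entry \<open>w\<close> forces
  \<open>x\<close> to be diagonal, with all diagonal entries equal and central.\<close>

lemma mat_center:
  assumes n: "n \<ge> 1" and x: "x \<in> carrier_mat n n"
    and comm: "\<And>y. y \<in> carrier_mat n n \<Longrightarrow> x * y = y * (x :: 'a mat)"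
  shows "\<exists>c. x = map_mat ((*\<^sub>R) c) (1\<^sub>m n)"
proof -
  have key: "x $$ (k, i) * w * (if j = l then 1 else 0) = (if k = i then 1 else 0) * (w * x $$ (j, l))"
    if ijkl: "i < n" "j < n" "k < n" "l < n" for i j k l w
  proof -
    let ?E = "mat n n (\<lambda>(a, b). if a = i \<and> b = j then w else 0)"
    have E: "?E \<in> carrier_mat n n" by simp
    have "(x * ?E) $$ (k, l) = (\<Sum>a<n. if a = i then x $$ (k, a) * w * (if j = l then 1 else 0) else 0)"
      using ijkl unfolding index_mult_mat_sum[OF x E ijkl(3,4)] by (intro sum.cong) auto
    moreover have "(?E * x) $$ (k, l) = (\<Sum>a<n. if a = j then (if k = i then 1 else 0) * (w * x $$ (a, l)) else 0)"
      using ijkl unfolding index_mult_mat_sum[OF E x ijkl(3,4)] by (intro sum.cong) auto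
    ultimately show ?thesis using comm[OF E] ijkl by simp
  qed
  have off: "x $$ (k, i) = 0" if "k < n" "i < n" "k \<noteq> i" for k i
    using key[of i k k k 1] that by simp
  have diag: "x $$ (i, i) * w = w * x $$ (j, j)" if "i < n" "j < n" for i j w
    using key[of i j i j w] that by simp
  obtain c where c: "x $$ (0, 0) = c *\<^sub>R 1"
    using center[of "x $$ (0, 0)"] diag[of 0 0] n by auto
  have "x $$ (i, i) = c *\<^sub>R 1" if "i < n" for i
    using diag[of i 0 1] that n c by simp
  then have "x = map_mat ((*\<^sub>R) c) (1\<^sub>m n)"
    using x off by (intro eq_matI) auto
  then show ?thesis ..
qed

lemma central_trace_alg_mat:
  assumes n: "n \<ge> 1"
  shows "central_trace_alg (mat_alg TYPE('a) n) (mat_index n Q) trace_sign"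
proof -
  let ?D = "mat_alg TYPE('a) n" and ?K = "mat_index n Q"
  define \<tau> where "\<tau> M = (\<Sum>i<n. re (M $$ (i, i)))" for M :: "'a mat"
  define l where "l k M = (case k of ((i, j), q) \<Rightarrow>
     if i < j then \<kappa> (M $$ (i, j)) q + \<kappa> (M $$ (j, i)) q
     else if i = j then \<kappa> (M $$ (i, j)) q else \<kappa> (M $$ (i, j)) q - \<kappa> (M $$ (j, i)) q)"
    for k and M :: "'a mat"
  have \<tau>_mult: "\<tau> (M * N) = (\<Sum>i<n. \<Sum>j<n. \<Sum>q\<in>Q. \<epsilon> q * \<kappa> (M $$ (i, j)) q * \<kappa> (N $$ (j, i)) q)"
    if "M \<in> carrier_mat n n" "N \<in> carrier_mat n n" for M N
    unfolding \<tau>_def using index_mult_mat_sum[OF that] by (simp add: re_sum re_mult)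
  have "linear_fn ?D \<tau>"
    by (auto simp: linear_fn_def \<tau>_def mat_alg_def re_ops sum.distrib sum_distrib_left)
  moreover have "\<tau> (M * N) = \<tau> (N * M)" if "M \<in> carrier_mat n n" "N \<in> carrier_mat n n" for M N
    unfolding \<tau>_mult[OF that] \<tau>_mult[OF that(2,1)] by (subst sum.swap) (simp add: mult_ac)
  moreover have "\<tau> (1\<^sub>m n) > 0"
    unfolding \<tau>_def using n re_ops(3) by simp
  moreover have "linear_fn ?D (l k)" if "k \<in> ?K" for k
    using that by (auto simp: linear_fn_def l_def mat_alg_def algebra_simps)
  moreover have "\<tau> (M * M) = (\<Sum>k\<in>?K. trace_sign k * (l k M)\<^sup>2)" if M: "M \<in> carrier_mat n n" for M
  proof -
    define S where "S i j q = trace_sign ((i, j), q) * (l ((i, j), q) M)\<^sup>2" for i j q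
    \<comment> \<open>The square stored at a single index does not match a single summand of the
      trace; only the sum over (i, j) and (j, i) does, hence the doubling below.\<close>
    have "S i j q + S j i q = 2 * (\<epsilon> q * \<kappa> (M $$ (i, j)) q * \<kappa> (M $$ (j, i)) q)" for i j q
      by (cases i j rule: linorder_cases)
        (simp_all add: S_def trace_sign_def l_def power2_eq_square field_simps)
    then have "2 * \<tau> (M * M) = (\<Sum>i<n. \<Sum>j<n. \<Sum>q\<in>Q. S i j q + S j i q)"
      unfolding \<tau>_mult[OF M M] by (simp add: sum_distrib_left)
    also have "\<dots> = (\<Sum>i<n. \<Sum>j<n. \<Sum>q\<in>Q. S i j q) + (\<Sum>i<n. \<Sum>j<n. \<Sum>q\<in>Q. S j i q)"
      by (simp add: sum.distrib)
    also have "(\<Sum>i<n. \<Sum>j<n. \<Sum>q\<in>Q. S j i q) = (\<Sum>i<n. \<Sum>j<n. \<Sum>q\<in>Q. S i j q)"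
      by (rule sum.swap)
    finally have "\<tau> (M * M) = (\<Sum>i<n. \<Sum>j<n. \<Sum>q\<in>Q. S i j q)" by simp
    then show ?thesis unfolding sum.cartesian_product' S_def by simp
  qed
  moreover have "\<exists>c. x = map_mat ((*\<^sub>R) c) (1\<^sub>m n)"
    if "x \<in> carrier_mat n n" "\<forall>y\<in>carrier_mat n n. x * y = y * x" for x :: "'a mat"
    using mat_center[OF n] that by blast
  ultimately show ?thesis
    unfolding central_trace_alg_def using alg_coords_mat
    by (intro conjI) (blast, intro exI[of _ \<tau>] exI[of _ l], simp_all add: mat_alg_def)
qed

text \<open>Off the diagonal the signs at (i, j) and (j, i) cancel, so only the \<open>n\<close>
  diagonal places count.\<close>

lemma sum_sgn_trace_sign: "(\<Sum>k\<in>mat_index n Q. sgn (trace_sign k)) = n * (\<Sum>q\<in>Q. \<epsilon> q)"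
proof -
  define S where "S i j q = sgn (trace_sign ((i, j), q))" for i j q
  have "S i j q + S j i q = (if j = i then 2 * \<epsilon> q else 0)" if "q \<in> Q" for i j q
    using eps[OF that] by (cases i j rule: linorder_cases) (auto simp: S_def trace_sign_def)
  then have "2 * (\<Sum>q\<in>Q. \<Sum>i<n. \<epsilon> q) = (\<Sum>q\<in>Q. \<Sum>i<n. \<Sum>j<n. S i j q + S j i q)"
    by (simp add: sum_distrib_left mult_ac)
  also have "\<dots> = (\<Sum>q\<in>Q. \<Sum>i<n. \<Sum>j<n. S i j q) + (\<Sum>q\<in>Q. \<Sum>i<n. \<Sum>j<n. S j i q)"
    by (simp add: sum.distrib)
  also have "(\<Sum>q\<in>Q. \<Sum>i<n. \<Sum>j<n. S j i q) = (\<Sum>q\<in>Q. \<Sum>i<n. \<Sum>j<n. S i j q)"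
    by (rule sum.cong[OF refl], rule sum.swap)
  finally have "(\<Sum>q\<in>Q. \<Sum>i<n. \<epsilon> q) = (\<Sum>q\<in>Q. \<Sum>i<n. \<Sum>j<n. S i j q)" by linarith
  moreover have "(\<Sum>q\<in>Q. \<Sum>i<n. \<epsilon> q) = n * (\<Sum>q\<in>Q. \<epsilon> q)" by (simp add: sum_distrib_left)
  ultimately have "(\<Sum>q\<in>Q. \<Sum>i<n. \<Sum>j<n. S i j q) = n * (\<Sum>q\<in>Q. \<epsilon> q)" by linarith
  moreover have "(\<Sum>k\<in>mat_index n Q. sgn (trace_sign k)) = (\<Sum>i<n. \<Sum>j<n. \<Sum>q\<in>Q. S i j q)"
    unfolding sum.cartesian_product' S_def by simp
  moreover have "\<dots> = (\<Sum>i<n. \<Sum>q\<in>Q. \<Sum>j<n. S i j q)"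
    by (rule sum.cong[OF refl], rule sum.swap)
  moreover have "\<dots> = (\<Sum>q\<in>Q. \<Sum>i<n. \<Sum>j<n. S i j q)"
    by (rule sum.swap)
  ultimately show ?thesis by simp
qed

end

section \<open>The factors R, H and \<open>M_2(R)\<close> in homogeneous coordinates\<close>

interpretation real_coords: central_class_coords "{()}" "\<lambda>s t u. 1" "\<lambda>u. 1"
  "\<lambda>x::real. \<lambda>u\<in>{()}. x" "\<lambda>x. x" "\<lambda>u. 1"
proof unfold_locales
  have "bij_betw (\<lambda>x::real. \<lambda>u\<in>{()}. x) UNIV ({()} \<rightarrow>\<^sub>E UNIV)"
    by (rule bij_betwI[where g = "\<lambda>w. w ()"]) (auto simp: fun_eq_iff PiE_def extensional_def)
  then show "alg_coords (class_alg TYPE(real)) {()} (\<lambda>s t u. 1) (\<lambda>u. 1) (\<lambda>x. \<lambda>u\<in>{()}. x)"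
    by (auto simp: alg_coords_def alg_ops_closed_def linear_fn_def class_alg_def)
qed (auto simp: algebra_simps)

lemma carrier_Z2_squared: "carrier Z2_squared = {(0, 0), (1, 0), (0, 1), (1, 1)}"
proof -
  have "{0..<2::int} = {0, 1}" by auto
  then show ?thesis by (auto simp: Z2_squared_def DirProd_def carrier_integer_mod_group)
qed

lemma mult_Z2_squared: "a \<otimes>\<^bsub>Z2_squared\<^esub> b = ((fst a + fst b) mod 2, (snd a + snd b) mod 2)"
  by (cases a, cases b) (simp add: Z2_squared_def)

lemma one_Z2_squared: "\<one>\<^bsub>Z2_squared\<^esub> = (0, 0)"
  by (simp add: Z2_squared_def)

definition quat_coords :: "quaternion \<Rightarrow> int \<times> int \<Rightarrow> real" where
  "quat_coords x = (\<lambda>t\<in>carrier Z2_squared. if t = (0, 0) then qRe x else if t = (1, 0) then qI x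
     else if t = (0, 1) then qJ x else qK x)"

text \<open>The basis vector of degree (a, b) is \<open>i^a j^b\<close>. In its product with
  \<open>i^c j^d\<close> the signs come from \<open>i^2 = -1\<close>, from \<open>j^2 = -1\<close>
  and from \<open>j i = - i j\<close>, one for each summand of the exponent, in this order.\<close>

definition quat_sigma :: "int \<times> int \<Rightarrow> int \<times> int \<Rightarrow> real" where
  "quat_sigma s t = (-1) ^ nat (fst s * fst t + snd s * snd t + snd s * fst t)"

definition mat2_coords :: "real mat \<Rightarrow> int \<times> int \<Rightarrow> real" where
  "mat2_coords M = (\<lambda>t\<in>carrier Z2_squared. (if t = (0, 0) then M $$ (0, 0) + M $$ (1, 1)
     else if t = (1, 0) then M $$ (0, 1) + M $$ (1, 0)
     else if t = (0, 1) then M $$ (1, 1) - M $$ (0, 0) else M $$ (1, 0) - M $$ (0, 1)) / 2)"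

text \<open>The basis vector of degree (a, b) is \<open>B^b A^a\<close>, where A and B are the
  matrices of degrees (1, 0) and (0, 1). Both square to 1 and they anticommute, so a sign arises
  only when A of the first factor passes B of the second.\<close>

definition mat2_sigma :: "int \<times> int \<Rightarrow> int \<times> int \<Rightarrow> real" where
  "mat2_sigma s t = (-1) ^ nat (fst s * snd t)"

text \<open>Structure constants of the group algebra of \<open>G\<close> twisted by
  \<open>\<sigma>\<close>.\<close>

definition graded_struct :: "('g, 'k) monoid_scheme \<Rightarrow> ('g \<Rightarrow> 'g \<Rightarrow> real) \<Rightarrow> 'g \<Rightarrow> 'g \<Rightarrow> 'g \<Rightarrow> real" where
  "graded_struct G \<sigma> s t u = (if s \<otimes>\<^bsub>G\<^esub> t = u then \<sigma> s t else 0)"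

definition graded_unit :: "('g, 'k) monoid_scheme \<Rightarrow> 'g \<Rightarrow> real" where
  "graded_unit G t = (if t = \<one>\<^bsub>G\<^esub> then 1 else 0)"

lemma alg_coords_HH:
  "alg_coords HH (carrier Z2_squared) (graded_struct Z2_squared quat_sigma) (graded_unit Z2_squared) quat_coords"
proof -
  have "bij_betw quat_coords UNIV (carrier Z2_squared \<rightarrow>\<^sub>E UNIV)"
    by (rule bij_betwI[where g = "\<lambda>w. Quaternion (w (0, 0)) (w (1, 0)) (w (0, 1)) (w (1, 1))"])
      (auto simp: quat_coords_def carrier_Z2_squared fun_eq_iff PiE_def extensional_def)
  then show ?thesis
    unfolding alg_coords_def alg_ops_closed_def linear_fn_def
    by (auto simp: class_alg_def quat_coords_def carrier_Z2_squared quaternion_ops graded_struct_def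
        graded_unit_def mult_Z2_squared one_Z2_squared quat_sigma_def)
qed

lemma alg_coords_M2R:
  "alg_coords M2R (carrier Z2_squared) (graded_struct Z2_squared mat2_sigma) (graded_unit Z2_squared) mat2_coords"
proof -
  have "bij_betw mat2_coords (carrier_mat 2 2) (carrier Z2_squared \<rightarrow>\<^sub>E UNIV)"
  proof (rule bij_betwI[where g = "\<lambda>w. mat 2 2 (\<lambda>(i, j). if i = 0
      then if j = 0 then w (0, 0) - w (0, 1) else w (1, 0) - w (1, 1)
      else if j = 0 then w (1, 0) + w (1, 1) else w (0, 0) + w (0, 1))"])
  qed (auto simp: mat2_coords_def carrier_Z2_squared fun_eq_iff PiE_def extensional_def less_2_cases_iff
      field_simps intro!: eq_matI)
  moreover have "mat2_coords (x * y) u = (\<Sum>s\<in>carrier Z2_squared. \<Sum>t\<in>carrier Z2_squared.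
      graded_struct Z2_squared mat2_sigma s t u * mat2_coords x s * mat2_coords y t)"
    if "x \<in> carrier_mat 2 2" "y \<in> carrier_mat 2 2" "u \<in> carrier Z2_squared" for x y u
  proof -
    have m: "(x * y) $$ (i, j) = x $$ (i, 0) * y $$ (0, j) + x $$ (i, 1) * y $$ (1, j)"
      if "i < 2" "j < 2" for i j
      using index_mult_mat_sum[OF \<open>x \<in> _\<close> \<open>y \<in> _\<close> that] by (simp add: numeral_2_eq_2)
    have "u = (0, 0) \<or> u = (1, 0) \<or> u = (0, 1) \<or> u = (1, 1)"
      using that(3) by (simp add: carrier_Z2_squared)
    then show ?thesis
      by (elim disjE; simp add: mat2_coords_def carrier_Z2_squared graded_struct_def mult_Z2_squared
          mat2_sigma_def m; simp add: field_simps)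
  qed
  ultimately show ?thesis
    using real_alg_closed[OF real_alg_mat_alg[where 'a = real and n = 2]]
    unfolding alg_coords_def linear_fn_def
    by (auto simp: mat_alg_def mat2_coords_def carrier_Z2_squared graded_unit_def one_Z2_squared field_simps)
qed

lemma quaternion_center:
  assumes "\<And>y. x * y = y * (x :: quaternion)"
  shows "\<exists>c. x = c *\<^sub>R 1"
proof -
  have "qI x = 0" "qJ x = 0" "qK x = 0"
    using assms[of "Quaternion 0 1 0 0"] assms[of "Quaternion 0 0 1 0"]
    by (auto simp: quaternion_eq_iff quaternion_ops)
  then have "x = qRe x *\<^sub>R 1" by (simp add: quaternion_eq_iff quaternion_ops)
  then show ?thesis ..
qed

interpretation quaternion_coords: central_class_coords "carrier Z2_squared"
  "graded_struct Z2_squared quat_sigma" "graded_unit Z2_squared" quat_coords qRe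
  "\<lambda>t. if t = (0, 0) then 1 else -1"
proof unfold_locales
  show "\<exists>c. x = c *\<^sub>R 1" if "\<And>y. x * y = y * x" for x :: quaternion
    by (rule quaternion_center) (rule that)
qed (use alg_coords_HH in \<open>auto simp: quaternion_ops quat_coords_def carrier_Z2_squared\<close>)

section \<open>The model algebras as matrix algebras\<close>

lemma alg_coords_rename:
  assumes "alg_coords D I' \<gamma>' \<eta>' \<kappa>'" "bij_betw \<alpha> I I'"
    and "\<And>s t u. s \<in> I \<Longrightarrow> t \<in> I \<Longrightarrow> u \<in> I \<Longrightarrow> \<gamma> s t u = \<gamma>' (\<alpha> s) (\<alpha> t) (\<alpha> u)"
    and "\<And>t. t \<in> I \<Longrightarrow> \<eta> t = \<eta>' (\<alpha> t)"
  shows "alg_coords D I \<gamma> \<eta> (\<lambda>x. \<lambda>t\<in>I. \<kappa>' x (\<alpha> t))"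
  using alg_coords_rescale[OF assms(1,2), of "\<lambda>_. 1" \<gamma> \<eta>] assms(3,4) by simp

text \<open>This is how the tensor products are shown to be algebras: they share constants with a
  matrix algebra, whose axioms are known.\<close>

lemma real_alg_of_coords:
  assumes "real_alg A" "alg_coords A I \<gamma> \<eta> \<kappa>" "alg_coords B I \<gamma> \<eta> \<kappa>'"
  shows "real_alg B" "alg_isomorphic B A"
proof -
  show "real_alg B"
    using alg_iso_of_coords[OF assms(2,3)] real_alg_iso[OF assms(1)] by blast
  show "alg_isomorphic B A"
    using alg_iso_of_coords[OF assms(3,2)] unfolding alg_isomorphic_def by blast
qed

text \<open>\<open>h\<close> writes an index as a word of length \<open>m\<close>. A Kronecker
  product of matrix units is a matrix unit: the conjunction of the letterwise conditions is the
  condition on the words, hence on the indices, since \<open>h\<close> is injective.\<close>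

lemma prod_mat_gamma:
  fixes m :: nat
  assumes h: "inj_on h {..<n}" "h ` {..<n} \<subseteq> {..<m} \<rightarrow>\<^sub>E A"
    and st: "s \<in> {..<n} \<times> {..<n}" "t \<in> {..<n} \<times> {..<n}" "u \<in> {..<n} \<times> {..<n}"
  shows "(\<Prod>i<m. mat_gamma (h (fst s) i, h (snd s) i) (h (fst t) i, h (snd t) i) (h (fst u) i, h (snd u) i))
    = mat_gamma s t u"
proof -
  have h_eq: "(\<forall>i<m. h x i = h y i) \<longleftrightarrow> x = y" if xy: "x < n" "y < n" for x y
  proof
    assume "\<forall>i<m. h x i = h y i"
    moreover have "h x \<in> {..<m} \<rightarrow>\<^sub>E A" "h y \<in> {..<m} \<rightarrow>\<^sub>E A" using h(2) xy by auto
    ultimately have "h x = h y" by (intro PiE_ext) auto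
    then show "x = y" using h(1) xy by (auto simp: inj_on_def)
  qed simp
  show ?thesis
  proof (cases "snd s = fst t \<and> fst s = fst u \<and> snd t = snd u")
    case True
    then show ?thesis by (simp add: mat_gamma_def)
  next
    case False
    then have "\<exists>i<m. \<not> (h (snd s) i = h (fst t) i \<and> h (fst s) i = h (fst u) i \<and> h (snd t) i = h (snd u) i)"
      using h_eq[of "snd s" "fst t"] h_eq[of "fst s" "fst u"] h_eq[of "snd t" "snd u"] st by auto
    then obtain i where "i < m"
        "\<not> (h (snd s) i = h (fst t) i \<and> h (fst s) i = h (fst u) i \<and> h (snd t) i = h (snd u) i)" by blast
    then have "(\<Prod>i<m. mat_gamma (h (fst s) i, h (snd s) i) (h (fst t) i, h (snd t) i)
        (h (fst u) i, h (snd u) i)) = 0"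
      by - (intro prod_zero[OF finite_lessThan] bexI[of _ i], auto simp: mat_gamma_def)
    then show ?thesis using False by (simp add: mat_gamma_def)
  qed
qed

text \<open>A word of index pairs is the same as a pair of words, and there are \<open>2 ^ m\<close>
  binary words of length \<open>m\<close>; any numbering \<open>h\<close> of them identifies the
  power of \<open>M_2(R)\<close> with the matrices of size \<open>2 ^ m\<close>.\<close>

lemma M2R_power_mat_coords:
  "\<exists>\<kappa>. alg_coords (M2R_power m) (mat_index (2 ^ m) {()}) (mat_struct (\<lambda>s t u. 1)) (mat_unit (\<lambda>u. 1)) \<kappa>"
proof -
  let ?n = "2 ^ m :: nat" and ?B = "{..<m} \<rightarrow>\<^sub>E mat_index 2 {()}"
  have "card ({..<m} \<rightarrow>\<^sub>E {..<2::nat}) = ?n" by (simp add: card_PiE)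
  then obtain h where h: "bij_betw h {..<?n} ({..<m} \<rightarrow>\<^sub>E {..<2::nat})"
    using finite_same_card_bij[of "{..<?n}" "{..<m} \<rightarrow>\<^sub>E {..<2::nat}"] by (auto simp: finite_PiE)
  then have hi: "inj_on h {..<?n}" "h ` {..<?n} \<subseteq> {..<m} \<rightarrow>\<^sub>E {..<2}" by (auto simp: bij_betw_def)
  have hv: "h x i < 2" if "x < ?n" "i < m" for x i using hi(2) that by (auto simp: PiE_iff)
  have hE: "h x \<in> {..<m} \<rightarrow>\<^sub>E {..<2}" if "x < ?n" for x using hi(2) that by auto
  let ?h' = "inv_into {..<?n} h"
  have h': "h (?h' y) = y" "?h' y < ?n" if "y \<in> {..<m} \<rightarrow>\<^sub>E {..<2}" for y
    using h that inv_into_into[of y h "{..<?n}"] by (auto simp: bij_betw_def f_inv_into_f)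
  \<comment> \<open>Takes a pair of word numbers to the word of letter pairs; the unit component is
    the only index of the coefficient algebra R.\<close>
  let ?\<alpha> = "\<lambda>a. \<lambda>i\<in>{..<m}. ((h (fst (fst a)) i, h (snd (fst a)) i), ())"
  have \<alpha>: "bij_betw ?\<alpha> (mat_index ?n {()}) ?B"
  proof (rule bij_betwI[where g = "\<lambda>b. ((?h' (\<lambda>i\<in>{..<m}. fst (fst (b i))), ?h' (\<lambda>i\<in>{..<m}. snd (fst (b i)))), ())"])
    show "?\<alpha> \<in> mat_index ?n {()} \<rightarrow> ?B" by (rule funcsetI, rule restrict_PiE_iff[THEN iffD2]) (auto simp: hv)
    show "(\<lambda>b. ((?h' (\<lambda>i\<in>{..<m}. fst (fst (b i))), ?h' (\<lambda>i\<in>{..<m}. snd (fst (b i)))), ())) \<in> ?B \<rightarrow> mat_index ?n {()}"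
    proof
      fix b assume "b \<in> ?B"
      then have "(\<lambda>i\<in>{..<m}. fst (fst (b i))) \<in> {..<m} \<rightarrow>\<^sub>E {..<2}" "(\<lambda>i\<in>{..<m}. snd (fst (b i))) \<in> {..<m} \<rightarrow>\<^sub>E {..<2}"
        by (auto simp: PiE_iff mem_Times_iff)
      then show "((?h' (\<lambda>i\<in>{..<m}. fst (fst (b i))), ?h' (\<lambda>i\<in>{..<m}. snd (fst (b i)))), ()) \<in> mat_index ?n {()}"
        using h'(2) by simp
    qed
    fix a assume a: "a \<in> mat_index ?n {()}"
    have "restrict (h x) {..<m} = h x" if "x < ?n" for x
      using hE[OF that] by (auto simp: PiE_iff extensional_restrict)
    moreover have "?h' (h x) = x" if "x < ?n" for x
      using hi(1) that by simp
    ultimately show "((?h' (\<lambda>i\<in>{..<m}. fst (fst (?\<alpha> a i))), ?h' (\<lambda>i\<in>{..<m}. snd (fst (?\<alpha> a i)))), ()) = a"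
      using a by (auto simp: mem_Times_iff prod_eq_iff cong: restrict_cong)
  next
    fix b assume b: "b \<in> ?B"
    have e: "(\<lambda>i\<in>{..<m}. fst (fst (b i))) \<in> {..<m} \<rightarrow>\<^sub>E {..<2}" "(\<lambda>i\<in>{..<m}. snd (fst (b i))) \<in> {..<m} \<rightarrow>\<^sub>E {..<2}"
      using b by (auto simp: PiE_iff mem_Times_iff)
    show "?\<alpha> ((?h' (\<lambda>i\<in>{..<m}. fst (fst (b i))), ?h' (\<lambda>i\<in>{..<m}. snd (fst (b i)))), ()) = b"
    proof (rule PiE_ext[OF _ b])
      have b': "fst (fst (b i)) < 2" "snd (fst (b i)) < 2" "(fst (b i), ()) = b i" if "i < m" for i
        using b that by (auto simp: PiE_iff mem_Times_iff prod_eq_iff)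
      show "?\<alpha> ((?h' (\<lambda>i\<in>{..<m}. fst (fst (b i))), ?h' (\<lambda>i\<in>{..<m}. snd (fst (b i)))), ()) i = b i"
        if "i \<in> {..<m}" for i
        using b'[of i] that by (simp add: h'(1)[OF e(1)] h'(1)[OF e(2)])
      show "?\<alpha> ((?h' (\<lambda>i\<in>{..<m}. fst (fst (b i))), ?h' (\<lambda>i\<in>{..<m}. snd (fst (b i)))), ()) \<in> ?B"
        using b' by (auto simp: h'(1)[OF e(1)] h'(1)[OF e(2)] PiE_iff mem_Times_iff)
    qed
  qed
  have "alg_coords (M2R_power m) (mat_index ?n {()}) (mat_struct (\<lambda>s t u. 1)) (mat_unit (\<lambda>u. 1))
    (\<lambda>x. \<lambda>t\<in>mat_index ?n {()}. (\<lambda>s. \<lambda>b\<in>?B. s (\<lambda>x. \<Prod>i<m.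
      (\<lambda>M. \<lambda>((i, j), q)\<in>mat_index 2 {()}. (\<lambda>u\<in>{()}. M $$ (i, j)) q) (x i) (b i))) x (?\<alpha> t))"
  proof (rule alg_coords_rename[OF alg_coords_tensor_power[OF real_coords.alg_coords_mat] \<alpha>])
    fix s t u :: "(nat \<times> nat) \<times> unit"
    assume "s \<in> mat_index ?n {()}" "t \<in> mat_index ?n {()}" "u \<in> mat_index ?n {()}"
    then show "mat_struct (\<lambda>s t u. 1) s t u =
        (\<Prod>i<m. mat_struct (\<lambda>s t u. 1) (?\<alpha> s i) (?\<alpha> t i) (?\<alpha> u i))"
      using prod_mat_gamma[OF hi, of "fst s" "fst t" "fst u"]
      by (simp add: mat_struct_def mem_Times_iff)
  next
    fix t :: "(nat \<times> nat) \<times> unit" assume t: "t \<in> mat_index ?n {()}"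
    have "(\<Prod>i<m. if h (fst (fst t)) i = h (snd (fst t)) i then 1 else 0) =
        (if fst (fst t) = snd (fst t) then 1 else (0::real))"
    proof (cases "fst (fst t) = snd (fst t)")
      case False
      have "\<not> (\<forall>i\<in>{..<m}. h (fst (fst t)) i = h (snd (fst t)) i)"
      proof
        assume "\<forall>i\<in>{..<m}. h (fst (fst t)) i = h (snd (fst t)) i"
        then have "h (fst (fst t)) = h (snd (fst t))"
          using t by (intro PiE_ext[OF hE hE]) auto
        then show False using False hi(1) t by (auto simp: inj_on_def)
      qed
      then show ?thesis using False by (auto intro!: prod_zero[OF finite_lessThan])
    qed simp
    then show "mat_unit (\<lambda>u. 1) t = (\<Prod>i<m. mat_unit (\<lambda>u. 1) (?\<alpha> t i))"
      by (simp add: mat_unit_def)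
  qed
  then show ?thesis by blast
qed

lemma M2R_power_HH_mat_coords:
  "\<exists>\<kappa>. alg_coords (tensor (M2R_power m) HH) (mat_index (2 ^ m) (carrier Z2_squared))
    (mat_struct (graded_struct Z2_squared quat_sigma)) (mat_unit (graded_unit Z2_squared)) \<kappa>"
proof -
  let ?n = "2 ^ m :: nat" and ?Q = "carrier Z2_squared"
  obtain \<kappa> where "alg_coords (M2R_power m) (mat_index ?n {()}) (mat_struct (\<lambda>s t u. 1)) (mat_unit (\<lambda>u. 1)) \<kappa>"
    using M2R_power_mat_coords by blast
  note c = alg_coords_tensor[OF this alg_coords_HH]
  have \<alpha>: "bij_betw (\<lambda>a. ((fst a, ()), snd a)) (mat_index ?n ?Q) (mat_index ?n {()} \<times> ?Q)"
    by (rule bij_betwI[where g = "\<lambda>b. (fst (fst b), snd b)"]) auto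
  show ?thesis
    by (rule exI, rule alg_coords_rename[OF c \<alpha>]) (simp_all add: mat_struct_def mat_unit_def)
qed

lemma M2R_power_matrix_alg:
  "real_alg (M2R_power m)" "alg_isomorphic (M2R_power m) (mat_alg TYPE(real) (2 ^ m))"
  using real_alg_of_coords[OF real_alg_mat_alg real_coords.alg_coords_mat] M2R_power_mat_coords by blast+

lemma M2R_power_HH_matrix_alg:
  "real_alg (tensor (M2R_power m) HH)"
  "alg_isomorphic (tensor (M2R_power m) HH) (mat_alg TYPE(quaternion) (2 ^ m))"
  using real_alg_of_coords[OF real_alg_mat_alg quaternion_coords.alg_coords_mat] M2R_power_HH_mat_coords by blast+

section \<open>Division gradings in coordinates\<close>

text \<open>Fewer equations than unknowns: one equation is used to eliminate an unknown
  \<open>q\<close>. The lemma stands in for dimension theory three times, for the invariance of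
  dimension, the finiteness of the support and the law of inertia.\<close>

lemma linear_dependence:
  fixes a :: "'p \<Rightarrow> 'k \<Rightarrow> real"
  assumes "finite K" "finite P" "card K < card P"
  shows "\<exists>c. (\<exists>p\<in>P. c p \<noteq> 0) \<and> (\<forall>k\<in>K. (\<Sum>p\<in>P. c p * a p k) = 0)"
  using assms
proof (induction K arbitrary: P a)
  case empty
  then have "P \<noteq> {}" by auto
  then show ?case by (intro exI[of _ "\<lambda>_. 1"]) auto
next
  case (insert k K)
  show ?case
  proof (cases "\<forall>p\<in>P. a p k = 0")
    case True
    obtain c where "\<exists>p\<in>P. c p \<noteq> 0" "\<forall>k\<in>K. (\<Sum>p\<in>P. c p * a p k) = 0"
      using insert.IH[of P a] insert.prems insert.hyps by auto
    then show ?thesis using True by (intro exI[of _ c]) auto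
  next
    case False
    then obtain q where q: "q \<in> P" "a q k \<noteq> 0" by auto
    let ?P = "P - {q}"
    have P: "finite ?P" "card K < card ?P" using insert.prems insert.hyps q by auto
    obtain c where c: "\<exists>p\<in>?P. c p \<noteq> 0"
        "\<forall>j\<in>K. (\<Sum>p\<in>?P. c p * (a p j - a p k / a q k * a q j)) = 0"
      using insert.IH[OF P, of "\<lambda>p j. a p j - a p k / a q k * a q j"] by blast
    \<comment> \<open>The coefficient of the eliminated unknown is chosen so that equation
      \<open>k\<close> holds.\<close>
    define d where "d = c(q := - (\<Sum>p\<in>?P. c p * (a p k / a q k)))"
    have "(\<Sum>p\<in>P. d p * a p j) = (\<Sum>p\<in>?P. c p * (a p j - a p k / a q k * a q j))" for j
    proof -
      have "(\<Sum>p\<in>?P. d p * a p j) = (\<Sum>p\<in>?P. c p * a p j)"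
        by (rule sum.cong) (auto simp: d_def)
      moreover have "d q = - (\<Sum>p\<in>?P. c p * (a p k / a q k))" by (simp add: d_def)
      ultimately show ?thesis
        unfolding sum.remove[OF insert.prems(1) q(1)]
        by (simp add: sum_distrib_right sum_distrib_left sum_subtractf algebra_simps)
    qed
    moreover have "(\<Sum>p\<in>?P. c p * (a p k - a p k / a q k * a q k)) = 0"
      using q by simp
    moreover have "\<exists>p\<in>P. d p \<noteq> 0" using c(1) by (auto simp: d_def)
    ultimately show ?thesis using c(2) by (intro exI[of _ d]) auto
  qed
qed

lemma card_le_of_coords:
  assumes "alg_coords D I \<gamma> \<eta> \<kappa>" "alg_coords D J \<gamma>' \<eta>' \<kappa>'"
  shows "card I \<le> card J"
proof (rule ccontr)
  interpret A: coords D I \<gamma> \<eta> \<kappa> by unfold_locales (rule assms)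
  interpret B: coords D J \<gamma>' \<eta>' \<kappa>' by unfold_locales (rule assms)
  assume "\<not> card I \<le> card J"
  then obtain c where c: "\<exists>i\<in>I. c i \<noteq> 0" "\<forall>j\<in>J. (\<Sum>i\<in>I. c i * \<kappa>' (A.basis_vec i) j) = 0"
    using linear_dependence[OF B.finite_I A.finite_I, of "\<lambda>i j. \<kappa>' (A.basis_vec i) j"] by auto
  have "\<kappa>' (A.of_coords c) j = 0" if "j \<in> J" for j
    using A.linear_fn_expand[OF B.coords_linear[OF that], of "A.of_coords c"] c(2) that by simp
  then have "A.of_coords c = \<zero>\<^bsub>D\<^esub>" by (intro B.coords_eqI) auto
  then have "c i = 0" if "i \<in> I" for i
    using A.coords_of_coords[OF that, of c] that by simp
  with c(1) show False by blast
qed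

locale real_algebra =
  fixes D :: "(real, 'a, 'm) module_scheme"
  assumes real_alg: "real_alg D"
begin

sublocale ring D
  using real_alg by (simp add: real_alg_def)

sublocale M: module real_field D
  using real_alg by (simp add: real_alg_def)

lemma smult_closed [simp, intro]: "x \<in> carrier D \<Longrightarrow> c \<odot>\<^bsub>D\<^esub> x \<in> carrier D"
  using M.smult_closed[of c x] by (simp add: real_field_def)

lemma smult_one [simp]: "x \<in> carrier D \<Longrightarrow> 1 \<odot>\<^bsub>D\<^esub> x = x"
  using M.smult_one[of x] by (simp add: real_field_def)

lemma smult_smult [simp]: "x \<in> carrier D \<Longrightarrow> a \<odot>\<^bsub>D\<^esub> (b \<odot>\<^bsub>D\<^esub> x) = (a * b) \<odot>\<^bsub>D\<^esub> x"
  using M.smult_assoc1[of a b x] by (simp add: real_field_def)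

lemma smult_add_left: "x \<in> carrier D \<Longrightarrow> (a + b) \<odot>\<^bsub>D\<^esub> x = a \<odot>\<^bsub>D\<^esub> x \<oplus>\<^bsub>D\<^esub> b \<odot>\<^bsub>D\<^esub> x"
  using M.smult_l_distr[of a b x] by (simp add: real_field_def)

lemma smult_zero [simp]: "x \<in> carrier D \<Longrightarrow> 0 \<odot>\<^bsub>D\<^esub> x = \<zero>\<^bsub>D\<^esub>" "c \<odot>\<^bsub>D\<^esub> \<zero>\<^bsub>D\<^esub> = \<zero>\<^bsub>D\<^esub>"
  using M.smult_l_null[of x] M.smult_r_null[of c] by (simp_all add: real_field_def)

lemma smult_mult [simp]:
  "x \<in> carrier D \<Longrightarrow> y \<in> carrier D \<Longrightarrow> (c \<odot>\<^bsub>D\<^esub> x) \<otimes>\<^bsub>D\<^esub> y = c \<odot>\<^bsub>D\<^esub> (x \<otimes>\<^bsub>D\<^esub> y)"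
  "x \<in> carrier D \<Longrightarrow> y \<in> carrier D \<Longrightarrow> x \<otimes>\<^bsub>D\<^esub> (c \<odot>\<^bsub>D\<^esub> y) = c \<odot>\<^bsub>D\<^esub> (x \<otimes>\<^bsub>D\<^esub> y)"
  using real_alg by (simp_all add: real_alg_def)

lemma smult_eq_zero:
  assumes "x \<in> carrier D" "c \<odot>\<^bsub>D\<^esub> x = \<zero>\<^bsub>D\<^esub>" "x \<noteq> \<zero>\<^bsub>D\<^esub>"
  shows "c = 0"
proof (rule ccontr)
  assume "c \<noteq> 0"
  then have "x = (1 / c) \<odot>\<^bsub>D\<^esub> (c \<odot>\<^bsub>D\<^esub> x)" using assms(1) by simp
  then show False using assms by simp
qed

lemma smult_right_cancel:
  assumes "x \<in> carrier D" "a \<odot>\<^bsub>D\<^esub> x = b \<odot>\<^bsub>D\<^esub> x" "x \<noteq> \<zero>\<^bsub>D\<^esub>"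
  shows "a = b"
proof -
  have "(a - b) \<odot>\<^bsub>D\<^esub> x = a \<odot>\<^bsub>D\<^esub> x \<oplus>\<^bsub>D\<^esub> (- b) \<odot>\<^bsub>D\<^esub> x"
    using smult_add_left[OF assms(1), of a "- b"] by simp
  also have "\<dots> = \<zero>\<^bsub>D\<^esub>"
    using smult_add_left[OF assms(1), of b "- b"] assms by simp
  finally show ?thesis using smult_eq_zero[OF assms(1)] assms(3) by force
qed

lemma linear_fn_finsum:
  assumes h: "linear_fn D h" and "finite P" "f \<in> P \<rightarrow> carrier D"
  shows "h (finsum D f P) = (\<Sum>p\<in>P. h (f p))"
  using assms(2,3)
proof (induction P)
  case empty
  have "h (0 \<odot>\<^bsub>D\<^esub> \<zero>\<^bsub>D\<^esub>) = 0 * h \<zero>\<^bsub>D\<^esub>" using h unfolding linear_fn_def by blast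
  then show ?case by simp
next
  case (insert p P)
  then have "finsum D f P \<in> carrier D" by auto
  with insert h show ?case by (simp add: linear_fn_def)
qed

lemma finsum_support:
  assumes "finite T" "T \<subseteq> S" "\<And>g. g \<in> T \<Longrightarrow> u g \<in> carrier D" "\<And>g. g \<in> S \<Longrightarrow> g \<notin> T \<Longrightarrow> u g = \<zero>\<^bsub>D\<^esub>"
  shows "finite {g \<in> S. u g \<noteq> \<zero>\<^bsub>D\<^esub>}" "finsum D u {g \<in> S. u g \<noteq> \<zero>\<^bsub>D\<^esub>} = finsum D u T"
proof -
  have "{g \<in> S. u g \<noteq> \<zero>\<^bsub>D\<^esub>} \<subseteq> T" using assms by auto
  then show "finite {g \<in> S. u g \<noteq> \<zero>\<^bsub>D\<^esub>}" using assms(1) finite_subset by blast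
  show "finsum D u {g \<in> S. u g \<noteq> \<zero>\<^bsub>D\<^esub>} = finsum D u T"
    by (rule add.finprod_mono_neutral_cong_left) (use assms in auto)
qed

lemma line_smult: "x \<in> carrier D \<Longrightarrow> c \<noteq> 0 \<Longrightarrow> line D (c \<odot>\<^bsub>D\<^esub> x) = line D x"
proof -
  assume x: "x \<in> carrier D" and c: "c \<noteq> 0"
  have "d \<odot>\<^bsub>D\<^esub> x = (d / c) \<odot>\<^bsub>D\<^esub> (c \<odot>\<^bsub>D\<^esub> x)" for d
    using x c by simp
  then have "d \<odot>\<^bsub>D\<^esub> x \<in> line D (c \<odot>\<^bsub>D\<^esub> x)" for d unfolding line_def by blast
  moreover have "d \<odot>\<^bsub>D\<^esub> (c \<odot>\<^bsub>D\<^esub> x) \<in> line D x" for d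
    using x by (simp add: line_def)
  ultimately show ?thesis unfolding line_def by blast
qed

end

section \<open>Gradings in homogeneous coordinates\<close>

definition graded_coords :: "('g, 'k) monoid_scheme \<Rightarrow> (real, 'a, 'm) module_scheme \<Rightarrow> 'g set \<Rightarrow>
    ('g \<Rightarrow> 'g \<Rightarrow> real) \<Rightarrow> ('a \<Rightarrow> 'g \<Rightarrow> real) \<Rightarrow> bool" where
  "graded_coords G D T \<sigma> \<kappa> \<longleftrightarrow> subgroup T G \<and> (\<forall>s\<in>T. \<forall>t\<in>T. \<sigma> s t \<noteq> 0) \<and>
     alg_coords D T (graded_struct G \<sigma>) (graded_unit G) \<kappa>"

text \<open>Asking the other coordinates to vanish, instead of spanning a line, also gives the zero
  space at degrees outside \<open>T\<close>. The restriction to the carrier makes equality of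
  gradings an equality of functions.\<close>

definition grading_of :: "('g, 'k) monoid_scheme \<Rightarrow> (real, 'a, 'm) module_scheme \<Rightarrow> 'g set \<Rightarrow>
    ('a \<Rightarrow> 'g \<Rightarrow> real) \<Rightarrow> 'g \<Rightarrow> 'a set" where
  "grading_of G D T \<kappa> = (\<lambda>g\<in>carrier G. {x \<in> carrier D. \<forall>s\<in>T. s \<noteq> g \<longrightarrow> \<kappa> x s = 0})"

locale graded_algebra = real_algebra D + G: group G
  for D :: "(real, 'a, 'm) module_scheme" and G :: "('g, 'k) monoid_scheme" +
  fixes T \<sigma> \<kappa>
  assumes graded_coords: "graded_coords G D T \<sigma> \<kappa>"
begin

sublocale coords D T "graded_struct G \<sigma>" "graded_unit G" \<kappa>
  using graded_coords by unfold_locales (simp add: graded_coords_def)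

lemma subgroup_T: "subgroup T G"
  and sigma_nonzero: "s \<in> T \<Longrightarrow> t \<in> T \<Longrightarrow> \<sigma> s t \<noteq> 0"
  using graded_coords by (auto simp: graded_coords_def)

lemma T_closed [simp, intro]:
  "s \<in> T \<Longrightarrow> s \<in> carrier G" "\<one>\<^bsub>G\<^esub> \<in> T" "s \<in> T \<Longrightarrow> t \<in> T \<Longrightarrow> s \<otimes>\<^bsub>G\<^esub> t \<in> T" "s \<in> T \<Longrightarrow> inv\<^bsub>G\<^esub> s \<in> T"
  using subgroup_T by (auto simp: subgroup_def)

lemma basis_vec_mult: "s \<in> T \<Longrightarrow> t \<in> T \<Longrightarrow> basis_vec s \<otimes>\<^bsub>D\<^esub> basis_vec t = \<sigma> s t \<odot>\<^bsub>D\<^esub> basis_vec (s \<otimes>\<^bsub>G\<^esub> t)"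
  by (rule coords_eqI) (auto simp: coords_mult_basis_vec graded_struct_def)

lemma basis_vec_one: "basis_vec \<one>\<^bsub>G\<^esub> = \<one>\<^bsub>D\<^esub>"
  by (rule coords_eqI) (auto simp: graded_unit_def)

lemma basis_vec_nonzero: "t \<in> T \<Longrightarrow> basis_vec t \<noteq> \<zero>\<^bsub>D\<^esub>"
  using coords_basis_vec[of t t] coords_ops(3)[of t] by force

lemma grading_of_line: "t \<in> T \<Longrightarrow> grading_of G D T \<kappa> t = line D (basis_vec t)"
proof -
  assume t: "t \<in> T"
  have "x = \<kappa> x t \<odot>\<^bsub>D\<^esub> basis_vec t" if "x \<in> carrier D" "\<forall>s\<in>T. s \<noteq> t \<longrightarrow> \<kappa> x s = 0" for x
    by (rule coords_eqI) (use that in auto)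
  then show ?thesis
    using t by (auto simp: grading_of_def line_def image_iff)
qed

lemma grading_of_outside: "g \<in> carrier G \<Longrightarrow> g \<notin> T \<Longrightarrow> grading_of G D T \<kappa> g = {\<zero>\<^bsub>D\<^esub>}"
proof -
  assume g: "g \<in> carrier G" "g \<notin> T"
  have "x = \<zero>\<^bsub>D\<^esub>" if "x \<in> carrier D" "\<forall>s\<in>T. s \<noteq> g \<longrightarrow> \<kappa> x s = 0" for x
    by (rule coords_eqI) (use that g in auto)
  then show ?thesis using g by (auto simp: grading_of_def)
qed

lemma support_grading_of: "support G D (grading_of G D T \<kappa>) = T"
proof -
  have "grading_of G D T \<kappa> t \<noteq> {\<zero>\<^bsub>D\<^esub>}" if "t \<in> T" for t
  proof -
    have "basis_vec t \<in> grading_of G D T \<kappa> t"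
      using that by (simp add: grading_of_def)
    then show ?thesis using basis_vec_nonzero[OF that] by auto
  qed
  then show ?thesis
    using grading_of_outside by (auto simp: support_def)
qed

lemma grading_grading_of: "grading G D (grading_of G D T \<kappa>)"
  unfolding grading_def
proof (intro conjI ballI)
  let ?\<Gamma> = "grading_of G D T \<kappa>"
  show "?\<Gamma> \<in> (\<Pi>\<^sub>E g\<in>carrier G. {V. lin_subspace D V})"
    by (auto simp: grading_of_def lin_subspace_def)
  fix g h x y assume gh: "g \<in> carrier G" "h \<in> carrier G" "x \<in> ?\<Gamma> g" "y \<in> ?\<Gamma> h"
  have xy: "x \<in> carrier D" "y \<in> carrier D" using gh by (auto simp: grading_of_def)
  have "\<kappa> (x \<otimes>\<^bsub>D\<^esub> y) u = 0" if u: "u \<in> T" "u \<noteq> g \<otimes>\<^bsub>G\<^esub> h" for u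
    unfolding coords_mult[OF xy u(1)]
  proof (intro sum.neutral ballI)
    fix s t assume "s \<in> T" "t \<in> T"
    then show "graded_struct G \<sigma> s t u * \<kappa> x s * \<kappa> y t = 0"
      using gh u by (cases "s = g \<and> t = h") (auto simp: graded_struct_def grading_of_def)
  qed
  then show "x \<otimes>\<^bsub>D\<^esub> y \<in> ?\<Gamma> (g \<otimes>\<^bsub>G\<^esub> h)"
    using gh xy by (simp add: grading_of_def)
next
  let ?\<Gamma> = "grading_of G D T \<kappa>"
  fix x assume x: "x \<in> carrier D"
  let ?u = "\<lambda>g\<in>carrier G. of_coords (\<lambda>s. if s = g then \<kappa> x s else 0)"
  \<comment> \<open>Uniqueness: in any decomposition the coordinate at \<open>s\<close> comes from
    the component of degree \<open>s\<close> alone, so the components are read off from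
    \<open>\<kappa> x\<close>.\<close>
  have u_eq: "u = ?u \<and> {g \<in> carrier G. u g \<noteq> \<zero>\<^bsub>D\<^esub>} \<subseteq> T"
    if u: "u \<in> (\<Pi>\<^sub>E g\<in>carrier G. ?\<Gamma> g)" and x: "x = (\<Oplus>\<^bsub>D\<^esub>g\<in>{g \<in> carrier G. u g \<noteq> \<zero>\<^bsub>D\<^esub>}. u g)" for u
  proof -
    have uc: "u g \<in> carrier D" "\<And>s. s \<in> T \<Longrightarrow> s \<noteq> g \<Longrightarrow> \<kappa> (u g) s = 0" if "g \<in> carrier G" for g
    proof -
      have "u g \<in> ?\<Gamma> g" using u that by auto
      then show "u g \<in> carrier D" "\<And>s. s \<in> T \<Longrightarrow> s \<noteq> g \<Longrightarrow> \<kappa> (u g) s = 0"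
        using that by (auto simp: grading_of_def)
    qed
    let ?S = "{g \<in> carrier G. u g \<noteq> \<zero>\<^bsub>D\<^esub>}"
    have S: "?S \<subseteq> T"
    proof
      fix g assume g: "g \<in> ?S"
      show "g \<in> T"
      proof (rule ccontr)
        assume "g \<notin> T"
        then have "u g = \<zero>\<^bsub>D\<^esub>" using g uc by (intro coords_eqI) auto
        with g show False by simp
      qed
    qed
    then have fin: "finite ?S" using finite_I finite_subset by blast
    have "\<kappa> x s = \<kappa> (u s) s" if s: "s \<in> T" for s
    proof -
      have "\<kappa> x s = (\<Sum>g\<in>?S. \<kappa> (u g) s)"
        unfolding x by (rule linear_fn_finsum[OF coords_linear[OF s] fin]) (use uc in auto)
      also have "\<dots> = (\<Sum>g\<in>?S. if g = s then \<kappa> (u s) s else 0)"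
        using uc s by (intro sum.cong) auto
      also have "\<dots> = \<kappa> (u s) s" using fin s by auto
      finally show ?thesis .
    qed
    then have "u g = ?u g" if "g \<in> carrier G" for g
      using uc[OF that] that by (auto intro!: coords_eqI)
    then have "u = ?u" using u by (intro extensionalityI[of _ "carrier G"]) (auto simp: PiE_iff)
    then show ?thesis using S by simp
  qed
  show "\<exists>!u. u \<in> (\<Pi>\<^sub>E g\<in>carrier G. ?\<Gamma> g) \<and> finite {g \<in> carrier G. u g \<noteq> \<zero>\<^bsub>D\<^esub>} \<and>
      x = (\<Oplus>\<^bsub>D\<^esub>g\<in>{g \<in> carrier G. u g \<noteq> \<zero>\<^bsub>D\<^esub>}. u g)"
  proof (rule ex1I[of _ ?u])
    have out: "?u g = \<zero>\<^bsub>D\<^esub>" if "g \<in> carrier G" "g \<notin> T" for g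
      using that by (auto intro!: coords_eqI)
    have h1: "T \<subseteq> carrier G" and h2: "\<And>g. g \<in> T \<Longrightarrow> ?u g \<in> carrier D" by auto
    have fs: "finite {g \<in> carrier G. ?u g \<noteq> \<zero>\<^bsub>D\<^esub>}"
      "finsum D ?u {g \<in> carrier G. ?u g \<noteq> \<zero>\<^bsub>D\<^esub>} = finsum D ?u T"
      by (rule finsum_support[OF finite_I h1], fact h2, fact out)+
    have x_eq: "x = finsum D ?u T"
    proof (rule coords_eqI)
      fix i assume i: "i \<in> T"
      have "\<kappa> (finsum D ?u T) i = (\<Sum>g\<in>T. \<kappa> (?u g) i)"
        by (rule linear_fn_finsum[OF coords_linear[OF i]]) auto
      also have "\<dots> = (\<Sum>g\<in>T. if g = i then \<kappa> x i else 0)"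
        using i by (intro sum.cong) auto
      finally show "\<kappa> x i = \<kappa> (finsum D ?u T) i" using i by simp
    qed (use x in auto)
    have "?u \<in> (\<Pi>\<^sub>E g\<in>carrier G. ?\<Gamma> g)"
      by (auto simp: grading_of_def)
    then show "?u \<in> (\<Pi>\<^sub>E g\<in>carrier G. ?\<Gamma> g) \<and> finite {g \<in> carrier G. ?u g \<noteq> \<zero>\<^bsub>D\<^esub>} \<and>
      x = (\<Oplus>\<^bsub>D\<^esub>g\<in>{g \<in> carrier G. ?u g \<noteq> \<zero>\<^bsub>D\<^esub>}. ?u g)"
      by (intro conjI) (assumption, rule fs(1), rule trans[OF x_eq fs(2)[symmetric]])
  qed (use u_eq in blast)
qed

lemma grading_of_div_gradings1: "grading_of G D T \<kappa> \<in> div_gradings1 G D"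
proof -
  have "x \<in> Units D" if g: "g \<in> carrier G" and x: "x \<in> grading_of G D T \<kappa> g" "x \<noteq> \<zero>\<^bsub>D\<^esub>" for g x
  proof -
    have gT: "g \<in> T" using grading_of_outside[OF g] x by auto
    obtain c where c: "x = c \<odot>\<^bsub>D\<^esub> basis_vec g"
      using x(1) grading_of_line[OF gT] by (auto simp: line_def)
    then have c0: "c \<noteq> 0" using x(2) by auto
    let ?y = "\<lambda>d. (1 / (c * d)) \<odot>\<^bsub>D\<^esub> basis_vec (inv\<^bsub>G\<^esub> g)"
    have r: "x \<otimes>\<^bsub>D\<^esub> ?y (\<sigma> g (inv\<^bsub>G\<^esub> g)) = \<one>\<^bsub>D\<^esub>"
      using gT c0 sigma_nonzero[of g "inv\<^bsub>G\<^esub> g"] by (simp add: c basis_vec_mult basis_vec_one)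
    have l: "?y (\<sigma> (inv\<^bsub>G\<^esub> g) g) \<otimes>\<^bsub>D\<^esub> x = \<one>\<^bsub>D\<^esub>"
      using gT c0 sigma_nonzero[of "inv\<^bsub>G\<^esub> g" g] by (simp add: c basis_vec_mult basis_vec_one)
    have xc: "x \<in> carrier D" by (simp add: c)
    \<comment> \<open>Right and left inverse were found with a priori different cocycle values in
      the denominator; associativity identifies them.\<close>
    have "?y (\<sigma> (inv\<^bsub>G\<^esub> g) g) = ?y (\<sigma> g (inv\<^bsub>G\<^esub> g))"
      by (rule inv_unique[OF l r]) (use xc in auto)
    then show ?thesis
      using l r xc unfolding Units_def by (metis (mono_tags, lifting) mem_Collect_eq smult_closed basis_vec_closed)
  qed
  moreover have "one_dimensional D (grading_of G D T \<kappa> t)" if "t \<in> T" for t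
    unfolding one_dimensional_def using grading_of_line[OF that] basis_vec_nonzero[OF that] by blast
  ultimately show ?thesis
    using grading_grading_of by (auto simp: div_gradings1_def division_grading_def support_grading_of)
qed

end

text \<open>Converse of \<open>grading_of_div_gradings1\<close>: spanning vectors of the components
  form a basis, because the decomposition into homogeneous parts exists and is unique, and the
  product of two of them is a nonzero multiple of a third.\<close>

lemma (in real_algebra) div_grading1_coords:
  fixes G :: "('g, 'k) monoid_scheme"
  assumes G: "group G" and \<xi>: "alg_coords D K \<gamma> \<eta> \<xi>" and one: "\<one>\<^bsub>D\<^esub> \<noteq> \<zero>\<^bsub>D\<^esub>"
    and \<Gamma>: "\<Gamma> \<in> div_gradings1 G D"
  obtains \<sigma> \<kappa> where "graded_coords G D (support G D \<Gamma>) \<sigma> \<kappa>" "\<Gamma> = grading_of G D (support G D \<Gamma>) \<kappa>"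
proof -
  interpret G: group G by (rule G)
  interpret X: coords D K \<gamma> \<eta> \<xi> by unfold_locales (rule \<xi>)
  define T where "T = support G D \<Gamma>"
  have \<Gamma>': "grading G D \<Gamma>" "\<And>g. g \<in> carrier G \<Longrightarrow> \<Gamma> g - {\<zero>\<^bsub>D\<^esub>} \<subseteq> Units D"
      "\<And>g. g \<in> T \<Longrightarrow> one_dimensional D (\<Gamma> g)"
    using \<Gamma> by (auto simp: div_gradings1_def division_grading_def T_def)
  have ext: "\<Gamma> \<in> extensional (carrier G)" and sub: "\<And>g. g \<in> carrier G \<Longrightarrow> lin_subspace D (\<Gamma> g)"
    using \<Gamma>'(1) by (auto simp: grading_def PiE_iff)
  have dec: "\<And>x. x \<in> carrier D \<Longrightarrow> \<exists>!u. u \<in> (\<Pi>\<^sub>E g\<in>carrier G. \<Gamma> g) \<and> finite {g \<in> carrier G. u g \<noteq> \<zero>\<^bsub>D\<^esub>} \<and>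
      x = (\<Oplus>\<^bsub>D\<^esub>g\<in>{g \<in> carrier G. u g \<noteq> \<zero>\<^bsub>D\<^esub>}. u g)"
    and mult: "\<And>g h x y. g \<in> carrier G \<Longrightarrow> h \<in> carrier G \<Longrightarrow> x \<in> \<Gamma> g \<Longrightarrow> y \<in> \<Gamma> h \<Longrightarrow> x \<otimes>\<^bsub>D\<^esub> y \<in> \<Gamma> (g \<otimes>\<^bsub>G\<^esub> h)"
    using \<Gamma>'(1) unfolding grading_def by blast+
  have TG: "T \<subseteq> carrier G" by (auto simp: T_def support_def)
  have out: "\<Gamma> g = {\<zero>\<^bsub>D\<^esub>}" if "g \<in> carrier G" "g \<notin> T" for g
    using that by (auto simp: T_def support_def)
  have zero_nonunit: "\<zero>\<^bsub>D\<^esub> \<notin> Units D"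
    using one by (auto simp: Units_def)
  have "\<forall>t\<in>T. \<exists>x. x \<in> carrier D \<and> x \<noteq> \<zero>\<^bsub>D\<^esub> \<and> \<Gamma> t = line D x"
    using \<Gamma>'(3) by (auto simp: one_dimensional_def)
  then obtain Y where Y: "\<And>t. t \<in> T \<Longrightarrow> Y t \<in> carrier D \<and> Y t \<noteq> \<zero>\<^bsub>D\<^esub> \<and> \<Gamma> t = line D (Y t)"
    by metis
  have Y\<Gamma>: "Y t \<in> \<Gamma> t" if "t \<in> T" for t
    using Y[OF that] smult_one[of "Y t"] unfolding line_def by (metis rangeI)
  have Yunit: "Y t \<in> Units D" if "t \<in> T" for t
    using Y[OF that] Y\<Gamma>[OF that] \<Gamma>'(2)[of t] TG that by auto
  \<comment> \<open>A product of units is a unit, hence nonzero, so its degree lies in the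
    support.\<close>
  have Tm: "s \<otimes>\<^bsub>G\<^esub> t \<in> T" if st: "s \<in> T" "t \<in> T" for s t
  proof -
    have "Y s \<otimes>\<^bsub>D\<^esub> Y t \<in> Units D" using Yunit st by simp
    then have "Y s \<otimes>\<^bsub>D\<^esub> Y t \<noteq> \<zero>\<^bsub>D\<^esub>" using zero_nonunit by metis
    moreover have "Y s \<otimes>\<^bsub>D\<^esub> Y t \<in> \<Gamma> (s \<otimes>\<^bsub>G\<^esub> t)" using mult Y\<Gamma> st TG by blast
    ultimately show ?thesis using st TG out[of "s \<otimes>\<^bsub>G\<^esub> t"] by auto
  qed
  \<comment> \<open>Linear independence of homogeneous vectors: two coefficient families give two
    families \<open>?u c\<close> and \<open>?u d\<close> of components of the same element, and the
    decomposition is unique. The finite set \<open>P\<close> is kept general because the statement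
    is first used before the support is known to be finite.\<close>
  have comb_unique: "\<forall>t\<in>P. c t = d t"
    if P: "finite P" "P \<subseteq> T" and X: "\<And>t. t \<in> P \<Longrightarrow> X t \<in> carrier D \<and> X t \<noteq> \<zero>\<^bsub>D\<^esub> \<and> \<Gamma> t = line D (X t)"
      and eq: "(\<Oplus>\<^bsub>D\<^esub>t\<in>P. c t \<odot>\<^bsub>D\<^esub> X t) = (\<Oplus>\<^bsub>D\<^esub>t\<in>P. d t \<odot>\<^bsub>D\<^esub> X t)" for P X and c d :: "'g \<Rightarrow> real"
  proof -
    let ?u = "\<lambda>c. \<lambda>g\<in>carrier G. if g \<in> P then c g \<odot>\<^bsub>D\<^esub> X g else \<zero>\<^bsub>D\<^esub>"
    have u: "?u c \<in> (\<Pi>\<^sub>E g\<in>carrier G. \<Gamma> g)" "finite {g \<in> carrier G. ?u c g \<noteq> \<zero>\<^bsub>D\<^esub>}"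
      "finsum D (?u c) {g \<in> carrier G. ?u c g \<noteq> \<zero>\<^bsub>D\<^esub>} = (\<Oplus>\<^bsub>D\<^esub>t\<in>P. c t \<odot>\<^bsub>D\<^esub> X t)" for c :: "'g \<Rightarrow> real"
    proof -
      show "?u c \<in> (\<Pi>\<^sub>E g\<in>carrier G. \<Gamma> g)"
        using X sub by (auto simp: line_def lin_subspace_def)
      have "P \<subseteq> carrier G" "\<And>g. g \<in> P \<Longrightarrow> ?u c g \<in> carrier D"
        "\<And>g. g \<in> carrier G \<Longrightarrow> g \<notin> P \<Longrightarrow> ?u c g = \<zero>\<^bsub>D\<^esub>"
        using P X TG by auto
      note fs = finsum_support[where u = "?u c" and S = "carrier G", OF P(1) this]
      have eq: "finsum D (?u c) P = (\<Oplus>\<^bsub>D\<^esub>t\<in>P. c t \<odot>\<^bsub>D\<^esub> X t)"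
        by (rule finsum_cong') (use P X TG in auto)
      show "finite {g \<in> carrier G. ?u c g \<noteq> \<zero>\<^bsub>D\<^esub>}" by (rule fs(1))
      show "finsum D (?u c) {g \<in> carrier G. ?u c g \<noteq> \<zero>\<^bsub>D\<^esub>} = (\<Oplus>\<^bsub>D\<^esub>t\<in>P. c t \<odot>\<^bsub>D\<^esub> X t)"
        by (rule trans[OF fs(2) eq])
    qed
    define y where "y = (\<Oplus>\<^bsub>D\<^esub>t\<in>P. c t \<odot>\<^bsub>D\<^esub> X t)"
    have y: "y \<in> carrier D" using X by (auto simp: y_def)
    define Q where "Q u \<longleftrightarrow> u \<in> (\<Pi>\<^sub>E g\<in>carrier G. \<Gamma> g) \<and> finite {g \<in> carrier G. u g \<noteq> \<zero>\<^bsub>D\<^esub>} \<and>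
        y = finsum D u {g \<in> carrier G. u g \<noteq> \<zero>\<^bsub>D\<^esub>}" for u
    have "\<exists>!u. Q u" unfolding Q_def by (rule dec[OF y])
    moreover have "Q (?u c)"
      unfolding Q_def y_def by (intro conjI u(1) u(2) u(3)[symmetric])
    moreover have "Q (?u d)"
      unfolding Q_def y_def eq by (intro conjI u(1) u(2) u(3)[symmetric])
    ultimately have "?u c = ?u d" by blast
    then show ?thesis
    proof (intro ballI)
      fix t assume t: "t \<in> P"
      then have "c t \<odot>\<^bsub>D\<^esub> X t = d t \<odot>\<^bsub>D\<^esub> X t"
        using fun_cong[OF \<open>?u c = ?u d\<close>, of t] P TG by (auto split: if_splits)
      then show "c t = d t" using smult_right_cancel X[OF t] by blast
    qed
  qed
  \<comment> \<open>More homogeneous vectors than the dimension of \<open>D\<close> would be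
    linearly dependent.\<close>
  have finT: "finite T"
  proof (rule ccontr)
    assume "infinite T"
    then obtain P where P: "P \<subseteq> T" "finite P" "card P = Suc (card K)"
      using infinite_arbitrarily_large by blast
    obtain c where c: "\<exists>p\<in>P. c p \<noteq> 0" "\<forall>k\<in>K. (\<Sum>p\<in>P. c p * \<xi> (Y p) k) = 0"
      using linear_dependence[OF X.finite_I P(2), of "\<lambda>p k. \<xi> (Y p) k"] P(3) by auto
    have "(\<Oplus>\<^bsub>D\<^esub>t\<in>P. c t \<odot>\<^bsub>D\<^esub> Y t) = \<zero>\<^bsub>D\<^esub>"
    proof (rule X.coords_eqI)
      fix k assume k: "k \<in> K"
      have "\<xi> (\<Oplus>\<^bsub>D\<^esub>t\<in>P. c t \<odot>\<^bsub>D\<^esub> Y t) k = (\<Sum>t\<in>P. \<xi> (c t \<odot>\<^bsub>D\<^esub> Y t) k)"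
        by (rule linear_fn_finsum[OF X.coords_linear[OF k] P(2)]) (use Y P in auto)
      also have "\<dots> = (\<Sum>p\<in>P. c p * \<xi> (Y p) k)"
        using k Y P by (intro sum.cong) auto
      finally show "\<xi> (\<Oplus>\<^bsub>D\<^esub>t\<in>P. c t \<odot>\<^bsub>D\<^esub> Y t) k = \<xi> \<zero>\<^bsub>D\<^esub> k" using c k by simp
    qed (use Y P in \<open>auto intro!: finsum_closed\<close>)
    also have "\<dots> = (\<Oplus>\<^bsub>D\<^esub>t\<in>P. 0 \<odot>\<^bsub>D\<^esub> Y t)"
      using Y P by (intro add.finprod_one_eqI[symmetric]) auto
    finally have "\<forall>t\<in>P. c t = 0"
      using comb_unique[OF P(2,1), of Y c "\<lambda>_. 0"] Y P by blast
    with c(1) show False by blast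
  qed
  have "T \<noteq> {}"
  proof
    assume "T = {}"
    obtain u where u: "u \<in> (\<Pi>\<^sub>E g\<in>carrier G. \<Gamma> g)"
        "\<one>\<^bsub>D\<^esub> = (\<Oplus>\<^bsub>D\<^esub>g\<in>{g \<in> carrier G. u g \<noteq> \<zero>\<^bsub>D\<^esub>}. u g)"
      using dec[of "\<one>\<^bsub>D\<^esub>"] by auto
    have S: "{g \<in> carrier G. u g \<noteq> \<zero>\<^bsub>D\<^esub>} = {}" using u(1) out \<open>T = {}\<close> by auto
    show False using u(2) one unfolding S by simp
  qed
  have subT: "subgroup T G"
  proof -
    \<comment> \<open>A left translation is injective on the finite set \<open>T\<close>, hence
      onto; the identity and inverses come from solving \<open>t s = r\<close>.\<close>
    have ex: "\<exists>s\<in>T. t \<otimes>\<^bsub>G\<^esub> s = r" if tr: "t \<in> T" "r \<in> T" for t r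
    proof -
      have "inj_on (\<lambda>s. t \<otimes>\<^bsub>G\<^esub> s) T"
        by (rule inj_onI) (metis G.Units_l_cancel G.Units_eq TG tr(1) subsetD)
      then have "(\<lambda>s. t \<otimes>\<^bsub>G\<^esub> s) ` T = T"
        using Tm tr(1) by (intro endo_inj_surj[OF finT]) auto
      then have "r \<in> (\<lambda>s. t \<otimes>\<^bsub>G\<^esub> s) ` T" using tr(2) by simp
      then show ?thesis by auto
    qed
    obtain t where t: "t \<in> T" using \<open>T \<noteq> {}\<close> by auto
    then have 1: "\<one>\<^bsub>G\<^esub> \<in> T" using ex[OF t t] TG by (metis G.l_cancel_one G.r_cancel_one subsetD)
    have "inv\<^bsub>G\<^esub> s \<in> T" if s: "s \<in> T" for s
      using ex[OF s 1] TG s by (metis G.inv_equality G.inv_inv subsetD)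
    then show ?thesis using TG Tm \<open>T \<noteq> {}\<close> by (intro G.subgroupI) auto
  qed
  have 1: "\<one>\<^bsub>G\<^esub> \<in> T" using subT by (rule subgroup.one_closed)
  \<comment> \<open>The generator \<open>Y\<close> of the identity component satisfies
    \<open>Y^2 = c Y\<close> and is invertible, so it is \<open>c\<close> times the unit.\<close>
  have line1: "\<Gamma> \<one>\<^bsub>G\<^esub> = line D \<one>\<^bsub>D\<^esub>"
  proof -
    have y: "Y \<one>\<^bsub>G\<^esub> \<in> carrier D" "Y \<one>\<^bsub>G\<^esub> \<in> Units D" using Y Yunit 1 by auto
    have "Y \<one>\<^bsub>G\<^esub> \<otimes>\<^bsub>D\<^esub> Y \<one>\<^bsub>G\<^esub> \<in> \<Gamma> (\<one>\<^bsub>G\<^esub> \<otimes>\<^bsub>G\<^esub> \<one>\<^bsub>G\<^esub>)" using mult Y\<Gamma> 1 TG by blast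
    then obtain c where c: "Y \<one>\<^bsub>G\<^esub> \<otimes>\<^bsub>D\<^esub> Y \<one>\<^bsub>G\<^esub> = c \<odot>\<^bsub>D\<^esub> Y \<one>\<^bsub>G\<^esub>"
      using Y[OF 1] by (auto simp: line_def)
    have "Y \<one>\<^bsub>G\<^esub> = inv\<^bsub>D\<^esub> (Y \<one>\<^bsub>G\<^esub>) \<otimes>\<^bsub>D\<^esub> (Y \<one>\<^bsub>G\<^esub> \<otimes>\<^bsub>D\<^esub> Y \<one>\<^bsub>G\<^esub>)"
      using y by (simp add: m_assoc[symmetric])
    also have "\<dots> = c \<odot>\<^bsub>D\<^esub> \<one>\<^bsub>D\<^esub>" using y by (simp add: c)
    finally have "Y \<one>\<^bsub>G\<^esub> = c \<odot>\<^bsub>D\<^esub> \<one>\<^bsub>D\<^esub>" .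
    moreover from this have "c \<noteq> 0" using Y[OF 1] by auto
    ultimately show ?thesis using Y[OF 1] line_smult by simp
  qed
  \<comment> \<open>The unit itself is taken as the basis vector of identity degree, so that its
    coordinates are \<open>graded_unit\<close>.\<close>
  define X where "X = Y(\<one>\<^bsub>G\<^esub> := \<one>\<^bsub>D\<^esub>)"
  have X: "X t \<in> carrier D \<and> X t \<noteq> \<zero>\<^bsub>D\<^esub> \<and> \<Gamma> t = line D (X t)" if "t \<in> T" for t
    using Y[OF that] line1 one by (auto simp: X_def)
  have Xc [simp]: "X t \<in> carrier D" if "t \<in> T" for t using X[OF that] by simp
  have X\<Gamma>: "X t \<in> \<Gamma> t" if "t \<in> T" for t
    using X[OF that] smult_one[of "X t"] unfolding line_def by (metis rangeI)
  have Xunit: "X t \<in> Units D" if "t \<in> T" for t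
    using X[OF that] X\<Gamma>[OF that] \<Gamma>'(2)[of t] TG that by auto
  define L where "L c = (\<Oplus>\<^bsub>D\<^esub>t\<in>T. c t \<odot>\<^bsub>D\<^esub> X t)" for c :: "'g \<Rightarrow> real"
  have Lc [simp]: "L c \<in> carrier D" for c by (auto simp: L_def)
  have L_inj: "\<forall>t\<in>T. c t = d t" if "L c = L d" for c d
    using comb_unique[OF finT subset_refl X] that unfolding L_def by blast
  have L_surj: "\<exists>c\<in>T \<rightarrow>\<^sub>E UNIV. L c = x" if x: "x \<in> carrier D" for x
  proof -
    obtain u where u: "u \<in> (\<Pi>\<^sub>E g\<in>carrier G. \<Gamma> g)"
        "x = (\<Oplus>\<^bsub>D\<^esub>g\<in>{g \<in> carrier G. u g \<noteq> \<zero>\<^bsub>D\<^esub>}. u g)"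
      using dec[OF x] by auto
    have "\<forall>t\<in>T. \<exists>c. u t = c \<odot>\<^bsub>D\<^esub> X t"
    proof
      fix t assume t: "t \<in> T"
      then have "u t \<in> \<Gamma> t" using u(1) TG by auto
      then show "\<exists>c. u t = c \<odot>\<^bsub>D\<^esub> X t" using X[OF t] by (auto simp: line_def)
    qed
    then obtain c where c: "\<And>t. t \<in> T \<Longrightarrow> u t = c t \<odot>\<^bsub>D\<^esub> X t" by metis
    have u0: "u g = \<zero>\<^bsub>D\<^esub>" if "g \<in> carrier G" "g \<notin> T" for g
      using PiE_mem[OF u(1) that(1)] out[OF that] by simp
    have "x = finsum D u T"
      unfolding u(2) by (rule finsum_support(2)) (use finT TG c u0 in auto)
    also have "\<dots> = L (restrict c T)"
      unfolding L_def by (rule finsum_cong') (use c in auto)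
    finally show ?thesis by (intro bexI[of _ "restrict c T"]) auto
  qed
  have L_bij: "bij_betw L (T \<rightarrow>\<^sub>E UNIV) (carrier D)"
    unfolding bij_betw_def
  proof
    show "inj_on L (T \<rightarrow>\<^sub>E UNIV)"
      by (rule inj_onI) (use L_inj in \<open>auto intro: PiE_ext\<close>)
    show "L ` (T \<rightarrow>\<^sub>E UNIV) = carrier D" using L_surj by force
  qed
  define \<kappa> where "\<kappa> = inv_into (T \<rightarrow>\<^sub>E UNIV) L"
  have \<kappa>_bij: "bij_betw \<kappa> (carrier D) (T \<rightarrow>\<^sub>E UNIV)"
    unfolding \<kappa>_def by (rule bij_betw_inv_into[OF L_bij])
  have L\<kappa>: "L (\<kappa> x) = x" if "x \<in> carrier D" for x
    using L_bij that by (simp add: \<kappa>_def bij_betw_def f_inv_into_f)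
  have \<kappa>I: "\<kappa> x t = c t" if "x = L c" "t \<in> T" for x c t
    using L_inj[of "\<kappa> x" c] L\<kappa>[of x] that by simp
  have L_add: "L (\<lambda>t. c t + d t) = L c \<oplus>\<^bsub>D\<^esub> L d" for c d
  proof -
    have "L (\<lambda>t. c t + d t) = (\<Oplus>\<^bsub>D\<^esub>t\<in>T. c t \<odot>\<^bsub>D\<^esub> X t \<oplus>\<^bsub>D\<^esub> d t \<odot>\<^bsub>D\<^esub> X t)"
      unfolding L_def by (rule finsum_cong') (auto simp: smult_add_left)
    also have "\<dots> = L c \<oplus>\<^bsub>D\<^esub> L d"
      unfolding L_def by (rule finsum_addf) auto
    finally show ?thesis .
  qed
  have L_smult: "L (\<lambda>t. k * c t) = k \<odot>\<^bsub>D\<^esub> L c" for k c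
  proof -
    have "k \<odot>\<^bsub>D\<^esub> L c = (\<Oplus>\<^bsub>D\<^esub>t\<in>T. k \<odot>\<^bsub>D\<^esub> (c t \<odot>\<^bsub>D\<^esub> X t))"
      unfolding L_def by (rule M.finsum_smult_ldistr[OF finT]) (auto simp: real_field_def)
    also have "\<dots> = L (\<lambda>t. k * c t)"
      unfolding L_def by (rule finsum_cong') auto
    finally show ?thesis by simp
  qed
  have lin: "linear_fn D (\<lambda>x. \<kappa> x t)" if t: "t \<in> T" for t
    unfolding linear_fn_def
  proof (intro conjI ballI allI)
    fix x y assume xy: "x \<in> carrier D" "y \<in> carrier D"
    show "\<kappa> (x \<oplus>\<^bsub>D\<^esub> y) t = \<kappa> x t + \<kappa> y t"
      by (rule \<kappa>I[OF _ t]) (use L_add[of "\<kappa> x" "\<kappa> y"] L\<kappa> xy in simp)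
  next
    fix k x assume x: "x \<in> carrier D"
    show "\<kappa> (k \<odot>\<^bsub>D\<^esub> x) t = k * \<kappa> x t"
      by (rule \<kappa>I[OF _ t]) (use L_smult[of k "\<kappa> x"] L\<kappa> x in simp)
  qed
  have \<kappa>X: "\<kappa> (X s) t = (if t = s then 1 else 0)" if "s \<in> T" "t \<in> T" for s t
  proof (rule \<kappa>I[OF _ that(2)])
    have "L (\<lambda>t. if t = s then 1 else 0) = (\<Oplus>\<^bsub>D\<^esub>t\<in>T. if s = t then X t else \<zero>\<^bsub>D\<^esub>)"
      unfolding L_def by (rule finsum_cong') auto
    also have "\<dots> = X s" by (rule add.finprod_singleton) (use that finT in auto)
    finally show "X s = L (\<lambda>t. if t = s then 1 else 0)" by simp
  qed
  have "\<exists>c. c \<noteq> 0 \<and> X s \<otimes>\<^bsub>D\<^esub> X t = c \<odot>\<^bsub>D\<^esub> X (s \<otimes>\<^bsub>G\<^esub> t)" if st: "s \<in> T" "t \<in> T" for s t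
  proof -
    have "X s \<otimes>\<^bsub>D\<^esub> X t \<in> \<Gamma> (s \<otimes>\<^bsub>G\<^esub> t)" using mult X\<Gamma> st TG by blast
    then obtain c where c: "X s \<otimes>\<^bsub>D\<^esub> X t = c \<odot>\<^bsub>D\<^esub> X (s \<otimes>\<^bsub>G\<^esub> t)"
      using X[OF Tm[OF st]] by (auto simp: line_def)
    moreover have "X s \<otimes>\<^bsub>D\<^esub> X t \<in> Units D" using Xunit st by simp
    ultimately show ?thesis
      using zero_nonunit smult_zero(1)[of "X (s \<otimes>\<^bsub>G\<^esub> t)"] Tm[OF st] by (metis Xc)
  qed
  then obtain \<sigma> where \<sigma>: "\<And>s t. s \<in> T \<Longrightarrow> t \<in> T \<Longrightarrow> \<sigma> s t \<noteq> 0 \<and> X s \<otimes>\<^bsub>D\<^esub> X t = \<sigma> s t \<odot>\<^bsub>D\<^esub> X (s \<otimes>\<^bsub>G\<^esub> t)"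
    by metis
  have expand: "h x = (\<Sum>t\<in>T. \<kappa> x t * h (X t))" if h: "linear_fn D h" and x: "x \<in> carrier D" for h x
  proof -
    have "h x = h (L (\<kappa> x))" using L\<kappa>[OF x] by simp
    also have "\<dots> = (\<Sum>t\<in>T. h (\<kappa> x t \<odot>\<^bsub>D\<^esub> X t))"
      unfolding L_def by (rule linear_fn_finsum[OF h finT]) auto
    also have "\<dots> = (\<Sum>t\<in>T. \<kappa> x t * h (X t))"
      using h by (intro sum.cong) (auto simp: linear_fn_def)
    finally show ?thesis .
  qed
  have \<kappa>mult: "\<kappa> (x \<otimes>\<^bsub>D\<^esub> y) u = (\<Sum>s\<in>T. \<Sum>t\<in>T. graded_struct G \<sigma> s t u * \<kappa> x s * \<kappa> y t)"
    if xy: "x \<in> carrier D" "y \<in> carrier D" and u: "u \<in> T" for x y u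
  proof -
    have "\<kappa> (x \<otimes>\<^bsub>D\<^esub> y) u = (\<Sum>s\<in>T. \<kappa> x s * \<kappa> (X s \<otimes>\<^bsub>D\<^esub> y) u)"
      by (rule expand[OF _ xy(1), where h = "\<lambda>x. \<kappa> (x \<otimes>\<^bsub>D\<^esub> y) u"])
        (use lin[OF u] xy in \<open>auto simp: linear_fn_def l_distr\<close>)
    also have "\<dots> = (\<Sum>s\<in>T. \<kappa> x s * (\<Sum>t\<in>T. \<kappa> y t * \<kappa> (X s \<otimes>\<^bsub>D\<^esub> X t) u))"
    proof (intro sum.cong refl arg_cong2[where f = "(*)"])
      fix s assume s: "s \<in> T"
      show "\<kappa> (X s \<otimes>\<^bsub>D\<^esub> y) u = (\<Sum>t\<in>T. \<kappa> y t * \<kappa> (X s \<otimes>\<^bsub>D\<^esub> X t) u)"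
        by (rule expand[OF _ xy(2), where h = "\<lambda>y. \<kappa> (X s \<otimes>\<^bsub>D\<^esub> y) u"])
          (use lin[OF u] xy s in \<open>auto simp: linear_fn_def r_distr\<close>)
    qed
    also have "\<dots> = (\<Sum>s\<in>T. \<Sum>t\<in>T. graded_struct G \<sigma> s t u * \<kappa> x s * \<kappa> y t)"
      unfolding sum_distrib_left
    proof (intro sum.cong refl)
      fix s t assume st: "s \<in> T" "t \<in> T"
      have "\<kappa> (X s \<otimes>\<^bsub>D\<^esub> X t) u = \<sigma> s t * \<kappa> (X (s \<otimes>\<^bsub>G\<^esub> t)) u"
        using \<sigma>[OF st] lin[OF u] Tm[OF st] by (simp add: linear_fn_def)
      also have "\<dots> = graded_struct G \<sigma> s t u"
        using \<kappa>X[OF Tm[OF st] u] by (auto simp: graded_struct_def)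
      finally show "\<kappa> x s * (\<kappa> y t * \<kappa> (X s \<otimes>\<^bsub>D\<^esub> X t) u) = graded_struct G \<sigma> s t u * \<kappa> x s * \<kappa> y t"
        by simp
    qed
    finally show ?thesis .
  qed
  have \<kappa>z: "\<kappa> \<zero>\<^bsub>D\<^esub> t = 0" if "t \<in> T" for t
    using lin[OF that] smult_zero(1)[of "\<zero>\<^bsub>D\<^esub>"] unfolding linear_fn_def by (metis mult_zero_left zero_closed)
  have \<kappa>1: "\<kappa> \<one>\<^bsub>D\<^esub> t = graded_unit G t" if "t \<in> T" for t
    using \<kappa>X[OF 1 that] by (simp add: X_def graded_unit_def)
  have gc: "graded_coords G D T \<sigma> \<kappa>"
    unfolding graded_coords_def alg_coords_def
    using subT \<sigma> finT real_alg_closed[OF real_alg] \<kappa>_bij lin \<kappa>mult \<kappa>z \<kappa>1 by auto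
  interpret A: graded_algebra D G T \<sigma> \<kappa>
    by unfold_locales (rule gc)
  have "X t = A.basis_vec t" if "t \<in> T" for t
    by (rule A.coords_eqI) (use \<kappa>X that in auto)
  then have "\<Gamma> g = grading_of G D T \<kappa> g" if "g \<in> carrier G" for g
    using X[of g] A.grading_of_line[of g] A.grading_of_outside[OF that] out[OF that] by (cases "g \<in> T") auto
  then have "\<Gamma> = grading_of G D T \<kappa>"
    using ext by (intro extensionalityI[of _ "carrier G"]) (auto simp: grading_of_def)
  with gc show ?thesis using that unfolding T_def by blast
qed

section \<open>Quadratic forms\<close>

lemma (in comm_monoid) finprod_if_subset:
  assumes "finite I" "P \<subseteq> I" "a \<in> P \<rightarrow> carrier G"
  shows "(\<Otimes>i\<in>I. if i \<in> P then a i else \<one>) = (\<Otimes>i\<in>P. a i)"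
  by (rule finprod_mono_neutral_cong_left[symmetric]) (use assms in auto)

locale quad_form =
  fixes K (structure) and \<mu> :: "'t \<Rightarrow> real"
  assumes quadratic: "quadratic_form K \<mu>" and finite_carrier [simp]: "finite (carrier K)"

sublocale quad_form \<subseteq> comm_group K
  using quadratic by (simp add: quadratic_form_def elementary_abelian_2_group_def)

context quad_form
begin

abbreviation \<beta> :: "'t \<Rightarrow> 't \<Rightarrow> real" where
  "\<beta> \<equiv> polarization K \<mu>"

lemma square_one [simp]: "u \<in> carrier K \<Longrightarrow> u \<otimes> u = \<one>"
  using quadratic by (simp add: quadratic_form_def elementary_abelian_2_group_def)

lemma cancel [simp]: "u \<in> carrier K \<Longrightarrow> v \<in> carrier K \<Longrightarrow> u \<otimes> (u \<otimes> v) = v"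
  by (simp add: m_assoc[symmetric])

lemma mult_eq_one_iff: "u \<in> carrier K \<Longrightarrow> v \<in> carrier K \<Longrightarrow> u \<otimes> v = \<one> \<longleftrightarrow> u = v"
  by (metis cancel r_one square_one)

lemma mu_cases: "u \<in> carrier K \<Longrightarrow> \<mu> u = 1 \<or> \<mu> u = -1"
  using quadratic by (auto simp: quadratic_form_def)

lemma mu_one [simp]: "\<mu> \<one> = 1"
  using quadratic by (simp add: quadratic_form_def)

lemma mu_mult: "u \<in> carrier K \<Longrightarrow> v \<in> carrier K \<Longrightarrow> \<mu> (u \<otimes> v) = \<mu> u * \<mu> v * \<beta> u v"
  using mu_cases[of u] mu_cases[of v] by (auto simp: polarization_def)

lemma beta_cases: "u \<in> carrier K \<Longrightarrow> v \<in> carrier K \<Longrightarrow> \<beta> u v = 1 \<or> \<beta> u v = -1"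
  using mu_cases[of u] mu_cases[of v] mu_cases[of "u \<otimes> v"] by (auto simp: polarization_def)

lemma beta_mult [simp]:
  "u \<in> carrier K \<Longrightarrow> v \<in> carrier K \<Longrightarrow> w \<in> carrier K \<Longrightarrow> \<beta> (u \<otimes> v) w = \<beta> u w * \<beta> v w"
  "u \<in> carrier K \<Longrightarrow> v \<in> carrier K \<Longrightarrow> w \<in> carrier K \<Longrightarrow> \<beta> u (v \<otimes> w) = \<beta> u v * \<beta> u w"
  using quadratic unfolding quadratic_form_def by blast+

lemma beta_sym: "u \<in> carrier K \<Longrightarrow> v \<in> carrier K \<Longrightarrow> \<beta> u v = \<beta> v u"
  by (simp add: polarization_def m_comm)

lemma beta_self [simp]: "u \<in> carrier K \<Longrightarrow> \<beta> u u = 1"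
  using mu_cases[of u] by (auto simp: polarization_def)

lemma beta_one [simp]:
  "u \<in> carrier K \<Longrightarrow> \<beta> \<one> u = 1" "u \<in> carrier K \<Longrightarrow> \<beta> u \<one> = 1"
  using mu_cases[of u] by (auto simp: polarization_def)

lemma beta_finprod:
  assumes "finite A" "g \<in> A \<rightarrow> carrier K" "v \<in> carrier K"
  shows "\<beta> (\<Otimes>i\<in>A. g i) v = (\<Prod>i\<in>A. \<beta> (g i) v)"
  using assms by (induction A) auto

lemma mu_finprod:
  assumes "finite A" "g \<in> A \<rightarrow> carrier K"
    and "\<And>i j. i \<in> A \<Longrightarrow> j \<in> A \<Longrightarrow> i \<noteq> j \<Longrightarrow> \<beta> (g i) (g j) = 1"
  shows "\<mu> (\<Otimes>i\<in>A. g i) = (\<Prod>i\<in>A. \<mu> (g i))"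
  using assms
proof (induction A)
  case (insert x A)
  have "\<beta> (\<Otimes>i\<in>A. g i) (g x) = 1"
    using insert by (subst beta_finprod) (auto intro!: prod.neutral)
  with insert show ?case
    by (simp add: mu_mult beta_sym[of "g x"] Pi_def)
qed simp

text \<open>The relations of a symplectic basis without the requirement of being a basis, so that
  such a family can be grown pair by pair.\<close>

definition symplectic_pairs :: "nat \<Rightarrow> (nat \<Rightarrow> 't) \<Rightarrow> (nat \<Rightarrow> 't) \<Rightarrow> bool" where
  "symplectic_pairs r a b \<longleftrightarrow>
     (\<forall>i<r. a i \<in> carrier K \<and> b i \<in> carrier K) \<and>
     (\<forall>i<r. \<forall>j<r. \<beta> (a i) (a j) = 1 \<and> \<beta> (b i) (b j) = 1 \<and>
        \<beta> (a i) (b j) = (if i = j then -1 else 1) \<and>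
        \<beta> (b j) (a i) = (if i = j then -1 else 1))"

definition cell :: "'t \<Rightarrow> 't \<Rightarrow> bool \<times> bool \<Rightarrow> 't" where
  "cell x y p = (if fst p then x else \<one>) \<otimes> (if snd p then y else \<one>)"

text \<open>Coefficients over the field with two elements are stored as one pair of booleans per
  index, not as two subsets as in \<open>symplectic_basis\<close>: with functions on the index set,
  a sum over the group turns into a product over the pairs.\<close>

definition combo :: "nat \<Rightarrow> (nat \<Rightarrow> 't) \<Rightarrow> (nat \<Rightarrow> 't) \<Rightarrow> (nat \<Rightarrow> bool \<times> bool) \<Rightarrow> 't" where
  "combo r a b f = (\<Otimes>i\<in>{..<r}. cell (a i) (b i) (f i))"

abbreviation coeffs :: "nat \<Rightarrow> (nat \<Rightarrow> bool \<times> bool) set" where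
  "coeffs r \<equiv> {..<r} \<rightarrow>\<^sub>E UNIV"

lemma cell_closed [simp]: "x \<in> carrier K \<Longrightarrow> y \<in> carrier K \<Longrightarrow> cell x y p \<in> carrier K"
  by (simp add: cell_def)

lemma cell_mult:
  assumes "x \<in> carrier K" "y \<in> carrier K"
  shows "cell x y p \<otimes> cell x y q = cell x y (fst p \<noteq> fst q, snd p \<noteq> snd q)"
  using assms by (auto simp: cell_def m_ac)

lemma combo_closed:
  assumes "symplectic_pairs r a b"
  shows "combo r a b f \<in> carrier K"
  using assms by (auto simp: combo_def symplectic_pairs_def intro!: finprod_closed)

lemma combo_mult:
  assumes "symplectic_pairs r a b"
  shows "combo r a b f \<otimes> combo r a b g = combo r a b (\<lambda>i. (fst (f i) \<noteq> fst (g i), snd (f i) \<noteq> snd (g i)))"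
proof -
  have ab: "a i \<in> carrier K" "b i \<in> carrier K" if "i < r" for i
    using assms that by (auto simp: symplectic_pairs_def)
  have "combo r a b f \<otimes> combo r a b g =
      (\<Otimes>i\<in>{..<r}. cell (a i) (b i) (f i) \<otimes> cell (a i) (b i) (g i))"
    unfolding combo_def by (rule finprod_multf[symmetric]) (auto simp: ab)
  also have "\<dots> = combo r a b (\<lambda>i. (fst (f i) \<noteq> fst (g i), snd (f i) \<noteq> snd (g i)))"
    unfolding combo_def by (rule finprod_cong) (auto simp: ab cell_mult simp_implies_def)
  finally show ?thesis .
qed

lemma combo_cong: "symplectic_pairs r a b \<Longrightarrow> (\<And>i. i < r \<Longrightarrow> f i = g i) \<Longrightarrow> combo r a b f = combo r a b g"
  unfolding combo_def symplectic_pairs_def by (rule finprod_cong) (auto simp: simp_implies_def)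

text \<open>Pairing with \<open>a j\<close> detects the coefficient of \<open>b j\<close> and
  conversely. Thus the element determines its coefficients, and independence comes with the
  relations.\<close>

lemma beta_combo:
  assumes ab: "symplectic_pairs r a b" and j: "j < r"
  shows "\<beta> (combo r a b f) (a j) = (if snd (f j) then -1 else 1)"
    and "\<beta> (combo r a b f) (b j) = (if fst (f j) then -1 else 1)"
proof -
  have cl: "a i \<in> carrier K" "b i \<in> carrier K" if "i < r" for i
    using ab that by (auto simp: symplectic_pairs_def)
  have "\<beta> (combo r a b f) (a j) = (\<Prod>i<r. \<beta> (cell (a i) (b i) (f i)) (a j))"
    unfolding combo_def using j by (intro beta_finprod) (auto simp: cl)
  also have "\<dots> = (\<Prod>i<r. if i = j then (if snd (f i) then -1 else 1) else 1)"
    using ab j by (intro prod.cong) (auto simp: cell_def symplectic_pairs_def)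
  finally show "\<beta> (combo r a b f) (a j) = (if snd (f j) then -1 else 1)"
    using j by simp
  have "\<beta> (combo r a b f) (b j) = (\<Prod>i<r. \<beta> (cell (a i) (b i) (f i)) (b j))"
    unfolding combo_def using j by (intro beta_finprod) (auto simp: cl)
  also have "\<dots> = (\<Prod>i<r. if i = j then (if fst (f i) then -1 else 1) else 1)"
    using ab j by (intro prod.cong) (auto simp: cell_def symplectic_pairs_def)
  finally show "\<beta> (combo r a b f) (b j) = (if fst (f j) then -1 else 1)"
    using j by simp
qed

lemma inj_on_combo:
  assumes ab: "symplectic_pairs r a b"
  shows "inj_on (combo r a b) (coeffs r)"
proof (rule inj_onI)
  fix f g assume fg: "f \<in> coeffs r" "g \<in> coeffs r" "combo r a b f = combo r a b g"
  show "f = g"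
  proof (rule PiE_ext[OF fg(1,2)])
    fix j assume "j \<in> {..<r}"
    then show "f j = g j"
      using beta_combo[OF ab, of j f] beta_combo[OF ab, of j g] fg(3)
      by (auto simp: prod_eq_iff split: if_splits)
  qed
qed

lemma mu_combo:
  assumes ab: "symplectic_pairs r a b"
  shows "\<mu> (combo r a b f) = (\<Prod>i<r. \<mu> (cell (a i) (b i) (f i)))"
  unfolding combo_def using ab
  by (intro mu_finprod) (auto simp: cell_def symplectic_pairs_def)

lemma symplectic_pairs_card_le:
  assumes ab: "symplectic_pairs r a b"
  shows "4 ^ r \<le> card (carrier K)"
proof -
  have "combo r a b ` coeffs r \<subseteq> carrier K"
    by (rule image_subsetI) (rule combo_closed[OF ab])
  then have "card (coeffs r) \<le> card (carrier K)"
    by (rule card_inj_on_le[OF inj_on_combo[OF ab] _ finite_carrier])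
  then show ?thesis by (simp add: card_PiE card_UNIV_bool flip: UNIV_Times_UNIV)
qed

lemma combo_eq_finprods:
  assumes ab: "symplectic_pairs r a b" and p: "P \<subseteq> {..<r}" "Q \<subseteq> {..<r}"
  shows "combo r a b (\<lambda>i. (i \<in> P, i \<in> Q)) = (\<Otimes>i\<in>P. a i) \<otimes> (\<Otimes>i\<in>Q. b i)"
proof -
  have cl: "a i \<in> carrier K" "b i \<in> carrier K" if "i < r" for i
    using ab that by (auto simp: symplectic_pairs_def)
  have "combo r a b (\<lambda>i. (i \<in> P, i \<in> Q)) =
      (\<Otimes>i\<in>{..<r}. if i \<in> P then a i else \<one>) \<otimes> (\<Otimes>i\<in>{..<r}. if i \<in> Q then b i else \<one>)"
    unfolding combo_def cell_def fst_conv snd_conv by (rule finprod_multf) (auto simp: cl)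
  moreover have "(\<Otimes>i\<in>{..<r}. if i \<in> P then a i else \<one>) = (\<Otimes>i\<in>P. a i)"
    by (rule finprod_if_subset) (use p cl in auto)
  moreover have "(\<Otimes>i\<in>{..<r}. if i \<in> Q then b i else \<one>) = (\<Otimes>i\<in>Q. b i)"
    by (rule finprod_if_subset) (use p cl in auto)
  ultimately show ?thesis by simp
qed

text \<open>Uniqueness of the representation is a consequence of the relations by
  \<open>inj_on_combo\<close>, so spanning is what remains of the basis property.\<close>

lemma symplectic_basis_iff:
  "symplectic_basis K \<beta> r a b \<longleftrightarrow>
     symplectic_pairs r a b \<and> combo r a b ` coeffs r = carrier K" (is "?L \<longleftrightarrow> ?R")
proof
  assume L: ?L
  then have ab: "symplectic_pairs r a b"
    by (simp add: symplectic_basis_def symplectic_pairs_def)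
  have "t \<in> combo r a b ` coeffs r" if t: "t \<in> carrier K" for t
  proof -
    obtain p where p: "p \<in> Pow {..<r} \<times> Pow {..<r}"
        "t = (\<Otimes>i\<in>fst p. a i) \<otimes> (\<Otimes>i\<in>snd p. b i)"
      using L t by (auto simp: symplectic_basis_def)
    have "t = combo r a b (\<lambda>i. (i \<in> fst p, i \<in> snd p))"
      using p combo_eq_finprods[OF ab, of "fst p" "snd p"] by auto
    also have "\<dots> = combo r a b (\<lambda>i\<in>{..<r}. (i \<in> fst p, i \<in> snd p))"
      by (rule combo_cong[OF ab]) auto
    finally show ?thesis by auto
  qed
  then show ?R using ab combo_closed[OF ab] by auto
next
  assume R: ?R
  then have ab: "symplectic_pairs r a b" by simp
  have "\<exists>!p. p \<in> Pow {..<r} \<times> Pow {..<r} \<and>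
        t = (\<Otimes>i\<in>fst p. a i) \<otimes> (\<Otimes>i\<in>snd p. b i)" if t: "t \<in> carrier K" for t
  proof -
    obtain f where f: "f \<in> coeffs r" "t = combo r a b f" using R t by auto
    let ?p = "({i\<in>{..<r}. fst (f i)}, {i\<in>{..<r}. snd (f i)})"
    have "t = combo r a b (\<lambda>i. (i \<in> fst ?p, i \<in> snd ?p))"
      unfolding f(2) by (rule combo_cong[OF ab]) auto
    also have "\<dots> = (\<Otimes>i\<in>fst ?p. a i) \<otimes> (\<Otimes>i\<in>snd ?p. b i)"
      by (rule combo_eq_finprods[OF ab]) auto
    finally have 1: "t = \<dots>" .
    have 2: "q = ?p" if q: "q \<in> Pow {..<r} \<times> Pow {..<r}"
        "t = (\<Otimes>i\<in>fst q. a i) \<otimes> (\<Otimes>i\<in>snd q. b i)" for q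
    proof -
      let ?g = "\<lambda>i\<in>{..<r}. (i \<in> fst q, i \<in> snd q)"
      have "t = combo r a b (\<lambda>i. (i \<in> fst q, i \<in> snd q))"
        using q combo_eq_finprods[OF ab, of "fst q" "snd q"] by auto
      also have "\<dots> = combo r a b ?g"
        by (rule combo_cong[OF ab]) auto
      finally have "?g = f"
        using inj_on_combo[OF ab] f by (auto simp: inj_on_def)
      have "f i = (i \<in> fst q, i \<in> snd q)" if "i < r" for i
        using that fun_cong[OF \<open>?g = f\<close>, of i] by simp
      then show ?thesis using q(1) by (auto simp: prod_eq_iff)
    qed
    show ?thesis
      by (rule ex1I[of _ ?p]) (use 1 2 in auto)
  qed
  then show ?L
    using ab by (simp add: symplectic_basis_def symplectic_pairs_def)
qed

lemma symplectic_basis_bij: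
  assumes "symplectic_basis K \<beta> r a b"
  shows "bij_betw (combo r a b) (coeffs r) (carrier K)"
  using assms inj_on_combo by (auto simp: symplectic_basis_iff bij_betw_def)

lemma symplectic_basis_card:
  assumes "symplectic_basis K \<beta> r a b"
  shows "card (carrier K) = 4 ^ r"
  using bij_betw_same_card[OF symplectic_basis_bij[OF assms]]
  by (simp add: card_PiE card_UNIV_bool flip: UNIV_Times_UNIV)

text \<open>Distinct pairs are orthogonal, so the sum factors over the pairs. A pair contributes
  \<open>1 + x + y - x y\<close> for \<open>x = \<mu> (a i)\<close> and
  \<open>y = \<mu> (b i)\<close>, which is 2 unless both are -1, and then -2.\<close>

lemma symplectic_basis_sum:
  assumes ab: "symplectic_basis K \<beta> r a b"
  shows "(\<Sum>t\<in>carrier K. \<mu> t) = 2 ^ r * (\<Prod>i<r. arf_q (\<mu> (a i)) (\<mu> (b i)))"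
proof -
  have p: "symplectic_pairs r a b" using ab by (simp add: symplectic_basis_iff)
  have cl: "a i \<in> carrier K" "b i \<in> carrier K" if "i < r" for i
    using p that by (auto simp: symplectic_pairs_def)
  have "(\<Sum>t\<in>carrier K. \<mu> t) = (\<Sum>f\<in>coeffs r. \<Prod>i<r. \<mu> (cell (a i) (b i) (f i)))"
    by (simp add: sum.reindex_bij_betw[OF symplectic_basis_bij[OF ab], symmetric] mu_combo[OF p])
  also have "\<dots> = (\<Prod>i<r. \<Sum>q\<in>UNIV. \<mu> (cell (a i) (b i) q))"
    by (rule prod_sum_PiE[symmetric]) auto
  also have "\<dots> = (\<Prod>i<r. 2 * arf_q (\<mu> (a i)) (\<mu> (b i)))"
  proof (rule prod.cong[OF refl])
    fix i assume "i \<in> {..<r}"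
    then have i: "i < r" by simp
    have "\<mu> (a i \<otimes> b i) = - (\<mu> (a i) * \<mu> (b i))"
      using p i by (simp add: mu_mult cl symplectic_pairs_def)
    moreover have "(\<Sum>q\<in>UNIV. \<mu> (cell (a i) (b i) q)) = 1 + \<mu> (a i) + \<mu> (b i) + \<mu> (a i \<otimes> b i)"
      using cl[OF i]
      by (simp add: UNIV_Times_UNIV[symmetric] sum.cartesian_product[symmetric] UNIV_bool cell_def
          del: UNIV_Times_UNIV)
    ultimately show "(\<Sum>q\<in>UNIV. \<mu> (cell (a i) (b i) q)) = 2 * arf_q (\<mu> (a i)) (\<mu> (b i))"
      using mu_cases[OF cl(1)[OF i]] mu_cases[OF cl(2)[OF i]] by (auto simp: arf_q_def)
  qed
  also have "\<dots> = 2 ^ r * (\<Prod>i<r. arf_q (\<mu> (a i)) (\<mu> (b i)))"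
    by (simp add: prod.distrib)
  finally show ?thesis .
qed

lemma symplectic_basis_iso_Z2_power:
  assumes ab: "symplectic_basis K \<beta> r a b"
  shows "K \<cong> Z2_power (2 * r)"
proof -
  have p: "symplectic_pairs r a b" using ab by (simp add: symplectic_basis_iff)
  let ?Z = "{..<2 * r} \<rightarrow>\<^sub>E {0, 1::int}"
  have Zc: "carrier (Z2_power (2 * r)) = ?Z"
    by (auto simp: Z2_power_def carrier_integer_mod_group PiE_def Pi_def)
  \<comment> \<open>The places \<open>2 * i\<close> and \<open>2 * i + 1\<close> hold the
    coefficients of \<open>a i\<close> and \<open>b i\<close>; addition mod 2 becomes exclusive
    or.\<close>
  let ?\<theta> = "\<lambda>z. \<lambda>i\<in>{..<r}. (z (2 * i) = (1::int), z (2 * i + 1) = (1::int))"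
  have "bij_betw ?\<theta> ?Z (coeffs r)"
  proof (rule bij_betwI[where g = "\<lambda>f. \<lambda>j\<in>{..<2 * r}.
      if (if even j then fst (f (j div 2)) else snd (f (j div 2))) then 1 else 0"])
    fix z assume z: "z \<in> ?Z"
    have z01: "z j = 0 \<or> z j = 1" if "j < 2 * r" for j
      using z that by (auto simp: PiE_def Pi_def)
    show "(\<lambda>j\<in>{..<2 * r}. if (if even j then fst (?\<theta> z (j div 2)) else snd (?\<theta> z (j div 2)))
        then 1 else 0) = z" (is "?w = z")
    proof (rule PiE_ext[OF _ z])
      fix j assume "j \<in> {..<2 * r}"
      then have j: "j < 2 * r" "j div 2 < r" by auto
      show "?w j = z j"
        using j z01[OF j(1)] by (cases "even j") auto
    qed auto
  qed (auto simp: fun_eq_iff PiE_def extensional_def prod_eq_iff)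
  then have "bij_betw (combo r a b \<circ> ?\<theta>) ?Z (carrier K)"
    by (rule bij_betw_trans[OF _ symplectic_basis_bij[OF ab]])
  moreover have "combo r a b (?\<theta> (x \<otimes>\<^bsub>Z2_power (2 * r)\<^esub> y)) = combo r a b (?\<theta> x) \<otimes> combo r a b (?\<theta> y)"
    if xy: "x \<in> ?Z" "y \<in> ?Z" for x y
  proof -
    have v: "x j = 0 \<or> x j = 1" "y j = 0 \<or> y j = 1" if "j < 2 * r" for j
      using xy that by (auto simp: PiE_def Pi_def)
    show ?thesis
      unfolding combo_mult[OF p]
    proof (rule combo_cong[OF p])
      fix i assume i: "i < r"
      then show "?\<theta> (x \<otimes>\<^bsub>Z2_power (2 * r)\<^esub> y) i =
          (fst (?\<theta> x i) \<noteq> fst (?\<theta> y i), snd (?\<theta> x i) \<noteq> snd (?\<theta> y i))"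
        using v[of "2 * i"] v[of "2 * i + 1"] by (auto simp: Z2_power_def)
    qed
  qed
  ultimately have "combo r a b \<circ> ?\<theta> \<in> iso (Z2_power (2 * r)) K"
    by (auto simp: iso_def hom_def Zc bij_betw_def)
  then have "Z2_power (2 * r) \<cong> K" by (auto simp: is_iso_def)
  moreover have "group (Z2_power (2 * r))" by (simp add: Z2_power_def)
  ultimately show ?thesis by (rule group.iso_sym[rotated])
qed

end

section \<open>Normal forms, Arf invariant and isometries\<close>

lemma card_Z2_power: "card (carrier (Z2_power k)) = 2 ^ k"
  by (simp add: Z2_power_def card_PiE carrier_integer_mod_group)

locale type_I_form = quad_form K \<mu> for K (structure) and \<mu> :: "'t \<Rightarrow> real" +
  assumes type_I: "type_I K \<mu>"
begin

lemma nondegenerate: "t \<in> carrier K \<Longrightarrow> t \<noteq> \<one> \<Longrightarrow> \<exists>u\<in>carrier K. \<beta> t u = -1"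
proof -
  assume t: "t \<in> carrier K" "t \<noteq> \<one>"
  then have "t \<notin> radical K \<beta>" using type_I by (simp add: type_I_def)
  then obtain u where "u \<in> carrier K" "\<beta> u t \<noteq> 1"
    using t by (auto simp: radical_def)
  then show ?thesis using beta_cases[of t u] beta_sym[of t u] t by auto
qed

definition perp :: "nat \<Rightarrow> (nat \<Rightarrow> 't) \<Rightarrow> (nat \<Rightarrow> 't) \<Rightarrow> 't set" where
  "perp r a b = {w \<in> carrier K. \<forall>j<r. \<beta> w (a j) = 1 \<and> \<beta> w (b j) = 1}"

text \<open>Orthogonal projection: the combination is chosen to pair with every \<open>a j\<close>
  and \<open>b j\<close> as \<open>t\<close> does, so the coefficient of \<open>a i\<close> is read
  from \<open>b i\<close> and vice versa. In the product with \<open>t\<close> these values are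
  squared, and they are signs.\<close>

lemma perp_projection:
  assumes p: "symplectic_pairs r a b" and t: "t \<in> carrier K"
  shows "\<exists>f\<in>coeffs r. t \<otimes> combo r a b f \<in> perp r a b"
proof
  let ?f = "\<lambda>i\<in>{..<r}. (\<beta> t (b i) = -1, \<beta> t (a i) = -1)"
  have cl: "a i \<in> carrier K" "b i \<in> carrier K" if "i < r" for i
    using p that by (auto simp: symplectic_pairs_def)
  have "\<beta> (t \<otimes> combo r a b ?f) (a j) = 1 \<and> \<beta> (t \<otimes> combo r a b ?f) (b j) = 1" if j: "j < r" for j
    using j t combo_closed[OF p, of ?f] beta_combo[OF p j, of ?f] cl[OF j]
      beta_cases[OF t cl(1)[OF j]] beta_cases[OF t cl(2)[OF j]] by auto
  then show "t \<otimes> combo r a b ?f \<in> perp r a b"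
    using t combo_closed[OF p] by (simp add: perp_def)
  show "?f \<in> coeffs r" by auto
qed

lemma beta_perp_combo:
  assumes p: "symplectic_pairs r a b" and w: "w \<in> perp r a b"
  shows "\<beta> w (combo r a b f) = 1"
proof -
  have cl: "a i \<in> carrier K" "b i \<in> carrier K" if "i < r" for i
    using p that by (auto simp: symplectic_pairs_def)
  have w': "w \<in> carrier K" using w by (simp add: perp_def)
  have "\<beta> (combo r a b f) w = (\<Prod>i<r. \<beta> (cell (a i) (b i) (f i)) w)"
    unfolding combo_def by (rule beta_finprod) (auto simp: cl w')
  also have "\<dots> = (\<Prod>i<r. 1)"
    using w w' by (intro prod.cong) (auto simp: cell_def cl perp_def beta_sym[of _ w])
  finally show ?thesis
    using beta_sym[OF w' combo_closed[OF p]] by simp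
qed

text \<open>A partner of \<open>w\<close> in the whole group remains a partner after projection,
  because \<open>w\<close> is orthogonal to all combinations.\<close>

lemma perp_nondegenerate:
  assumes p: "symplectic_pairs r a b" and w: "w \<in> perp r a b" "w \<noteq> \<one>"
  shows "\<exists>u\<in>perp r a b. \<beta> w u = -1"
proof -
  have w': "w \<in> carrier K" using w by (simp add: perp_def)
  obtain u where u: "u \<in> carrier K" "\<beta> w u = -1"
    using nondegenerate[OF w' w(2)] by blast
  obtain f where "u \<otimes> combo r a b f \<in> perp r a b"
    using perp_projection[OF p u(1)] by blast
  moreover have "\<beta> w (u \<otimes> combo r a b f) = -1"
    using u w' beta_perp_combo[OF p w(1)] combo_closed[OF p] by simp
  ultimately show ?thesis by blast
qed

lemma perp_mult: "symplectic_pairs r a b \<Longrightarrow> u \<in> perp r a b \<Longrightarrow> v \<in> perp r a b \<Longrightarrow> u \<otimes> v \<in> perp r a b"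
  by (auto simp: perp_def symplectic_pairs_def)

lemma symplectic_pairs_extend:
  assumes p: "symplectic_pairs r a b" and "x \<in> perp r a b" "y \<in> perp r a b" "\<beta> x y = -1"
  shows "symplectic_pairs (Suc r) (a(r := x)) (b(r := y))"
  using assms beta_sym[of x y] beta_sym[of x "a _"] beta_sym[of y "a _"] beta_sym[of x "b _"] beta_sym[of y "b _"]
  by (auto simp: symplectic_pairs_def perp_def less_Suc_eq)

text \<open>The projection of any \<open>t\<close> is then trivial, which in exponent two says that
  \<open>t\<close> equals the combination.\<close>

lemma symplectic_basisI:
  assumes p: "symplectic_pairs r a b" and 1: "perp r a b \<subseteq> {\<one>}"
  shows "symplectic_basis K \<beta> r a b"
proof -
  have "t \<in> combo r a b ` coeffs r" if t: "t \<in> carrier K" for t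
  proof -
    obtain f where f: "f \<in> coeffs r" "t \<otimes> combo r a b f \<in> perp r a b"
      using perp_projection[OF p t] by blast
    then have "t = combo r a b f"
      using 1 t combo_closed[OF p] mult_eq_one_iff by auto
    with f show ?thesis by blast
  qed
  then show ?thesis
    using p combo_closed[OF p] by (auto simp: symplectic_basis_iff)
qed

text \<open>Take a maximal family of pairs with \<open>\<mu> = 1\<close>. On its orthogonal complement \<open>\<mu>\<close> is \<open>-1\<close>
  on both members of every pair with \<open>\<beta> = -1\<close>, so that the complement has rank at most one:
  for orthogonal pairs \<open>(x, y)\<close> and \<open>(w, v)\<close> of this kind, \<open>\<mu> (x w) = \<mu> (y w) = 1\<close>.\<close>

lemma normal_basis:
  obtains r a b and s :: real where "symplectic_basis K \<beta> r a b" "s = 1 \<or> s = -1" "s = -1 \<longrightarrow> r \<noteq> 0"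
    "\<forall>i<r. \<mu> (a i) = (if s = -1 \<and> Suc i = r then -1 else 1)"
    "\<forall>i<r. \<mu> (b i) = (if s = -1 \<and> Suc i = r then -1 else 1)"
proof -
  define P where "P r \<longleftrightarrow> (\<exists>a b. symplectic_pairs r a b \<and> (\<forall>i<r. \<mu> (a i) = 1 \<and> \<mu> (b i) = 1))" for r
  have "P 0" by (simp add: P_def symplectic_pairs_def)
  have bd: "r \<le> card (carrier K)" if Pr: "P r" for r
  proof -
    have "4 ^ r \<le> card (carrier K)"
      using Pr symplectic_pairs_card_le unfolding P_def by blast
    moreover have "r < 4 ^ r" by (rule less_exp[THEN less_le_trans]) (simp add: power_mono)
    ultimately show ?thesis by linarith
  qed
  define r where "r = (GREATEST r. P r)"
  have "P r" unfolding r_def using \<open>P 0\<close> bd by (rule GreatestI_nat)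
  have max: "\<not> P (Suc r)" using Greatest_le_nat[of P "Suc r", OF _ bd] unfolding r_def by fastforce
  obtain a b where p: "symplectic_pairs r a b" and \<mu>: "\<And>i. i < r \<Longrightarrow> \<mu> (a i) = 1 \<and> \<mu> (b i) = 1"
    using \<open>P r\<close> unfolding P_def by blast
  let ?W = "perp r a b"
  have cl: "x \<in> carrier K" if "x \<in> ?W" for x using that by (simp add: perp_def)
  have nohyp: "\<not> (\<mu> x = 1 \<and> \<mu> y = 1)" if xy: "x \<in> ?W" "y \<in> ?W" "\<beta> x y = -1" for x y
  proof
    assume m: "\<mu> x = 1 \<and> \<mu> y = 1"
    have "P (Suc r)"
      unfolding P_def using symplectic_pairs_extend[OF p xy] m \<mu>
      by (intro exI[of _ "a(r := x)"] exI[of _ "b(r := y)"]) (auto simp: less_Suc_eq)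
    with max show False by simp
  qed
  \<comment> \<open>If \<open>\<mu> x\<close> were 1, then \<open>\<mu> y = -1\<close> by
    maximality, hence \<open>\<mu> (x y) = - \<mu> x \<mu> y = 1\<close>, and \<open>x\<close>
    together with \<open>x y\<close> would be a pair that extends the family.\<close>
  have aniso: "\<mu> x = -1" if xy: "x \<in> ?W" "y \<in> ?W" "\<beta> x y = -1" for x y
  proof -
    have xy': "x \<otimes> y \<in> ?W" "\<beta> x (x \<otimes> y) = -1"
      using perp_mult[OF p xy(1,2)] xy cl by auto
    show ?thesis
      using nohyp[OF xy] nohyp[OF xy(1) xy'] mu_cases[of x] mu_cases[of y] mu_mult[of x y] cl xy by auto
  qed
  show thesis
  proof (cases "?W \<subseteq> {\<one>}")
    case True
    with symplectic_basisI[OF p] \<mu> show ?thesis by (intro that[of r a b 1]) auto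
  next
    case False
    then obtain x where x: "x \<in> ?W" "x \<noteq> \<one>" by auto
    then obtain y where y: "y \<in> ?W" "\<beta> x y = -1" using perp_nondegenerate[OF p] by blast
    have yx: "\<beta> y x = -1" using y x cl beta_sym[of x y] by simp
    let ?a = "a(r := x)" and ?b = "b(r := y)"
    have p': "symplectic_pairs (Suc r) ?a ?b"
      using symplectic_pairs_extend[OF p x(1) y] .
    have "perp (Suc r) ?a ?b \<subseteq> {\<one>}"
    proof (rule ccontr)
      assume "\<not> perp (Suc r) ?a ?b \<subseteq> {\<one>}"
      then obtain w where w: "w \<in> perp (Suc r) ?a ?b" "w \<noteq> \<one>" by auto
      then obtain v where v: "v \<in> perp (Suc r) ?a ?b" "\<beta> w v = -1"
        using perp_nondegenerate[OF p'] by blast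
      have wW: "w \<in> ?W" "\<beta> w x = 1" "\<beta> w y = 1" and vW: "v \<in> ?W"
        using w(1) v(1) by (auto simp: perp_def less_Suc_eq all_conj_distrib split: if_splits)
      have \<beta>w: "\<beta> x w = 1" "\<beta> y w = 1" using wW x y cl beta_sym by auto
      have "\<mu> x = -1" "\<mu> y = -1" "\<mu> w = -1"
        using aniso[OF x(1) y] aniso[OF y(1) x(1) yx] aniso[OF wW(1) vW v(2)] by auto
      then have "\<mu> (x \<otimes> w) = 1" "\<mu> (y \<otimes> w) = 1" "\<beta> (x \<otimes> w) (y \<otimes> w) = -1"
        using x y wW \<beta>w cl by (auto simp: mu_mult)
      with nohyp[OF perp_mult[OF p x(1) wW(1)] perp_mult[OF p y(1) wW(1)]] show False by simp
    qed
    then have "symplectic_basis K \<beta> (Suc r) ?a ?b" by (rule symplectic_basisI[OF p'])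
    then show ?thesis
      using aniso[OF x(1) y] aniso[OF y(1) x(1) yx] \<mu>
      by (intro that[of "Suc r" ?a ?b "-1"]) (auto simp: less_Suc_eq)
  qed
qed

lemma card_eq_power: "\<exists>r. card (carrier K) = 4 ^ r \<and> K \<cong> Z2_power (2 * r)"
  by (rule normal_basis) (use symplectic_basis_card symplectic_basis_iso_Z2_power in blast)

text \<open>Every symplectic basis yields the sum of \<open>\<mu>\<close> divided by
  \<open>2 ^ r\<close>, which does not depend on the basis. So the definite description in
  \<open>Arf\<close> has exactly one solution.\<close>

lemma Arf_eq:
  assumes "card (carrier K) = 4 ^ r"
  shows "(\<Sum>t\<in>carrier K. \<mu> t) = 2 ^ r * Arf K \<mu>"
proof -
  have val: "(\<Prod>i<r'. arf_q (\<mu> (a i)) (\<mu> (b i))) = (\<Sum>t\<in>carrier K. \<mu> t) / 2 ^ r"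
    if ab: "symplectic_basis K \<beta> r' a b" for r' a b
  proof -
    have "r' = r" using symplectic_basis_card[OF ab] assms by simp
    then show ?thesis using symplectic_basis_sum[OF ab] by simp
  qed
  obtain r' a b where ab: "symplectic_basis K \<beta> r' a b" using normal_basis by metis
  have "Arf K \<mu> = (\<Sum>t\<in>carrier K. \<mu> t) / 2 ^ r"
    unfolding Arf_def
  proof (rule the_equality)
    show "\<exists>r' a b. symplectic_basis K \<beta> r' a b \<and>
      (\<Sum>t\<in>carrier K. \<mu> t) / 2 ^ r = (\<Prod>i<r'. arf_q (\<mu> (a i)) (\<mu> (b i)))"
      using val[OF ab] ab by metis
  qed (use val in blast)
  then show ?thesis by simp
qed

end

lemma prod_last:
  fixes c :: real
  assumes "r \<noteq> 0"
  shows "(\<Prod>i<r. if Suc i = r then c else 1) = c"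
proof -
  obtain q where "r = Suc q" using assms not0_implies_Suc by blast
  then show ?thesis by (simp add: prod.delta)
qed

text \<open>The isometry maps one normal basis to the other.\<close>

lemma isometry:
  assumes K: "type_I_form K \<mu>" and L: "type_I_form L \<nu>"
    and card: "card (carrier K) = card (carrier L)"
    and sum: "(\<Sum>t\<in>carrier K. \<mu> t) = (\<Sum>t\<in>carrier L. \<nu> t)"
  obtains \<alpha> where "\<alpha> \<in> iso K L" "\<And>t. t \<in> carrier K \<Longrightarrow> \<nu> (\<alpha> t) = \<mu> t"
proof -
  interpret K: type_I_form K \<mu> by (rule K)
  interpret L: type_I_form L \<nu> by (rule L)
  obtain r a b and s :: real where ab: "symplectic_basis K K.\<beta> r a b" "s = 1 \<or> s = -1" "s = -1 \<longrightarrow> r \<noteq> 0"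
    "\<forall>i<r. \<mu> (a i) = (if s = -1 \<and> Suc i = r then -1 else 1)"
    "\<forall>i<r. \<mu> (b i) = (if s = -1 \<and> Suc i = r then -1 else 1)"
    by (rule K.normal_basis) (rule that)
  obtain r' a' b' and s' :: real where ab': "symplectic_basis L L.\<beta> r' a' b'" "s' = 1 \<or> s' = -1" "s' = -1 \<longrightarrow> r' \<noteq> 0"
    "\<forall>i<r'. \<nu> (a' i) = (if s' = -1 \<and> Suc i = r' then -1 else 1)"
    "\<forall>i<r'. \<nu> (b' i) = (if s' = -1 \<and> Suc i = r' then -1 else 1)"
    by (rule L.normal_basis) (rule that)
  have r: "r' = r"
    using K.symplectic_basis_card[OF ab(1)] L.symplectic_basis_card[OF ab'(1)] card by simp
  have "(\<Prod>i<r. arf_q (\<mu> (a i)) (\<mu> (b i))) = (\<Prod>i<r. if Suc i = r then s else 1)"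
    using ab(2) by (intro prod.cong refl) (use ab(4,5) in \<open>auto simp: arf_q_def\<close>)
  also have "\<dots> = s" using ab(2,3) prod_last[of r s] by (cases "r = 0") auto
  finally have 1: "(\<Prod>i<r. arf_q (\<mu> (a i)) (\<mu> (b i))) = s" .
  have "(\<Prod>i<r. arf_q (\<nu> (a' i)) (\<nu> (b' i))) = (\<Prod>i<r. if Suc i = r then s' else 1)"
    using ab'(2) by (intro prod.cong refl) (use ab'(4,5) r in \<open>auto simp: arf_q_def\<close>)
  also have "\<dots> = s'" using ab'(2,3) prod_last[of r s'] unfolding r by (cases "r = 0") auto
  \<comment> \<open>Both signs are the products that define the Arf invariant; with equal group
    orders, equal sums force them to agree, so the two normal forms coincide.\<close>
  finally have "s = s'"
    using 1 K.symplectic_basis_sum[OF ab(1)] L.symplectic_basis_sum[OF ab'(1)] sum r by simp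
  note ab' = ab'(1,4,5)[unfolded r \<open>s = s'\<close>[symmetric]]
  have p: "K.symplectic_pairs r a b" using ab(1) by (simp add: K.symplectic_basis_iff)
  have p': "L.symplectic_pairs r a' b'" using ab'(1) by (simp add: L.symplectic_basis_iff)
  note bij = K.symplectic_basis_bij[OF ab(1)] and bij' = L.symplectic_basis_bij[OF ab'(1)]
  let ?h = "inv_into (K.coeffs r) (K.combo r a b)"
  let ?\<alpha> = "L.combo r a' b' \<circ> ?h"
  have h: "?h t \<in> K.coeffs r" "K.combo r a b (?h t) = t" if "t \<in> carrier K" for t
    using bij that by (auto simp: bij_betw_def f_inv_into_f inv_into_into)
  have \<alpha>bij: "bij_betw ?\<alpha> (carrier K) (carrier L)"
    by (rule bij_betw_trans[OF bij_betw_inv_into[OF bij] bij'])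
  have "?\<alpha> (x \<otimes>\<^bsub>K\<^esub> y) = ?\<alpha> x \<otimes>\<^bsub>L\<^esub> ?\<alpha> y" if xy: "x \<in> carrier K" "y \<in> carrier K" for x y
  proof -
    \<comment> \<open>Exclusive or of the coefficients. It has to be restricted before it can be
      compared with a value of \<open>?h\<close>, which is extensional.\<close>
    let ?f = "\<lambda>i. (fst (?h x i) \<noteq> fst (?h y i), snd (?h x i) \<noteq> snd (?h y i))"
    have "x \<otimes>\<^bsub>K\<^esub> y = K.combo r a b ?f"
      using K.combo_mult[OF p, of "?h x" "?h y"] h xy by simp
    also have "\<dots> = K.combo r a b (restrict ?f {..<r})"
      by (rule K.combo_cong[OF p]) simp
    finally have "?h (x \<otimes>\<^bsub>K\<^esub> y) = restrict ?f {..<r}"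
      using bij by (simp add: bij_betw_def inv_into_f_eq)
    then have "?\<alpha> (x \<otimes>\<^bsub>K\<^esub> y) = L.combo r a' b' (restrict ?f {..<r})" by simp
    also have "\<dots> = L.combo r a' b' ?f" by (rule L.combo_cong[OF p']) simp
    also have "\<dots> = ?\<alpha> x \<otimes>\<^bsub>L\<^esub> ?\<alpha> y" by (simp add: L.combo_mult[OF p'])
    finally show ?thesis .
  qed
  then have "?\<alpha> \<in> iso K L"
    using \<alpha>bij by (auto simp: iso_def hom_def bij_betw_def)
  moreover have "\<nu> (?\<alpha> t) = \<mu> t" if t: "t \<in> carrier K" for t
  proof -
    have "\<nu> (L.cell (a' i) (b' i) q) = \<mu> (K.cell (a i) (b i) q)" if i: "i < r" for i q
      using p p' ab(4,5) ab'(2,3) i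
      by (auto simp: K.cell_def L.cell_def K.mu_mult L.mu_mult K.symplectic_pairs_def L.symplectic_pairs_def)
    then have "\<nu> (?\<alpha> t) = \<mu> (K.combo r a b (?h t))"
      by (simp add: K.mu_combo[OF p] L.mu_combo[OF p'])
    then show ?thesis using h(2)[OF t] by simp
  qed
  ultimately show ?thesis using that by blast
qed

section \<open>The quadratic form of a grading\<close>

text \<open>Associativity of the product of three basis vectors.\<close>

lemma (in graded_algebra) sigma_cocycle:
  assumes "r \<in> T" "s \<in> T" "t \<in> T"
  shows "\<sigma> r s * \<sigma> (r \<otimes>\<^bsub>G\<^esub> s) t = \<sigma> s t * \<sigma> r (s \<otimes>\<^bsub>G\<^esub> t)"
proof (rule smult_right_cancel)
  let ?x = "basis_vec (r \<otimes>\<^bsub>G\<^esub> s \<otimes>\<^bsub>G\<^esub> t)"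
  have "(\<sigma> r s * \<sigma> (r \<otimes>\<^bsub>G\<^esub> s) t) \<odot>\<^bsub>D\<^esub> ?x = basis_vec r \<otimes>\<^bsub>D\<^esub> basis_vec s \<otimes>\<^bsub>D\<^esub> basis_vec t"
    using assms by (simp add: basis_vec_mult)
  also have "\<dots> = basis_vec r \<otimes>\<^bsub>D\<^esub> (basis_vec s \<otimes>\<^bsub>D\<^esub> basis_vec t)"
    by (simp add: m_assoc)
  also have "\<dots> = (\<sigma> s t * \<sigma> r (s \<otimes>\<^bsub>G\<^esub> t)) \<odot>\<^bsub>D\<^esub> ?x"
    using assms by (simp add: basis_vec_mult G.m_assoc)
  finally show "(\<sigma> r s * \<sigma> (r \<otimes>\<^bsub>G\<^esub> s) t) \<odot>\<^bsub>D\<^esub> ?x = (\<sigma> s t * \<sigma> r (s \<otimes>\<^bsub>G\<^esub> t)) \<odot>\<^bsub>D\<^esub> ?x" .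
qed (use assms in \<open>auto simp: basis_vec_nonzero\<close>)

lemma (in graded_algebra) sigma_one:
  assumes "t \<in> T"
  shows "\<sigma> \<one>\<^bsub>G\<^esub> t = 1" "\<sigma> t \<one>\<^bsub>G\<^esub> = 1"
proof -
  have "\<sigma> \<one>\<^bsub>G\<^esub> t \<odot>\<^bsub>D\<^esub> basis_vec t = 1 \<odot>\<^bsub>D\<^esub> basis_vec t"
    using basis_vec_mult[of "\<one>\<^bsub>G\<^esub>" t] assms by (simp add: basis_vec_one)
  then show "\<sigma> \<one>\<^bsub>G\<^esub> t = 1" using smult_right_cancel basis_vec_nonzero[OF assms] by blast
  have "\<sigma> t \<one>\<^bsub>G\<^esub> \<odot>\<^bsub>D\<^esub> basis_vec t = 1 \<odot>\<^bsub>D\<^esub> basis_vec t"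
    using basis_vec_mult[of t "\<one>\<^bsub>G\<^esub>"] assms by (simp add: basis_vec_one)
  then show "\<sigma> t \<one>\<^bsub>G\<^esub> = 1" using smult_right_cancel basis_vec_nonzero[OF assms] by blast
qed

section \<open>Commutation factors\<close>

locale comm_graded_algebra = graded_algebra D G T \<sigma> \<kappa> + G: comm_group G
  for D :: "(real, 'a, 'm) module_scheme" and G :: "('g, 'k) monoid_scheme" and T \<sigma> \<kappa>
begin

definition comm_factor :: "'g \<Rightarrow> 'g \<Rightarrow> real" where
  "comm_factor s t = \<sigma> s t / \<sigma> t s"

text \<open>The instances of the cocycle identity at (s, s', t), (t, s, s') and (s, t, s') reflect
  moving \<open>X_t\<close> past \<open>X_s X_s'\<close> one factor at a time; the mixed values
  cancel in the quotient.\<close>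

lemma comm_factor_mult:
  assumes "s \<in> T" "s' \<in> T" "t \<in> T"
  shows "comm_factor (s \<otimes>\<^bsub>G\<^esub> s') t = comm_factor s t * comm_factor s' t"
proof -
  have c: "t \<otimes>\<^bsub>G\<^esub> s = s \<otimes>\<^bsub>G\<^esub> t" "t \<otimes>\<^bsub>G\<^esub> s' = s' \<otimes>\<^bsub>G\<^esub> t" using assms by (auto intro: G.m_comm)
  note nz = sigma_nonzero[OF assms(1,2)] sigma_nonzero[OF assms(3,1)] sigma_nonzero[OF assms(3,2)]
  have A: "\<sigma> (s \<otimes>\<^bsub>G\<^esub> s') t = \<sigma> s' t * \<sigma> s (s' \<otimes>\<^bsub>G\<^esub> t) / \<sigma> s s'"
    using sigma_cocycle[OF assms] nz by (simp add: field_simps)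
  have B: "\<sigma> t (s \<otimes>\<^bsub>G\<^esub> s') = \<sigma> t s * \<sigma> (s \<otimes>\<^bsub>G\<^esub> t) s' / \<sigma> s s'"
    using sigma_cocycle[OF assms(3,1,2)] nz by (simp add: field_simps c)
  have C: "\<sigma> s (s' \<otimes>\<^bsub>G\<^esub> t) = \<sigma> s t * \<sigma> (s \<otimes>\<^bsub>G\<^esub> t) s' / \<sigma> t s'"
    using sigma_cocycle[OF assms(1,3,2)] nz by (simp add: field_simps c)
  have "\<sigma> (s \<otimes>\<^bsub>G\<^esub> t) s' \<noteq> 0" using assms by (intro sigma_nonzero) auto
  then show ?thesis using nz by (simp add: comm_factor_def A B C field_simps)
qed

end

locale central_graded_algebra = comm_graded_algebra D G T \<sigma> \<kappa>
  for D :: "(real, 'a, 'm) module_scheme" and G :: "('g, 'k) monoid_scheme" and T \<sigma> \<kappa> +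
  fixes K :: "'i set" and e :: "'i \<Rightarrow> real"
  assumes central: "central_trace_alg D K e"
begin

text \<open>If \<open>X_t\<close> commutes with every basis vector, it is central, hence a scalar,
  and scalars have identity degree.\<close>

lemma comm_factor_nondegenerate:
  assumes t: "t \<in> T" and 1: "\<And>s. s \<in> T \<Longrightarrow> comm_factor s t = 1"
  shows "t = \<one>\<^bsub>G\<^esub>"
proof -
  have comm: "basis_vec t \<otimes>\<^bsub>D\<^esub> basis_vec s = basis_vec s \<otimes>\<^bsub>D\<^esub> basis_vec t" if s: "s \<in> T" for s
    using 1[OF s] sigma_nonzero[OF t s] t s G.m_comm[of s t]
    by (simp add: basis_vec_mult comm_factor_def)
  have "basis_vec t \<otimes>\<^bsub>D\<^esub> y = y \<otimes>\<^bsub>D\<^esub> basis_vec t" if y: "y \<in> carrier D" for y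
  proof (rule coords_eqI)
    fix u assume u: "u \<in> T"
    have "\<kappa> (basis_vec t \<otimes>\<^bsub>D\<^esub> y) u = (\<Sum>s\<in>T. \<kappa> y s * \<kappa> (basis_vec t \<otimes>\<^bsub>D\<^esub> basis_vec s) u)"
      by (rule linear_fn_expand[OF _ y, where h = "\<lambda>y. \<kappa> (basis_vec t \<otimes>\<^bsub>D\<^esub> y) u"])
        (use u in \<open>auto simp: linear_fn_def r_distr\<close>)
    also have "\<dots> = (\<Sum>s\<in>T. \<kappa> y s * \<kappa> (basis_vec s \<otimes>\<^bsub>D\<^esub> basis_vec t) u)"
      by (intro sum.cong refl) (simp add: comm)
    also have "\<dots> = \<kappa> (y \<otimes>\<^bsub>D\<^esub> basis_vec t) u"
      by (rule linear_fn_expand[OF _ y, where h = "\<lambda>y. \<kappa> (y \<otimes>\<^bsub>D\<^esub> basis_vec t) u", symmetric])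
        (use u in \<open>auto simp: linear_fn_def l_distr\<close>)
    finally show "\<kappa> (basis_vec t \<otimes>\<^bsub>D\<^esub> y) u = \<kappa> (y \<otimes>\<^bsub>D\<^esub> basis_vec t) u" .
  qed (use y in auto)
  then obtain c where "basis_vec t = c \<odot>\<^bsub>D\<^esub> \<one>\<^bsub>D\<^esub>"
    using central unfolding central_trace_alg_def by blast
  then have "\<kappa> (basis_vec t) t = c * graded_unit G t" using t by simp
  then show ?thesis using t by (auto simp: graded_unit_def split: if_splits)
qed

text \<open>Translation by \<open>s\<close> permutes the finite group \<open>T\<close>, so the
  product of all \<open>comm_factor r t\<close> is unchanged when each factor is multiplied by
  \<open>comm_factor s t\<close>. This makes that number a real root of unity.\<close>

lemma comm_factor_square:
  assumes "s \<in> T" "t \<in> T"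
  shows "comm_factor s t * comm_factor s t = 1"
proof -
  have bij: "bij_betw (\<lambda>r. s \<otimes>\<^bsub>G\<^esub> r) T T"
    by (rule bij_betwI[where g = "\<lambda>r. inv\<^bsub>G\<^esub> s \<otimes>\<^bsub>G\<^esub> r"])
      (use assms in \<open>auto simp: G.m_assoc[symmetric]\<close>)
  have nz: "(\<Prod>r\<in>T. comm_factor r t) \<noteq> 0"
    using assms sigma_nonzero by (simp add: comm_factor_def)
  have "(\<Prod>r\<in>T. comm_factor r t) = (\<Prod>r\<in>T. comm_factor (s \<otimes>\<^bsub>G\<^esub> r) t)"
    by (rule prod.reindex_bij_betw[OF bij, symmetric])
  also have "\<dots> = comm_factor s t ^ card T * (\<Prod>r\<in>T. comm_factor r t)"
    using assms by (simp add: comm_factor_mult prod.distrib)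
  finally have "comm_factor s t ^ card T = 1" using nz by simp
  then have "\<bar>comm_factor s t\<bar> ^ card T = 1" by (simp add: power_abs[symmetric])
  moreover have "card T > 0" using assms by (auto simp: card_gt_0_iff)
  ultimately have "\<bar>comm_factor s t\<bar> = 1"
    using power_eq_iff_eq_base[of "card T" "\<bar>comm_factor s t\<bar>" 1] by simp
  then show ?thesis using abs_mult_self_eq[of "comm_factor s t"] by simp
qed

text \<open>By multiplicativity, the commutation factor of \<open>s^2\<close> with any
  \<open>u\<close> is the square of a sign, so nondegeneracy applies. This is where working over the
  reals forces exponent two.\<close>

lemma T_square: "s \<in> T \<Longrightarrow> s \<otimes>\<^bsub>G\<^esub> s = \<one>\<^bsub>G\<^esub>"
proof -
  assume s: "s \<in> T"
  have "comm_factor u (s \<otimes>\<^bsub>G\<^esub> s) = 1" if u: "u \<in> T" for u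
  proof -
    have "comm_factor (s \<otimes>\<^bsub>G\<^esub> s) u = 1"
      using comm_factor_mult[OF s s u] comm_factor_square[OF s u] by simp
    then show ?thesis
      using sigma_nonzero[of u "s \<otimes>\<^bsub>G\<^esub> s"] sigma_nonzero[of "s \<otimes>\<^bsub>G\<^esub> s" u] s u
      by (simp add: comm_factor_def)
  qed
  then show ?thesis using comm_factor_nondegenerate s by blast
qed

end

section \<open>Normalization to a cocycle of signs\<close>

locale elementary_graded_algebra = comm_graded_algebra D G T \<sigma> \<kappa>
  for D :: "(real, 'a, 'm) module_scheme" and G :: "('g, 'k) monoid_scheme" and T \<sigma> \<kappa> +
  assumes T_square: "t \<in> T \<Longrightarrow> t \<otimes>\<^bsub>G\<^esub> t = \<one>\<^bsub>G\<^esub>"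
begin

lemma T_cancel [simp]: "s \<in> T \<Longrightarrow> t \<in> T \<Longrightarrow> s \<otimes>\<^bsub>G\<^esub> (s \<otimes>\<^bsub>G\<^esub> t) = t"
  by (simp add: G.m_assoc[symmetric] T_square)

lemma T_cancel' [simp]: "s \<in> T \<Longrightarrow> t \<in> T \<Longrightarrow> t \<otimes>\<^bsub>G\<^esub> (s \<otimes>\<^bsub>G\<^esub> t) = s"
  by (metis G.m_comm T_cancel T_closed(1))

lemma T_mult_eq_one: "s \<in> T \<Longrightarrow> t \<in> T \<Longrightarrow> s \<otimes>\<^bsub>G\<^esub> t = \<one>\<^bsub>G\<^esub> \<longleftrightarrow> t = s"
  by (metis G.r_one T_cancel T_closed(1) T_square)

text \<open>The identity \<open>X_s X_t X_t X_s = X_s^2 X_t^2\<close>, where the squares are scalars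
  because \<open>T\<close> has exponent two.\<close>

lemma sigma_square:
  assumes "s \<in> T" "t \<in> T"
  shows "\<sigma> s t * \<sigma> t s * \<sigma> (s \<otimes>\<^bsub>G\<^esub> t) (s \<otimes>\<^bsub>G\<^esub> t) = \<sigma> s s * \<sigma> t t"
proof -
  have c: "t \<otimes>\<^bsub>G\<^esub> s = s \<otimes>\<^bsub>G\<^esub> t" using assms by (auto intro: G.m_comm)
  have "\<sigma> s t * \<sigma> (s \<otimes>\<^bsub>G\<^esub> t) (s \<otimes>\<^bsub>G\<^esub> t) = \<sigma> t (s \<otimes>\<^bsub>G\<^esub> t) * \<sigma> s s"
    using sigma_cocycle[of s t "s \<otimes>\<^bsub>G\<^esub> t"] assms by simp
  moreover have "\<sigma> t t = \<sigma> t s * \<sigma> t (s \<otimes>\<^bsub>G\<^esub> t)"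
    using sigma_cocycle[of t t s] assms by (simp add: T_square sigma_one c)
  ultimately show ?thesis by (simp add: mult_ac)
qed

text \<open>Rescaling makes the diagonal values signs, and the others follow:
  \<open>\<sigma>' s t\<close> and \<open>\<sigma>' t s\<close> have the same absolute value, since
  the commutation factor is a sign, and by \<open>sigma_square\<close> their product has absolute
  value 1.\<close>

lemma normalize:
  obtains \<sigma>' \<kappa>' where "graded_coords G D T \<sigma>' \<kappa>'" "grading_of G D T \<kappa>' = grading_of G D T \<kappa>"
    "\<And>s t. s \<in> T \<Longrightarrow> t \<in> T \<Longrightarrow> \<sigma>' s t = 1 \<or> \<sigma>' s t = -1"
proof -
  \<comment> \<open>The scalar \<open>X_t^2\<close> is divided by its absolute value. At the
    identity the factor is 1, so the unit keeps its coordinates.\<close>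
  define f where "f t = 1 / sqrt \<bar>\<sigma> t t\<bar>" for t
  define \<sigma>' where "\<sigma>' s t = f s * f t * \<sigma> s t / f (s \<otimes>\<^bsub>G\<^esub> t)" for s t
  define \<kappa>' where "\<kappa>' = (\<lambda>x. \<lambda>t\<in>T. \<kappa> x t / f t)"
  have f0: "f t \<noteq> 0" if "t \<in> T" for t
    using sigma_nonzero[OF that that] by (simp add: f_def)
  have "alg_coords D T (graded_struct G \<sigma>') (graded_unit G) (\<lambda>x. \<lambda>t\<in>T. \<kappa> x (id t) / f t)"
  proof (rule alg_coords_rescale[OF alg_coords bij_betw_id f0])
    show "f u * graded_struct G \<sigma>' s t u = f s * f t * graded_struct G \<sigma> (id s) (id t) (id u)"
      if "s \<in> T" "t \<in> T" "u \<in> T" for s t u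
      using f0[OF that(3)] by (auto simp: graded_struct_def \<sigma>'_def)
    show "f t * graded_unit G t = graded_unit G (id t)" if "t \<in> T" for t
      by (simp add: graded_unit_def f_def sigma_one)
  qed
  then have 1: "graded_coords G D T \<sigma>' \<kappa>'"
    unfolding graded_coords_def using subgroup_T sigma_nonzero f0 by (auto simp: \<sigma>'_def \<kappa>'_def)
  have 2: "grading_of G D T \<kappa>' = grading_of G D T \<kappa>"
    unfolding grading_of_def
    by (rule restrict_ext) (use f0 in \<open>auto simp: \<kappa>'_def\<close>)
  have 3: "\<sigma>' s t = 1 \<or> \<sigma>' s t = -1" if st: "s \<in> T" "t \<in> T" for s t
  proof -
    interpret N: graded_algebra D G T \<sigma>' \<kappa>' by unfold_locales (rule 1)
    interpret N: elementary_graded_algebra D G T \<sigma>' \<kappa>'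
      by unfold_locales (rule T_square)
    have diag: "\<bar>\<sigma>' r r\<bar> = 1" if r: "r \<in> T" for r
      using sigma_nonzero[OF r r] r by (simp add: \<sigma>'_def T_square f_def sigma_one abs_mult)
    have flip: "\<bar>\<sigma>' t s\<bar> = \<bar>\<sigma>' s t\<bar>"
    proof -
      have "comm_factor s t * comm_factor s t = comm_factor \<one>\<^bsub>G\<^esub> t"
        using comm_factor_mult[OF st(1,1,2)] by (simp add: T_square st)
      also have "\<dots> = 1" using st by (simp add: comm_factor_def sigma_one)
      finally have "\<bar>comm_factor s t\<bar> = 1" by (simp flip: power2_eq_square add: abs_square_eq_1)
      then have "\<bar>\<sigma> t s\<bar> = \<bar>\<sigma> s t\<bar>"
        using sigma_nonzero[of t s] st by (simp add: comm_factor_def divide_eq_eq)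
      then show ?thesis using G.m_comm[of s t] st by (simp add: \<sigma>'_def abs_mult)
    qed
    have "\<bar>\<sigma>' s t\<bar> * \<bar>\<sigma>' t s\<bar> = 1"
      using arg_cong[OF N.sigma_square[OF st], of abs] diag st by (simp add: abs_mult)
    then have "\<bar>\<sigma>' s t\<bar> = 1" unfolding flip by (simp flip: power2_eq_square add: abs_square_eq_1)
    then show ?thesis by linarith
  qed
  show ?thesis by (rule that[OF 1 2 3])
qed

end

locale sign_graded_algebra = elementary_graded_algebra D G T \<sigma> \<kappa>
  for D :: "(real, 'a, 'm) module_scheme" and G :: "('g, 'k) monoid_scheme" and T \<sigma> \<kappa> +
  assumes sigma_sign: "s \<in> T \<Longrightarrow> t \<in> T \<Longrightarrow> \<sigma> s t = 1 \<or> \<sigma> s t = -1"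
begin

text \<open>The quadratic form of the grading; \<open>\<sigma> t t\<close> is the scalar
  \<open>X_t^2\<close>. The restriction matches the extensionality demanded by
  \<open>quadratic_form\<close>.\<close>

definition square_sign :: "'g \<Rightarrow> real" where
  "square_sign = (\<lambda>t\<in>T. \<sigma> t t)"

lemma sigma_mult_self [simp]: "s \<in> T \<Longrightarrow> t \<in> T \<Longrightarrow> \<sigma> s t * \<sigma> s t = 1"
  using sigma_sign[of s t] by auto

text \<open>For signs, \<open>sigma_square\<close> can be solved for the commutation factor; the
  right side is the polarization of \<open>square_sign\<close>.\<close>

lemma sigma_swap:
  assumes "s \<in> T" "t \<in> T"
  shows "\<sigma> s t * \<sigma> t s = \<sigma> (s \<otimes>\<^bsub>G\<^esub> t) (s \<otimes>\<^bsub>G\<^esub> t) * \<sigma> s s * \<sigma> t t"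
  using sigma_square[OF assms] sigma_sign[OF assms] sigma_sign[OF assms(2,1)] sigma_sign[of "s \<otimes>\<^bsub>G\<^esub> t" "s \<otimes>\<^bsub>G\<^esub> t"]
    sigma_sign[OF assms(1,1)] sigma_sign[OF assms(2,2)] assms by auto

lemma comm_factor_eq: "s \<in> T \<Longrightarrow> t \<in> T \<Longrightarrow> comm_factor s t = \<sigma> s t * \<sigma> t s"
  using sigma_sign[of t s] by (auto simp: comm_factor_def)

lemma comm_factor_swap: "s \<in> T \<Longrightarrow> t \<in> T \<Longrightarrow> comm_factor s t = comm_factor t s"
  by (simp add: comm_factor_eq)

lemma polarization_square_sign:
  assumes "s \<in> T" "t \<in> T"
  shows "polarization (G\<lparr>carrier := T\<rparr>) square_sign s t = comm_factor s t"
  using assms sigma_swap[OF assms] sigma_sign[of s s] sigma_sign[of t t]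
  by (auto simp: polarization_def square_sign_def comm_factor_eq)

lemma quadratic_form_square_sign: "quadratic_form (G\<lparr>carrier := T\<rparr>) square_sign"
proof -
  let ?K = "G\<lparr>carrier := T\<rparr>"
  have "comm_group ?K"
    using G.subgroup_imp_group[OF subgroup_T]
    by (rule group.group_comm_groupI) (auto intro: G.m_comm)
  then have "elementary_abelian_2_group ?K"
    by (simp add: elementary_abelian_2_group_def T_square)
  moreover have "square_sign \<in> carrier ?K \<rightarrow>\<^sub>E {1, -1}"
    using sigma_sign by (auto simp: square_sign_def)
  moreover have "square_sign \<one>\<^bsub>?K\<^esub> = 1"
    by (simp add: square_sign_def sigma_one)
  moreover have "polarization ?K square_sign (u \<otimes>\<^bsub>G\<^esub> v) w =
      polarization ?K square_sign u w * polarization ?K square_sign v w"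
    if "u \<in> T" "v \<in> T" "w \<in> T" for u v w
    using that by (simp add: polarization_square_sign comm_factor_mult)
  moreover have "polarization ?K square_sign u (v \<otimes>\<^bsub>G\<^esub> w) =
      polarization ?K square_sign u v * polarization ?K square_sign u w"
    if "u \<in> T" "v \<in> T" "w \<in> T" for u v w
    using that by (simp add: polarization_square_sign comm_factor_mult comm_factor_swap[of u])
  ultimately show ?thesis by (simp add: quadratic_form_def)
qed

end

locale central_sign_graded_algebra = central_graded_algebra D G T \<sigma> \<kappa> K e
  for D :: "(real, 'a, 'm) module_scheme" and G :: "('g, 'k) monoid_scheme" and T \<sigma> \<kappa> and
    K :: "'i set" and e +
  assumes sign: "s \<in> T \<Longrightarrow> t \<in> T \<Longrightarrow> \<sigma> s t = 1 \<or> \<sigma> s t = -1"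

sublocale central_sign_graded_algebra \<subseteq> sign_graded_algebra D G T \<sigma> \<kappa>
  by unfold_locales (use T_square sign in auto)

section \<open>Inertia of the trace form\<close>

lemma sum_sgn_eq_card:
  fixes h :: "'x \<Rightarrow> real"
  assumes "finite A"
  shows "(\<Sum>x\<in>A. sgn (h x)) = real (card {x\<in>A. h x > 0}) - real (card {x\<in>A. h x < 0})"
proof -
  have "(\<Sum>x\<in>A. sgn (h x)) = (\<Sum>x\<in>A. (if h x > 0 then 1 else 0) - (if h x < 0 then 1 else 0))"
    by (intro sum.cong refl) (auto simp: sgn_if)
  also have "\<dots> = real (card {x\<in>A. h x > 0}) - real (card {x\<in>A. h x < 0})"
    using assms by (simp add: sum_subtractf sum.If_cases Int_def)
  finally show ?thesis .
qed

context central_sign_graded_algebra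
begin

lemma type_I_form_square_sign: "type_I_form (G\<lparr>carrier := T\<rparr>) square_sign"
proof -
  let ?K = "G\<lparr>carrier := T\<rparr>"
  have "radical ?K (polarization ?K square_sign) = {\<one>\<^bsub>?K\<^esub>}"
  proof (intro equalityI subsetI)
    fix t assume "t \<in> radical ?K (polarization ?K square_sign)"
    then have t: "t \<in> T" "\<And>u. u \<in> T \<Longrightarrow> comm_factor u t = 1"
      by (auto simp: radical_def polarization_square_sign)
    then show "t \<in> {\<one>\<^bsub>?K\<^esub>}" using comm_factor_nondegenerate by simp
  next
    fix t assume "t \<in> {\<one>\<^bsub>?K\<^esub>}"
    then show "t \<in> radical ?K (polarization ?K square_sign)"
      by (auto simp: radical_def polarization_square_sign comm_factor_def sigma_one)
  qed
  then show ?thesis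
    using quadratic_form_square_sign by unfold_locales (simp_all add: type_I_def)
qed

text \<open>Both sets index a basis of \<open>D\<close>.\<close>

lemma card_T: "card T = card K"
proof -
  obtain \<gamma> \<eta> \<xi> where "alg_coords D K \<gamma> \<eta> \<xi>"
    using central unfolding central_trace_alg_def by blast
  then show ?thesis
    by (intro le_antisym card_le_of_coords[OF _ alg_coords] card_le_of_coords[OF alg_coords])
qed

text \<open>The basis vectors are orthogonal for the trace form, so that Sylvester's law of inertia
  compares the signs of \<open>\<sigma> t t\<close> with those of \<open>e\<close>.\<close>

lemma trace_square:
  assumes \<tau>: "linear_fn D \<tau>" "\<forall>x\<in>carrier D. \<forall>y\<in>carrier D. \<tau> (x \<otimes>\<^bsub>D\<^esub> y) = \<tau> (y \<otimes>\<^bsub>D\<^esub> x)"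
    and x: "x \<in> carrier D"
  shows "\<tau> (x \<otimes>\<^bsub>D\<^esub> x) = \<tau> \<one>\<^bsub>D\<^esub> * (\<Sum>t\<in>T. \<sigma> t t * (\<kappa> x t)\<^sup>2)"
proof -
  \<comment> \<open>Some \<open>X_s\<close> does not commute with \<open>X_u\<close>. Then
    \<open>X_s X_su\<close> and \<open>X_su X_s\<close> are different multiples of
    \<open>X_u\<close>, while the trace takes the same value on both, so it kills
    \<open>X_u\<close>.\<close>
  have \<tau>0: "\<tau> (basis_vec u) = 0" if u: "u \<in> T" "u \<noteq> \<one>\<^bsub>G\<^esub>" for u
  proof -
    obtain s where s: "s \<in> T" "comm_factor s u \<noteq> 1"
      using comm_factor_nondegenerate u by blast
    have us: "s \<otimes>\<^bsub>G\<^esub> u = u \<otimes>\<^bsub>G\<^esub> s" using u s by (auto intro: G.m_comm)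
    have e: "s \<otimes>\<^bsub>G\<^esub> u \<otimes>\<^bsub>G\<^esub> s = u" using u s unfolding us by (simp add: G.m_assoc T_square)
    have sm: "\<tau> (c \<odot>\<^bsub>D\<^esub> y) = c * \<tau> y" if "y \<in> carrier D" for c y
      using \<tau>(1) that by (simp add: linear_fn_def)
    have "\<tau> (basis_vec s \<otimes>\<^bsub>D\<^esub> basis_vec (s \<otimes>\<^bsub>G\<^esub> u)) = \<tau> (basis_vec (s \<otimes>\<^bsub>G\<^esub> u) \<otimes>\<^bsub>D\<^esub> basis_vec s)"
      using \<tau>(2) by simp
    then have "\<sigma> s (s \<otimes>\<^bsub>G\<^esub> u) * \<tau> (basis_vec u) = \<sigma> (s \<otimes>\<^bsub>G\<^esub> u) s * \<tau> (basis_vec u)"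
      using s u by (simp add: basis_vec_mult sm e)
    moreover have "\<sigma> s (s \<otimes>\<^bsub>G\<^esub> u) \<noteq> \<sigma> (s \<otimes>\<^bsub>G\<^esub> u) s"
    proof
      assume "\<sigma> s (s \<otimes>\<^bsub>G\<^esub> u) = \<sigma> (s \<otimes>\<^bsub>G\<^esub> u) s"
      then have "comm_factor (s \<otimes>\<^bsub>G\<^esub> u) s = 1"
        using s u sigma_nonzero[of s "s \<otimes>\<^bsub>G\<^esub> u"] by (simp add: comm_factor_def)
      then have "comm_factor u s = 1"
        using s u by (simp add: comm_factor_mult comm_factor_eq[of s s])
      then show False using s u comm_factor_swap by simp
    qed
    ultimately show ?thesis by simp
  qed
  have "\<tau> (x \<otimes>\<^bsub>D\<^esub> x) = (\<Sum>u\<in>T. \<kappa> (x \<otimes>\<^bsub>D\<^esub> x) u * \<tau> (basis_vec u))"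
    by (rule linear_fn_expand[OF \<tau>(1)]) (use x in auto)
  also have "\<dots> = (\<Sum>u\<in>T. if u = \<one>\<^bsub>G\<^esub> then \<kappa> (x \<otimes>\<^bsub>D\<^esub> x) \<one>\<^bsub>G\<^esub> * \<tau> \<one>\<^bsub>D\<^esub> else 0)"
    by (intro sum.cong refl) (simp add: \<tau>0 basis_vec_one)
  also have "\<dots> = \<tau> \<one>\<^bsub>D\<^esub> * \<kappa> (x \<otimes>\<^bsub>D\<^esub> x) \<one>\<^bsub>G\<^esub>" by simp
  also have "\<kappa> (x \<otimes>\<^bsub>D\<^esub> x) \<one>\<^bsub>G\<^esub> = (\<Sum>s\<in>T. \<Sum>t\<in>T. if t = s then \<sigma> s s * (\<kappa> x s)\<^sup>2 else 0)"
    unfolding coords_mult[OF x x T_closed(2)]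
    by (intro sum.cong refl) (auto simp: graded_struct_def T_mult_eq_one power2_eq_square T_square)
  also have "\<dots> = (\<Sum>t\<in>T. \<sigma> t t * (\<kappa> x t)\<^sup>2)" by simp
  finally show ?thesis .
qed

text \<open>If there were more \<open>t\<close> with \<open>w * \<sigma> t t > 0\<close> than
  \<open>k\<close> with \<open>w * e k > 0\<close>, some nonzero combination of these
  \<open>X_t\<close> would be annihilated by all these \<open>l k\<close>, and \<open>w\<close>
  times the trace of its square would be both positive and nonpositive. The sign \<open>w\<close>
  covers the positive and the negative part at once.\<close>

lemma card_sign_le:
  assumes w: "w = 1 \<or> w = -1"
  shows "card {t\<in>T. w * \<sigma> t t > 0} \<le> card {k\<in>K. w * e k > 0}"
proof (rule ccontr)
  let ?P = "{t\<in>T. w * \<sigma> t t > 0}" and ?S = "{k\<in>K. w * e k > 0}"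
  assume "\<not> card ?P \<le> card ?S"
  then have less: "card ?S < card ?P" by simp
  obtain \<tau> l where \<tau>: "linear_fn D \<tau>"
      "\<forall>x\<in>carrier D. \<forall>y\<in>carrier D. \<tau> (x \<otimes>\<^bsub>D\<^esub> y) = \<tau> (y \<otimes>\<^bsub>D\<^esub> x)"
      "\<tau> \<one>\<^bsub>D\<^esub> > 0" "\<forall>k\<in>K. linear_fn D (l k)"
      "\<forall>x\<in>carrier D. \<tau> (x \<otimes>\<^bsub>D\<^esub> x) = (\<Sum>k\<in>K. e k * (l k x)\<^sup>2)"
    using central unfolding central_trace_alg_def by blast
  have "finite K" using card_T T_closed(2) finite_I by (metis card_gt_0_iff empty_iff)
  then obtain c where c: "\<exists>t\<in>?P. c t \<noteq> 0" "\<forall>k\<in>?S. (\<Sum>t\<in>?P. c t * l k (basis_vec t)) = 0"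
    using linear_dependence[OF _ _ less, of "\<lambda>t k. l k (basis_vec t)"] by auto
  let ?x = "of_coords (\<lambda>t. if t \<in> ?P then c t else 0)"
  have l0: "l k ?x = 0" if k: "k \<in> ?S" for k
  proof -
    have "l k ?x = (\<Sum>t\<in>T. \<kappa> ?x t * l k (basis_vec t))"
      using \<tau>(4) k by (intro linear_fn_expand) auto
    also have "\<dots> = (\<Sum>t\<in>?P. c t * l k (basis_vec t))"
      by (rule sum.mono_neutral_cong_right) auto
    finally show ?thesis using c k by simp
  qed
  have "w * \<tau> (?x \<otimes>\<^bsub>D\<^esub> ?x) = (\<Sum>k\<in>K. (w * e k) * (l k ?x)\<^sup>2)"
    using \<tau>(5) by (simp add: sum_distrib_left mult.assoc)
  also have "\<dots> \<le> 0"
  proof (rule sum_nonpos)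
    fix k assume "k \<in> K"
    then show "(w * e k) * (l k ?x)\<^sup>2 \<le> 0"
      using l0[of k] by (cases "w * e k > 0") (auto simp: mult_nonpos_nonneg)
  qed
  finally have le: "w * \<tau> (?x \<otimes>\<^bsub>D\<^esub> ?x) \<le> 0" .
  have eq: "w * \<tau> (?x \<otimes>\<^bsub>D\<^esub> ?x) = \<tau> \<one>\<^bsub>D\<^esub> * (\<Sum>t\<in>?P. (w * \<sigma> t t) * (c t)\<^sup>2)"
  proof -
    have "(\<Sum>t\<in>T. (w * \<sigma> t t) * (\<kappa> ?x t)\<^sup>2) = (\<Sum>t\<in>?P. (w * \<sigma> t t) * (c t)\<^sup>2)"
      by (rule sum.mono_neutral_cong_right) auto
    moreover have "w * (a * (\<Sum>t\<in>T. \<sigma> t t * (h t)\<^sup>2)) = a * (\<Sum>t\<in>T. (w * \<sigma> t t) * (h t)\<^sup>2)"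
      for a and h :: "'g \<Rightarrow> real"
      by (simp add: sum_distrib_left mult_ac)
    ultimately show ?thesis
      unfolding trace_square[OF \<tau>(1,2) of_coords_closed] by (simp only:)
  qed
  have pos: "(\<Sum>t\<in>?P. (w * \<sigma> t t) * (c t)\<^sup>2) > 0"
  proof -
    obtain p where "p \<in> ?P" "c p \<noteq> 0" using c(1) by blast
    then show ?thesis by (intro sum_pos2[of _ p]) auto
  qed
  show False using le eq mult_pos_pos[OF \<tau>(3) pos] by linarith
qed

text \<open>The inequalities for both signs are equalities, because the positive and the negative
  \<open>t\<close> exhaust \<open>T\<close> and \<open>T\<close> is as large as
  \<open>K\<close>.\<close>

lemma sum_square_sign: "(\<Sum>t\<in>T. square_sign t) = (\<Sum>k\<in>K. sgn (e k))"
proof -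
  have finK: "finite K" using card_T T_closed(2) finite_I by (metis card_gt_0_iff empty_iff)
  have p: "card {t\<in>T. \<sigma> t t > 0} \<le> card {k\<in>K. e k > 0}"
    and m: "card {t\<in>T. \<sigma> t t < 0} \<le> card {k\<in>K. e k < 0}"
    using card_sign_le[of 1] card_sign_le[of "-1"] by simp_all
  have "T = {t\<in>T. \<sigma> t t > 0} \<union> {t\<in>T. \<sigma> t t < 0}"
    using sigma_nonzero by fastforce
  then have "card T = card ({t\<in>T. \<sigma> t t > 0} \<union> {t\<in>T. \<sigma> t t < 0})" by (rule arg_cong)
  also have "\<dots> = card {t\<in>T. \<sigma> t t > 0} + card {t\<in>T. \<sigma> t t < 0}"
    by (rule card_Un_disjoint) auto
  finally have "card T = card {t\<in>T. \<sigma> t t > 0} + card {t\<in>T. \<sigma> t t < 0}" .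
  moreover have "card ({k\<in>K. e k > 0} \<union> {k\<in>K. e k < 0}) \<le> card K"
    by (rule card_mono[OF finK]) auto
  then have "card {k\<in>K. e k > 0} + card {k\<in>K. e k < 0} \<le> card K"
    using finK by (subst (asm) card_Un_disjoint) auto
  ultimately have eq: "card {t\<in>T. \<sigma> t t > 0} = card {k\<in>K. e k > 0}"
      "card {t\<in>T. \<sigma> t t < 0} = card {k\<in>K. e k < 0}"
    using p m card_T by simp_all
  have "(\<Sum>t\<in>T. square_sign t) = (\<Sum>t\<in>T. sgn (\<sigma> t t))"
    using sigma_sign by (intro sum.cong refl) (force simp: square_sign_def)
  then show ?thesis
    by (simp add: sum_sgn_eq_card finK eq)
qed

end

section \<open>Gradings with the same quadratic form\<close>

text \<open>A symmetric sign cocycle \<open>\<tau>\<close> with trivial diagonal defines an extension of \<open>K\<close> of exponent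
  two, which splits. The splitting \<open>f\<close> is extended from a subgroup \<open>H\<close> to \<open>H \<union> a H\<close> by
  \<open>f (a h) = f h * \<tau> a h\<close>.\<close>

lemma (in comm_group) symmetric_cocycle_splits:
  fixes \<tau> :: "'a \<Rightarrow> 'a \<Rightarrow> real"
  assumes fin: "finite (carrier G)" and sq: "\<And>t. t \<in> carrier G \<Longrightarrow> t \<otimes> t = \<one>"
    and sign: "\<And>s t. s \<in> carrier G \<Longrightarrow> t \<in> carrier G \<Longrightarrow> \<tau> s t = 1 \<or> \<tau> s t = -1"
    and sym: "\<And>s t. s \<in> carrier G \<Longrightarrow> t \<in> carrier G \<Longrightarrow> \<tau> s t = \<tau> t s"
    and diag: "\<And>t. t \<in> carrier G \<Longrightarrow> \<tau> t t = 1"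
    and one: "\<And>t. t \<in> carrier G \<Longrightarrow> \<tau> \<one> t = 1"
    and cocycle: "\<And>r s t. r \<in> carrier G \<Longrightarrow> s \<in> carrier G \<Longrightarrow> t \<in> carrier G \<Longrightarrow>
      \<tau> r s * \<tau> (r \<otimes> s) t = \<tau> s t * \<tau> r (s \<otimes> t)"
  shows "\<exists>f. (\<forall>t\<in>carrier G. f t = 1 \<or> f t = -1) \<and>
    (\<forall>s\<in>carrier G. \<forall>t\<in>carrier G. f (s \<otimes> t) = \<tau> s t * f s * f t)"
proof -
  \<comment> \<open>A subgroup with a splitting on it; inverses are automatic in exponent two.
    Below, a good \<open>H\<close> of largest cardinality is shown to be everything.\<close>
  define good where "good H f \<longleftrightarrow> H \<subseteq> carrier G \<and> \<one> \<in> H \<and> (\<forall>s\<in>H. \<forall>t\<in>H. s \<otimes> t \<in> H) \<and>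
    (\<forall>t\<in>H. f t = 1 \<or> f t = -1) \<and> (\<forall>s\<in>H. \<forall>t\<in>H. f (s \<otimes> t) = \<tau> s t * f s * f t)" for H and f :: "'a \<Rightarrow> real"
  define P where "P n \<longleftrightarrow> (\<exists>H f. good H f \<and> card H = n)" for n
  have cancel: "s \<otimes> (s \<otimes> t) = t" if "s \<in> carrier G" "t \<in> carrier G" for s t
    using that by (simp add: m_assoc[symmetric] sq)
  have "good {\<one>} (\<lambda>_. 1)" by (simp add: good_def one)
  then have "P 1" unfolding P_def by (intro exI[of _ "{\<one>}"] exI[of _ "\<lambda>_. 1"]) auto
  moreover have bd: "n \<le> card (carrier G)" if "P n" for n
    using that card_mono[OF fin] by (auto simp: P_def good_def)
  ultimately have "P (GREATEST n. P n)" by (rule GreatestI_nat)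
  then obtain H f where H: "good H f" "card H = (GREATEST n. P n)" unfolding P_def by blast
  have finH: "finite H" using H(1) fin finite_subset unfolding good_def by blast
  have HG: "h \<in> carrier G" if "h \<in> H" for h using H(1) that by (auto simp: good_def)
  have Hm: "s \<otimes> t \<in> H" if "s \<in> H" "t \<in> H" for s t using H(1) that by (auto simp: good_def)
  have fs: "f h = 1 \<or> f h = -1" if "h \<in> H" for h using H(1) that by (auto simp: good_def)
  have fm: "f (s \<otimes> t) = \<tau> s t * f s * f t" if "s \<in> H" "t \<in> H" for s t
    using H(1) that by (auto simp: good_def)
  have "carrier G \<subseteq> H"
  proof (rule ccontr)
    assume "\<not> carrier G \<subseteq> H"
    then obtain a where a: "a \<in> carrier G" "a \<notin> H" by blast
    define H' where "H' = H \<union> (\<lambda>h. a \<otimes> h) ` H"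
    \<comment> \<open>For \<open>x = a h\<close> the element \<open>h\<close> is recovered as
      \<open>a x\<close>, since \<open>a^2 = 1\<close>.\<close>
    define f' where "f' x = (if x \<in> H then f x else f (a \<otimes> x) * \<tau> a (a \<otimes> x))" for x
    have aH: "a \<otimes> h \<notin> H" if h: "h \<in> H" for h
    proof
      assume "a \<otimes> h \<in> H"
      from Hm[OF this h] show False using a HG[OF h] by (simp add: m_assoc sq)
    qed
    have f'1: "f' h = f h" if "h \<in> H" for h using that by (simp add: f'_def)
    have f'2: "f' (a \<otimes> h) = f h * \<tau> a h" if "h \<in> H" for h
      using aH[OF that] cancel a HG[OF that] by (simp add: f'_def)
    have sg: "\<tau> s t * \<tau> s t = 1" if "s \<in> carrier G" "t \<in> carrier G" for s t
      using sign[OF that] by auto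
    have m1: "f' (a \<otimes> h \<otimes> h') = \<tau> (a \<otimes> h) h' * f' (a \<otimes> h) * f' h'" if h: "h \<in> H" "h' \<in> H" for h h'
    proof -
      have "f' (a \<otimes> h \<otimes> h') = \<tau> h h' * f h * f h' * \<tau> a (h \<otimes> h')"
        using f'2[OF Hm[OF h]] fm[OF h] a HG h by (simp add: m_assoc)
      also have "\<dots> = (\<tau> h h' * \<tau> a (h \<otimes> h')) * f h * f h'" by simp
      also have "\<dots> = (\<tau> a h * \<tau> (a \<otimes> h) h') * f h * f h'"
        using cocycle[of a h h'] a HG h by simp
      finally show ?thesis using f'1 f'2 h by simp
    qed
    have m2: "f' ((a \<otimes> h) \<otimes> (a \<otimes> h')) = \<tau> (a \<otimes> h) (a \<otimes> h') * f' (a \<otimes> h) * f' (a \<otimes> h')"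
      if h: "h \<in> H" "h' \<in> H" for h h'
    proof -
      note G = a(1) HG[OF h(1)] HG[OF h(2)]
      have ahah: "h \<otimes> (a \<otimes> h') = a \<otimes> (h \<otimes> h')" "h' \<otimes> h = h \<otimes> h'"
        using G by (simp_all add: m_lcomm m_comm)
      have e: "a \<otimes> h \<otimes> (a \<otimes> h') = h \<otimes> h'"
        using G cancel[of a "h \<otimes> h'"] by (simp add: m_assoc ahah)
      have c1: "\<tau> a h * \<tau> (a \<otimes> h) (a \<otimes> h') = \<tau> h (a \<otimes> h') * \<tau> a (a \<otimes> (h \<otimes> h'))"
        using cocycle[of a h "a \<otimes> h'"] G by (simp add: ahah)
      \<comment> \<open>Here the trivial diagonal enters, through the cocycle identity at (a, a, h
        h') with \<open>\<tau> a a = 1\<close>.\<close>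
      have c2: "\<tau> a (a \<otimes> (h \<otimes> h')) = \<tau> a (h \<otimes> h')"
      proof -
        have "1 = \<tau> a (h \<otimes> h') * \<tau> a (a \<otimes> (h \<otimes> h'))"
          using cocycle[of a a "h \<otimes> h'"] G by (simp add: diag sq one)
        then show ?thesis
          using sign[of a "h \<otimes> h'"] G by auto
      qed
      have c3: "\<tau> a h' * \<tau> (a \<otimes> h') h = \<tau> h' h * \<tau> a (h \<otimes> h')"
        using cocycle[of a h' h] G by (simp add: ahah)
      have s1: "\<tau> (a \<otimes> h') h = \<tau> h (a \<otimes> h')" "\<tau> h' h = \<tau> h h'" using sym G by auto
      \<comment> \<open>All values are signs, so \<open>c1\<close>, \<open>c2\<close> and
        \<open>c3\<close> can be multiplied and solved; the symmetry in \<open>s1\<close> matches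
        the factor common to \<open>c1\<close> and \<open>c3\<close>, which cancels together with
        \<open>\<tau> a (h h')\<close>.\<close>
      have "\<tau> (a \<otimes> h) (a \<otimes> h') * \<tau> a h * \<tau> a h' = \<tau> h h'"
        using c1 c2 c3 s1 sign[of a "h \<otimes> h'"] sign[of a h'] sign[of a h] sign[of h h'] sign[of h "a \<otimes> h'"]
          sign[of "a \<otimes> h" "a \<otimes> h'"] G by auto
      then show ?thesis
        using fm[OF h] f'1[OF Hm[OF h]] f'2 h by (simp add: e)
    qed
    have "good H' f'"
      unfolding good_def
    proof (intro conjI ballI)
      show "H' \<subseteq> carrier G" using HG a by (auto simp: H'_def)
      show "\<one> \<in> H'" using H(1) by (auto simp: H'_def good_def)
    next
      fix s t assume "s \<in> H'" "t \<in> H'"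
      then consider "s \<in> H" "t \<in> H" | h where "s = a \<otimes> h" "h \<in> H" "t \<in> H"
        | h where "t = a \<otimes> h" "h \<in> H" "s \<in> H" | h h' where "s = a \<otimes> h" "t = a \<otimes> h'" "h \<in> H" "h' \<in> H"
        by (auto simp: H'_def)
      then have "s \<otimes> t \<in> H' \<and> f' (s \<otimes> t) = \<tau> s t * f' s * f' t"
      proof cases
        case 1
        then show ?thesis using Hm fm f'1 by (simp add: H'_def)
      next
        case 2
        then show ?thesis using m1[of h t] Hm[of h t] a HG by (auto simp: H'_def m_assoc)
      next
        case 3
        have "s \<otimes> t = a \<otimes> h \<otimes> s" using 3 a HG m_comm[of s t] by auto
        moreover have "\<tau> s t = \<tau> t s" using sym 3 a HG by auto
        ultimately show ?thesis using m1[of h s] Hm[of h s] a HG 3 by (auto simp: H'_def m_assoc)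
      next
        case 4
        have "s \<otimes> t = h \<otimes> h'"
        proof -
          have "s \<otimes> t = a \<otimes> (a \<otimes> (h \<otimes> h'))" using 4 a HG by (simp add: m_ac)
          then show ?thesis using cancel a HG 4 by simp
        qed
        then have "s \<otimes> t \<in> H'" using Hm 4 by (simp add: H'_def)
        then show ?thesis using m2[of h h'] 4 by auto
      qed
      then show "s \<otimes> t \<in> H'" "f' (s \<otimes> t) = \<tau> s t * f' s * f' t" by auto
    next
      fix t assume "t \<in> H'"
      then consider "t \<in> H" | h where "t = a \<otimes> h" "h \<in> H" by (auto simp: H'_def)
      then show "f' t = 1 \<or> f' t = -1"
      proof cases
        case 1
        then show ?thesis using f'1 fs by simp
      next
        case 2
        then show ?thesis using f'2 fs[of h] sign[OF a(1) HG[of h]] by auto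
      qed
    qed
    then have "P (card H')" unfolding P_def by blast
    then have "card H' \<le> card H" using Greatest_le_nat[of P "card H'"] bd H(2) by metis
    moreover have "H \<subset> H'"
    proof -
      have "a \<otimes> \<one> \<in> H'" using H(1) by (auto simp: H'_def good_def)
      then show ?thesis using a by (auto simp: H'_def)
    qed
    then have "card H < card H'" by (intro psubset_card_mono) (auto simp: H'_def finH)
    ultimately show False by simp
  qed
  then have "H = carrier G" using H(1) by (auto simp: good_def)
  then show ?thesis using fs fm by blast
qed

lemma graded_algebra_iso:
  assumes "sign_graded_algebra D G T \<sigma> \<kappa>" "sign_graded_algebra D' G' T' \<sigma>' \<kappa>'"
    and \<alpha>: "\<alpha> \<in> iso (G\<lparr>carrier := T\<rparr>) (G'\<lparr>carrier := T'\<rparr>)"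
    and \<sigma>: "\<And>t. t \<in> T \<Longrightarrow> \<sigma>' (\<alpha> t) (\<alpha> t) = \<sigma> t t"
  obtains \<phi> where "\<phi> \<in> alg_iso D D'"
    "\<And>t. t \<in> T \<Longrightarrow> \<phi> ` grading_of G D T \<kappa> t = grading_of G' D' T' \<kappa>' (\<alpha> t)"
proof -
  interpret A: sign_graded_algebra D G T \<sigma> \<kappa> by (rule assms)
  interpret B: sign_graded_algebra D' G' T' \<sigma>' \<kappa>' by (rule assms)
  have bij: "bij_betw \<alpha> T T'" and hom: "\<And>s t. s \<in> T \<Longrightarrow> t \<in> T \<Longrightarrow> \<alpha> (s \<otimes>\<^bsub>G\<^esub> t) = \<alpha> s \<otimes>\<^bsub>G'\<^esub> \<alpha> t"
    using \<alpha> by (auto simp: iso_def hom_def)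
  have \<alpha>T: "\<alpha> t \<in> T'" if "t \<in> T" for t using bij that bij_betwE by blast
  have \<alpha>inj: "s = t" if "\<alpha> s = \<alpha> t" "s \<in> T" "t \<in> T" for s t
    using bij that by (auto simp: bij_betw_def inj_on_def)
  have \<alpha>1: "\<alpha> \<one>\<^bsub>G\<^esub> = \<one>\<^bsub>G'\<^esub>"
    using hom[of "\<one>\<^bsub>G\<^esub>" "\<one>\<^bsub>G\<^esub>"] \<alpha>T[of "\<one>\<^bsub>G\<^esub>"] B.T_square[of "\<alpha> \<one>\<^bsub>G\<^esub>"] by simp
  let ?K = "G\<lparr>carrier := T\<rparr>"
  interpret K: comm_group ?K
    using A.quadratic_form_square_sign by (simp add: quadratic_form_def elementary_abelian_2_group_def)
  \<comment> \<open>For signs the product is the quotient of the two cocycles.\<close>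
  define \<tau> where "\<tau> s t = \<sigma> s t * \<sigma>' (\<alpha> s) (\<alpha> t)" for s t
  have "\<exists>f. (\<forall>t\<in>carrier ?K. f t = 1 \<or> f t = -1) \<and>
    (\<forall>s\<in>carrier ?K. \<forall>t\<in>carrier ?K. f (s \<otimes>\<^bsub>?K\<^esub> t) = \<tau> s t * f s * f t)"
  proof (rule K.symmetric_cocycle_splits)
    fix s t assume st: "s \<in> carrier ?K" "t \<in> carrier ?K"
    then have T: "s \<in> T" "t \<in> T" "\<alpha> s \<in> T'" "\<alpha> t \<in> T'" by (simp_all add: \<alpha>T)
    note signs = A.sigma_sign[OF T(1,2)] A.sigma_sign[OF T(2,1)] B.sigma_sign[OF T(3,4)] B.sigma_sign[OF T(4,3)]
    show "\<tau> s t = 1 \<or> \<tau> s t = -1"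
      unfolding \<tau>_def using signs(1,3) by (elim disjE) simp_all
    \<comment> \<open>By \<open>sigma_swap\<close> the commutation factor depends on the diagonal
      alone, and the diagonals agree under \<open>\<alpha>\<close>; this makes \<open>\<tau>\<close>
      symmetric.\<close>
    have "\<sigma> s t * \<sigma> t s = \<sigma>' (\<alpha> s) (\<alpha> t) * \<sigma>' (\<alpha> t) (\<alpha> s)"
      using A.sigma_swap[OF T(1,2)] B.sigma_swap[OF T(3,4)] \<sigma>[OF T(1)] \<sigma>[OF T(2)]
        \<sigma>[OF A.T_closed(3)[OF T(1,2)]] by (simp add: hom[OF T(1,2)])
    then show "\<tau> s t = \<tau> t s"
      unfolding \<tau>_def using signs by (elim disjE) simp_all
  next
    fix r s t assume rst: "r \<in> carrier ?K" "s \<in> carrier ?K" "t \<in> carrier ?K"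
    then show "\<tau> r s * \<tau> (r \<otimes>\<^bsub>?K\<^esub> s) t = \<tau> s t * \<tau> r (s \<otimes>\<^bsub>?K\<^esub> t)"
      using A.sigma_cocycle[of r s t] B.sigma_cocycle[of "\<alpha> r" "\<alpha> s" "\<alpha> t"] \<alpha>T
      by (simp add: \<tau>_def hom algebra_simps)
  next
    fix t assume "t \<in> carrier ?K"
    then show "\<tau> \<one>\<^bsub>?K\<^esub> t = 1" using \<alpha>T by (simp add: \<tau>_def A.sigma_one B.sigma_one \<alpha>1)
  qed (use \<sigma> A.T_square in \<open>auto simp: \<tau>_def\<close>)
  then obtain f where f: "\<And>t. t \<in> T \<Longrightarrow> f t = 1 \<or> f t = -1"
    "\<And>s t. s \<in> T \<Longrightarrow> t \<in> T \<Longrightarrow> f (s \<otimes>\<^bsub>G\<^esub> t) = \<tau> s t * f s * f t" by auto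
  have f0: "f t \<noteq> 0" if "t \<in> T" for t using f(1)[OF that] by auto
  have f1: "f \<one>\<^bsub>G\<^esub> = 1"
    using f(2)[of "\<one>\<^bsub>G\<^esub>" "\<one>\<^bsub>G\<^esub>"] f(1)[of "\<one>\<^bsub>G\<^esub>"] by (auto simp: \<tau>_def A.sigma_one B.sigma_one \<alpha>1)
  \<comment> \<open>Rescaling the basis of \<open>D'\<close> by the splitting \<open>f\<close> turns
    its cocycle into that of \<open>D\<close>, after which the structure constants coincide.\<close>
  have co: "alg_coords D' T (graded_struct G \<sigma>) (graded_unit G) (\<lambda>x. \<lambda>t\<in>T. \<kappa>' x (\<alpha> t) / f t)"
  proof (rule alg_coords_rescale[OF B.alg_coords bij f0])
    fix s t u assume stu: "s \<in> T" "t \<in> T" "u \<in> T"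
    show "f u * graded_struct G \<sigma> s t u = f s * f t * graded_struct G' \<sigma>' (\<alpha> s) (\<alpha> t) (\<alpha> u)"
    proof (cases "s \<otimes>\<^bsub>G\<^esub> t = u")
      case True
      have "f u * \<sigma> s t = f s * f t * \<sigma>' (\<alpha> s) (\<alpha> t)"
        using f(2)[OF stu(1,2)] A.sigma_sign[OF stu(1,2)] True by (auto simp: \<tau>_def)
      moreover have "\<alpha> s \<otimes>\<^bsub>G'\<^esub> \<alpha> t = \<alpha> u" using hom[OF stu(1,2)] True by simp
      ultimately show ?thesis using True by (simp add: graded_struct_def)
    next
      case False
      then have "\<alpha> s \<otimes>\<^bsub>G'\<^esub> \<alpha> t \<noteq> \<alpha> u"
        using hom[OF stu(1,2)] \<alpha>inj[of "s \<otimes>\<^bsub>G\<^esub> t" u] stu by auto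
      then show ?thesis using False by (simp add: graded_struct_def)
    qed
  next
    fix t assume t: "t \<in> T"
    have "\<alpha> t = \<one>\<^bsub>G'\<^esub> \<longleftrightarrow> t = \<one>\<^bsub>G\<^esub>"
      using \<alpha>inj[OF _ t A.T_closed(2)] \<alpha>1 by metis
    then show "f t * graded_unit G t = graded_unit G' (\<alpha> t)"
      using f1 by (simp add: graded_unit_def)
  qed
  obtain \<phi> where \<phi>: "\<phi> \<in> alg_iso D D'"
    "\<And>x. x \<in> carrier D \<Longrightarrow> (\<lambda>t\<in>T. \<kappa>' (\<phi> x) (\<alpha> t) / f t) = \<kappa> x"
    by (rule alg_iso_of_coords[OF A.alg_coords co]) (rule that)
  \<comment> \<open>Components are described by vanishing coordinates, which the factors
    \<open>f t\<close> do not affect.\<close>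
  have zero: "\<kappa> x t = 0 \<longleftrightarrow> \<kappa>' (\<phi> x) (\<alpha> t) = 0" if "x \<in> carrier D" "t \<in> T" for x t
  proof -
    have "\<kappa> x t = \<kappa>' (\<phi> x) (\<alpha> t) / f t"
      unfolding \<phi>(2)[OF that(1), symmetric] using that(2) by simp
    then show ?thesis using f0[OF that(2)] by simp
  qed
  have "\<phi> ` grading_of G D T \<kappa> t = grading_of G' D' T' \<kappa>' (\<alpha> t)" if t: "t \<in> T" for t
  proof -
    have mem: "x \<in> grading_of G D T \<kappa> t \<longleftrightarrow> \<phi> x \<in> grading_of G' D' T' \<kappa>' (\<alpha> t)"
      if x: "x \<in> carrier D" for x
    proof -
      have "(\<forall>s\<in>T. s \<noteq> t \<longrightarrow> \<kappa> x s = 0) \<longleftrightarrow> (\<forall>s\<in>T. \<alpha> s \<noteq> \<alpha> t \<longrightarrow> \<kappa>' (\<phi> x) (\<alpha> s) = 0)"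
      proof (intro ball_cong refl)
        fix s assume s: "s \<in> T"
        have "s = t \<longleftrightarrow> \<alpha> s = \<alpha> t" using \<alpha>inj[OF _ s t] by metis
        then show "(s \<noteq> t \<longrightarrow> \<kappa> x s = 0) \<longleftrightarrow> (\<alpha> s \<noteq> \<alpha> t \<longrightarrow> \<kappa>' (\<phi> x) (\<alpha> s) = 0)"
          using zero[OF x s] by simp
      qed
      also have "\<dots> \<longleftrightarrow> (\<forall>s\<in>T'. s \<noteq> \<alpha> t \<longrightarrow> \<kappa>' (\<phi> x) s = 0)"
        using bij by (auto simp: bij_betw_def)
      finally show ?thesis
        using t x \<alpha>T[OF t] alg_isoD(2)[OF \<phi>(1) x] by (simp add: grading_of_def)
    qed
    show ?thesis
    proof (intro equalityI subsetI)
      fix y assume y: "y \<in> grading_of G' D' T' \<kappa>' (\<alpha> t)"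
      then have "y \<in> carrier D'" using \<alpha>T[OF t] by (simp add: grading_of_def)
      then obtain x where "x \<in> carrier D" "y = \<phi> x"
        using alg_isoD(1)[OF \<phi>(1)] by (auto simp: bij_betw_def)
      then show "y \<in> \<phi> ` grading_of G D T \<kappa> t" using mem y by auto
    next
      fix y assume "y \<in> \<phi> ` grading_of G D T \<kappa> t"
      then obtain x where x: "x \<in> grading_of G D T \<kappa> t" "y = \<phi> x" by auto
      then have "x \<in> carrier D" using t by (simp add: grading_of_def)
      then show "y \<in> grading_of G' D' T' \<kappa>' (\<alpha> t)" using mem x by simp
    qed
  qed
  with \<phi>(1) show ?thesis using that by blast
qed

section \<open>The model gradings\<close>

lemma alg_coords_cong:
  assumes "alg_coords D I \<gamma> \<eta> \<kappa>"
    and "\<And>s t u. s \<in> I \<Longrightarrow> t \<in> I \<Longrightarrow> u \<in> I \<Longrightarrow> \<gamma> s t u = \<gamma>' s t u"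
    and "\<And>t. t \<in> I \<Longrightarrow> \<eta> t = \<eta>' t"
  shows "alg_coords D I \<gamma>' \<eta>' \<kappa>"
proof -
  have "(\<Sum>s\<in>I. \<Sum>t\<in>I. \<gamma>' s t u * a s * b t) = (\<Sum>s\<in>I. \<Sum>t\<in>I. \<gamma> s t u * a s * b t)" if "u \<in> I" for u a b
    using assms(2)[OF _ _ that] by (intro sum.cong refl) simp
  then show ?thesis using assms(1,3) by (simp add: alg_coords_def)
qed

text \<open>Products of homogeneous coordinates are homogeneous for the product group, with the
  product of the cocycles. The components agree by \<open>tensor_span_component\<close>: on a tuple
  of homogeneous elements of degrees \<open>g i\<close>, only the product of coordinates at
  \<open>g\<close> can be nonzero.\<close>

lemma graded_coords_tensor_power:
  fixes m :: nat
  assumes G: "group G" and A: "real_alg A" and gc: "graded_coords G A (carrier G) \<sigma> \<kappa>"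
  defines "GP \<equiv> product_group {..<m} (\<lambda>_. G)"
  defines "\<kappa>P \<equiv> \<lambda>s. \<lambda>b\<in>carrier GP. s (\<lambda>x. \<Prod>i<m. \<kappa> (x i) (b i))"
  shows "graded_coords GP (tensor_power m A) (carrier GP) (\<lambda>a b. \<Prod>i<m. \<sigma> (a i) (b i)) \<kappa>P"
    and "tensor_power_grading m G A (grading_of G A (carrier G) \<kappa>) =
      grading_of GP (tensor_power m A) (carrier GP) \<kappa>P"
proof -
  interpret A: graded_algebra A G "carrier G" \<sigma> \<kappa>
    using G A gc by (simp add: graded_algebra_def real_algebra_def graded_algebra_axioms_def)
  have GP: "group GP" unfolding GP_def by (rule product_group) (rule G)
  have cGP: "carrier GP = {..<m} \<rightarrow>\<^sub>E carrier G" by (simp add: GP_def)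
  have "alg_coords (tensor_power m A) (carrier GP)
    (\<lambda>a b c. \<Prod>i<m. graded_struct G \<sigma> (a i) (b i) (c i)) (\<lambda>b. \<Prod>i<m. graded_unit G (b i)) \<kappa>P"
    using alg_coords_tensor_power[OF A.alg_coords, of m] unfolding \<kappa>P_def cGP .
  then have "alg_coords (tensor_power m A) (carrier GP)
    (graded_struct GP (\<lambda>a b. \<Prod>i<m. \<sigma> (a i) (b i))) (graded_unit GP) \<kappa>P"
  proof (rule alg_coords_cong)
    fix a b c assume abc: "a \<in> carrier GP" "b \<in> carrier GP" "c \<in> carrier GP"
    show "(\<Prod>i<m. graded_struct G \<sigma> (a i) (b i) (c i)) = graded_struct GP (\<lambda>a b. \<Prod>i<m. \<sigma> (a i) (b i)) a b c"
    proof (cases "a \<otimes>\<^bsub>GP\<^esub> b = c")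
      case True
      then have "a i \<otimes>\<^bsub>G\<^esub> b i = c i" if "i < m" for i
        using that by (auto simp: GP_def)
      then show ?thesis using True by (simp add: graded_struct_def)
    next
      case False
      have "a \<otimes>\<^bsub>GP\<^esub> b \<in> carrier GP" using GP abc by (simp add: group.is_monoid monoid.m_closed)
      then obtain i where "i < m" "a i \<otimes>\<^bsub>G\<^esub> b i \<noteq> c i"
        using False abc(3) PiE_ext[of "a \<otimes>\<^bsub>GP\<^esub> b" "{..<m}" "\<lambda>_. carrier G" c] unfolding cGP
        by (auto simp: GP_def)
      then have "(\<Prod>i<m. graded_struct G \<sigma> (a i) (b i) (c i)) = 0"
        by - (rule prod_zero[OF finite_lessThan], auto simp: graded_struct_def)
      then show ?thesis using False by (simp add: graded_struct_def)
    qed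
  next
    fix b assume b: "b \<in> carrier GP"
    show "(\<Prod>i<m. graded_unit G (b i)) = graded_unit GP b"
    proof (cases "b = \<one>\<^bsub>GP\<^esub>")
      case True
      then have "b i = \<one>\<^bsub>G\<^esub>" if "i < m" for i using that by (simp add: GP_def)
      then show ?thesis using True by (simp add: graded_unit_def)
    next
      case False
      then obtain i where "i < m" "b i \<noteq> \<one>\<^bsub>G\<^esub>"
        using b PiE_ext[of b "{..<m}" "\<lambda>_. carrier G" "\<one>\<^bsub>GP\<^esub>"] A.T_closed(2) unfolding cGP
        by (auto simp: GP_def)
      then have "(\<Prod>i<m. graded_unit G (b i)) = 0"
        by - (rule prod_zero[OF finite_lessThan], auto simp: graded_unit_def)
      then show ?thesis using False by (simp add: graded_unit_def)
    qed
  qed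
  moreover have "(\<Prod>i<m. \<sigma> (a i) (b i)) \<noteq> 0" if "a \<in> carrier GP" "b \<in> carrier GP" for a b
    using that A.sigma_nonzero unfolding cGP by (auto simp: PiE_iff)
  ultimately show "graded_coords GP (tensor_power m A) (carrier GP) (\<lambda>a b. \<Prod>i<m. \<sigma> (a i) (b i)) \<kappa>P"
    unfolding graded_coords_def using group.subgroup_self[OF GP] by blast
  let ?\<Gamma> = "grading_of G A (carrier G) \<kappa>" and ?g = "\<lambda>b x. \<Prod>i<m. \<kappa> (x i) (b i)"
  interpret T: tensor_basis "multilinear_forms m A" "{..<m} \<rightarrow>\<^sub>E carrier A" "{..<m} \<rightarrow>\<^sub>E carrier G"
    "\<lambda>b. \<lambda>i\<in>{..<m}. A.basis_vec (b i)" ?g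
    by (rule tensor_basis_power[OF A.alg_coords])
  have "tensor_span (multilinear_forms m A) (\<Pi>\<^sub>E i\<in>{..<m}. ?\<Gamma> (g i)) =
      {x \<in> carrier (tensor_power m A). \<forall>s\<in>carrier GP. s \<noteq> g \<longrightarrow> \<kappa>P x s = 0}"
    if g: "g \<in> carrier GP" for g
  proof -
    have gG: "g i \<in> carrier G" if "i < m" for i using g that by (auto simp: cGP)
    have "tensor_span (multilinear_forms m A) (\<Pi>\<^sub>E i\<in>{..<m}. ?\<Gamma> (g i)) =
      {s \<in> tensor_span (multilinear_forms m A) ({..<m} \<rightarrow>\<^sub>E carrier A).
        \<forall>b'\<in>{..<m} \<rightarrow>\<^sub>E carrier G. b' \<noteq> g \<longrightarrow> s (?g b') = 0}"
    proof (rule T.tensor_span_component)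
      show "g \<in> {..<m} \<rightarrow>\<^sub>E carrier G" using g by (simp add: cGP)
      show "(\<Pi>\<^sub>E i\<in>{..<m}. ?\<Gamma> (g i)) \<subseteq> {..<m} \<rightarrow>\<^sub>E carrier A"
        by (rule PiE_mono) (use gG in \<open>auto simp: grading_of_def\<close>)
      show "(\<lambda>i\<in>{..<m}. A.basis_vec (g i)) \<in> (\<Pi>\<^sub>E i\<in>{..<m}. ?\<Gamma> (g i))"
        by (simp add: restrict_PiE_iff grading_of_def gG)
      fix y b' assume y: "y \<in> (\<Pi>\<^sub>E i\<in>{..<m}. ?\<Gamma> (g i))" and b': "b' \<in> {..<m} \<rightarrow>\<^sub>E carrier G" "b' \<noteq> g"
      then have "\<not> (\<forall>i\<in>{..<m}. b' i = g i)"
        using PiE_ext[OF b'(1) g[unfolded cGP]] b'(2) by blast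
      then obtain i where i: "i < m" "b' i \<noteq> g i" by auto
      then have "\<kappa> (y i) (b' i) = 0"
        using PiE_mem[OF y, of i] PiE_mem[OF b'(1), of i] gG[of i] by (simp add: grading_of_def)
      then show "?g b' y = 0" using i by - (rule prod_zero[OF finite_lessThan], auto)
    qed
    then show ?thesis by (simp add: tensor_power_def tensor_alg_def \<kappa>P_def cGP)
  qed
  then show "tensor_power_grading m G A ?\<Gamma> = grading_of GP (tensor_power m A) (carrier GP) \<kappa>P"
    unfolding tensor_power_grading_def grading_of_def[of GP] GP_def[symmetric] by (intro restrict_ext) blast
qed

lemma graded_coords_tensor:
  assumes G: "group G" and A: "real_alg A" and gA: "graded_coords G A (carrier G) \<sigma> \<kappa>"
    and H: "group H" and B: "real_alg B" and gB: "graded_coords H B (carrier H) \<sigma>' \<kappa>'"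
  defines "\<kappa>T \<equiv> \<lambda>s. \<lambda>(i, j)\<in>carrier G \<times> carrier H. s (\<lambda>(x, y). \<kappa> x i * \<kappa>' y j)"
  shows "graded_coords (G \<times>\<times> H) (tensor A B) (carrier (G \<times>\<times> H))
      (\<lambda>a b. \<sigma> (fst a) (fst b) * \<sigma>' (snd a) (snd b)) \<kappa>T"
    and "tensor_grading G A (grading_of G A (carrier G) \<kappa>) H B (grading_of H B (carrier H) \<kappa>') =
      grading_of (G \<times>\<times> H) (tensor A B) (carrier (G \<times>\<times> H)) \<kappa>T"
proof -
  interpret A: graded_algebra A G "carrier G" \<sigma> \<kappa>
    using G A gA by (simp add: graded_algebra_def real_algebra_def graded_algebra_axioms_def)
  interpret B: graded_algebra B H "carrier H" \<sigma>' \<kappa>'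
    using H B gB by (simp add: graded_algebra_def real_algebra_def graded_algebra_axioms_def)
  have "alg_coords (tensor A B) (carrier (G \<times>\<times> H))
      (graded_struct (G \<times>\<times> H) (\<lambda>a b. \<sigma> (fst a) (fst b) * \<sigma>' (snd a) (snd b))) (graded_unit (G \<times>\<times> H)) \<kappa>T"
    unfolding \<kappa>T_def carrier_DirProd
    by (rule alg_coords_cong[OF alg_coords_tensor[OF A.alg_coords B.alg_coords]])
      (auto simp: graded_struct_def graded_unit_def DirProd_def)
  then show "graded_coords (G \<times>\<times> H) (tensor A B) (carrier (G \<times>\<times> H))
      (\<lambda>a b. \<sigma> (fst a) (fst b) * \<sigma>' (snd a) (snd b)) \<kappa>T"
    using A.sigma_nonzero B.sigma_nonzero group.subgroup_self[OF DirProd_group[OF G H]]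
    by (auto simp: graded_coords_def)
  let ?\<Gamma> = "grading_of G A (carrier G) \<kappa>" and ?\<Delta> = "grading_of H B (carrier H) \<kappa>'"
    and ?g = "\<lambda>(i, j) (x, y). \<kappa> x i * \<kappa>' y j"
  interpret T: tensor_basis "bilinear_forms A B" "carrier A \<times> carrier B" "carrier G \<times> carrier H"
    "\<lambda>(i, j). (A.basis_vec i, B.basis_vec j)" ?g
    by (rule tensor_basis_tensor[OF A.alg_coords B.alg_coords])
  have "tensor_span (bilinear_forms A B) (?\<Gamma> (fst z) \<times> ?\<Delta> (snd z)) =
      {x \<in> carrier (tensor A B). \<forall>s\<in>carrier (G \<times>\<times> H). s \<noteq> z \<longrightarrow> \<kappa>T x s = 0}"
    if z: "z \<in> carrier (G \<times>\<times> H)" for z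
  proof -
    have zGH: "fst z \<in> carrier G" "snd z \<in> carrier H" using z by auto
    have "tensor_span (bilinear_forms A B) (?\<Gamma> (fst z) \<times> ?\<Delta> (snd z)) =
      {s \<in> tensor_span (bilinear_forms A B) (carrier A \<times> carrier B).
        \<forall>b'\<in>carrier G \<times> carrier H. b' \<noteq> z \<longrightarrow> s (?g b') = 0}"
      by (rule T.tensor_span_component)
        (use z zGH in \<open>auto simp: grading_of_def case_prod_beta prod_eq_iff\<close>)
    then show ?thesis
      by (simp add: tensor_def tensor_alg_def \<kappa>T_def case_prod_beta carrier_DirProd del: mem_Times_iff cong: conj_cong)
  qed
  then show "tensor_grading G A ?\<Gamma> H B ?\<Delta> = grading_of (G \<times>\<times> H) (tensor A B) (carrier (G \<times>\<times> H)) \<kappa>T"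
    unfolding tensor_grading_def grading_of_def[of "G \<times>\<times> H"] by (intro restrict_ext) blast
qed

section \<open>The concrete model gradings\<close>

lemma comm_group_Z2_squared: "comm_group Z2_squared"
proof -
  have "group Z2_squared" by (simp add: Z2_squared_def DirProd_group)
  then show ?thesis
    by (rule group.group_comm_groupI) (simp add: mult_Z2_squared add.commute)
qed

lemma group_Z2_squared: "group Z2_squared"
  using comm_group_Z2_squared by (simp add: comm_group_def)

lemma graded_coords_M2R: "graded_coords Z2_squared M2R (carrier Z2_squared) mat2_sigma mat2_coords"
  using alg_coords_M2R group.subgroup_self[OF group_Z2_squared] by (simp add: graded_coords_def mat2_sigma_def)

lemma graded_coords_HH: "graded_coords Z2_squared HH (carrier Z2_squared) quat_sigma quat_coords"
  using alg_coords_HH group.subgroup_self[OF group_Z2_squared] by (simp add: graded_coords_def quat_sigma_def)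

text \<open>The four matrices are the basis dual to \<open>mat2_coords\<close>, so the lines they
  span are the coordinate lines.\<close>

lemma M2R_grading_eq: "M2R_grading = grading_of Z2_squared M2R (carrier Z2_squared) mat2_coords"
proof -
  interpret graded_algebra M2R Z2_squared "carrier Z2_squared" mat2_sigma mat2_coords
    using group_Z2_squared real_alg_mat_alg graded_coords_M2R
    by (simp add: graded_algebra_def real_algebra_def graded_algebra_axioms_def)
  have "M2R_grading g = grading_of Z2_squared M2R (carrier Z2_squared) mat2_coords g"
    if g: "g \<in> carrier Z2_squared" for g
  proof -
    have "(if g = (0, 0) then mat_of_rows_list 2 [[1, 0], [0, 1]]
      else if g = (1, 0) then mat_of_rows_list 2 [[0, 1], [1, 0]]
      else if g = (0, 1) then mat_of_rows_list 2 [[-1, 0], [0, 1]]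
      else mat_of_rows_list 2 [[0, -1], [1, 0]]) = basis_vec g" (is "?m = _")
    proof (rule coords_eqI)
      have "mat_of_rows_list 2 [[a, b], [c, d]] \<in> carrier M2R" for a b c d :: real
        unfolding mat_alg_def by (simp add: mat_of_rows_list_def numeral_2_eq_2)
      then show "?m \<in> carrier M2R" by presburger
      fix i assume i: "i \<in> carrier Z2_squared"
      then show "mat2_coords ?m i = mat2_coords (basis_vec g) i"
        unfolding coords_basis_vec[OF i] using g
        by (auto simp: carrier_Z2_squared mat2_coords_def mat_of_rows_list_def)
    qed simp
    then show ?thesis using g grading_of_line[OF g] by (simp add: M2R_grading_def)
  qed
  then show ?thesis
    by (intro extensionalityI[of _ "carrier Z2_squared"]) (auto simp: M2R_grading_def grading_of_def)
qed

lemma HH_grading_eq: "HH_grading = grading_of Z2_squared HH (carrier Z2_squared) quat_coords"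
proof -
  interpret graded_algebra HH Z2_squared "carrier Z2_squared" quat_sigma quat_coords
    using group_Z2_squared real_alg_class_alg graded_coords_HH
    by (simp add: graded_algebra_def real_algebra_def graded_algebra_axioms_def)
  have "HH_grading g = grading_of Z2_squared HH (carrier Z2_squared) quat_coords g"
    if g: "g \<in> carrier Z2_squared" for g
  proof -
    have "(if g = (0, 0) then Quaternion 1 0 0 0 else if g = (1, 0) then Quaternion 0 1 0 0
      else if g = (0, 1) then Quaternion 0 0 1 0 else Quaternion 0 0 0 1) = quaternion_coords.C.basis_vec g" (is "?m = _")
    proof (rule quaternion_coords.C.coords_eqI)
      show "?m \<in> carrier HH" by (simp add: class_alg_def)
      fix i assume i: "i \<in> carrier Z2_squared"
      then show "quat_coords ?m i = quat_coords (quaternion_coords.C.basis_vec g) i"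
        unfolding quaternion_coords.C.coords_basis_vec[OF i] using g
        by (auto simp: carrier_Z2_squared quat_coords_def)
    qed simp
    then show ?thesis using g grading_of_line[OF g] by (simp add: HH_grading_def)
  qed
  then show ?thesis
    by (intro extensionalityI[of _ "carrier Z2_squared"]) (auto simp: HH_grading_def grading_of_def)
qed

lemma comm_group_M2R_power_group: "comm_group (M2R_power_group m)"
proof -
  have "group (M2R_power_group m)" using group_Z2_squared by simp
  then show ?thesis
    by (rule group.group_comm_groupI)
      (auto simp: PiE_iff intro!: restrict_ext comm_groupE(4)[OF comm_group_Z2_squared])
qed

lemma comm_group_M2R_power_HH_group: "comm_group (M2R_power_group m \<times>\<times> Z2_squared)"
proof -
  have g: "group (M2R_power_group m)" "group Z2_squared"
    using comm_group_M2R_power_group group_Z2_squared by (auto simp: comm_group_def)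
  show ?thesis
    by (rule group.group_comm_groupI[OF DirProd_group[OF g]])
      (auto simp: DirProd_def comm_groupE(4)[OF comm_group_Z2_squared] comm_groupE(4)[OF comm_group_M2R_power_group]
        simp del: mult_product_group carrier_product_group)
qed

lemma M2R_power_graded:
  "\<exists>\<sigma> \<kappa>. graded_coords (M2R_power_group m) (M2R_power m) (carrier (M2R_power_group m)) \<sigma> \<kappa> \<and>
    M2R_power_grading m = grading_of (M2R_power_group m) (M2R_power m) (carrier (M2R_power_group m)) \<kappa>"
  using graded_coords_tensor_power[OF group_Z2_squared real_alg_mat_alg graded_coords_M2R, of m]
  unfolding M2R_grading_eq by blast

lemma M2R_power_grading_div_gradings1:
  "M2R_power_grading m \<in> div_gradings1 (M2R_power_group m) (M2R_power m)"
proof -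
  obtain \<sigma> \<kappa> where gc: "graded_coords (M2R_power_group m) (M2R_power m) (carrier (M2R_power_group m)) \<sigma> \<kappa>"
    "M2R_power_grading m = grading_of (M2R_power_group m) (M2R_power m) (carrier (M2R_power_group m)) \<kappa>"
    using M2R_power_graded by blast
  interpret graded_algebra "M2R_power m" "M2R_power_group m" "carrier (M2R_power_group m)" \<sigma> \<kappa>
    using comm_group_M2R_power_group M2R_power_matrix_alg(1) gc(1)
    by (simp add: graded_algebra_def real_algebra_def graded_algebra_axioms_def comm_group_def)
  show ?thesis using grading_of_div_gradings1 gc(2) by simp
qed

lemma M2R_power_HH_grading_div_gradings1:
  "tensor_grading (M2R_power_group m) (M2R_power m) (M2R_power_grading m) Z2_squared HH HH_grading
    \<in> div_gradings1 (M2R_power_group m \<times>\<times> Z2_squared) (tensor (M2R_power m) HH)"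
proof -
  let ?G = "M2R_power_group m \<times>\<times> Z2_squared"
  obtain \<sigma> \<kappa> where gc: "graded_coords (M2R_power_group m) (M2R_power m) (carrier (M2R_power_group m)) \<sigma> \<kappa>"
    "M2R_power_grading m = grading_of (M2R_power_group m) (M2R_power m) (carrier (M2R_power_group m)) \<kappa>"
    using M2R_power_graded by blast
  have g: "group (M2R_power_group m)"
    using comm_group_M2R_power_group by (simp add: comm_group_def)
  note t = graded_coords_tensor[OF g M2R_power_matrix_alg(1) gc(1) group_Z2_squared real_alg_class_alg graded_coords_HH]
  have "\<exists>\<sigma> \<kappa>. graded_algebra (tensor (M2R_power m) HH) ?G (carrier ?G) \<sigma> \<kappa> \<and>
      tensor_grading (M2R_power_group m) (M2R_power m) (M2R_power_grading m) Z2_squared HH HH_grading =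
      grading_of ?G (tensor (M2R_power m) HH) (carrier ?G) \<kappa>"
    unfolding gc(2) HH_grading_eq graded_algebra_def real_algebra_def graded_algebra_axioms_def
    using t M2R_power_HH_matrix_alg(1) DirProd_group[OF g group_Z2_squared] by blast
  then show ?thesis using graded_algebra.grading_of_div_gradings1 by metis
qed

section \<open>Classification\<close>

text \<open>The classes are the fibres of the surjection \<open>f\<close>. The last conjunct keeps
  the value at every representative; it ties the abstract bijection to the support and to the signs
  of squares.\<close>

lemma ex_bij_betw_quotient:
  assumes "\<And>x. x \<in> S \<Longrightarrow> f x \<in> P" "\<And>p. p \<in> P \<Longrightarrow> \<exists>x\<in>S. f x = p"
    and R: "R = {(x, y). x \<in> S \<and> y \<in> S \<and> f x = f y}"
  shows "\<exists>F. bij_betw F (S // R) P \<and> (\<forall>C\<in>S // R. \<forall>x\<in>C. x \<in> S \<and> F C = f x)"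
proof -
  have C: "\<exists>x\<in>S. C = {y\<in>S. f x = f y}" if "C \<in> S // R" for C
    using that unfolding quotient_def R by auto
  have C': "{y\<in>S. f x = f y} \<in> S // R" if "x \<in> S" for x
    using that unfolding quotient_def R by auto
  let ?F = "\<lambda>C. f (SOME x. x \<in> C)"
  have F: "x \<in> S \<and> ?F C = f x" if CR: "C \<in> S // R" and xC: "x \<in> C" for C x
  proof -
    obtain z where z: "C = {y\<in>S. f z = f y}" using C[OF CR] by blast
    have "(SOME x. x \<in> C) \<in> C" using xC by (rule someI)
    then show ?thesis using xC unfolding z by simp
  qed
  have F': "?F {y\<in>S. f x = f y} = f x" if "x \<in> S" for x
    using F[OF C'[OF that], of x] that by simp
  have "inj_on ?F (S // R)"
  proof (rule inj_onI)
    fix C\<^sub>1 C\<^sub>2 assume "C\<^sub>1 \<in> S // R" "C\<^sub>2 \<in> S // R" and eq: "?F C\<^sub>1 = ?F C\<^sub>2"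
    then obtain x\<^sub>1 x\<^sub>2 where x: "x\<^sub>1 \<in> S" "C\<^sub>1 = {y\<in>S. f x\<^sub>1 = f y}" "x\<^sub>2 \<in> S" "C\<^sub>2 = {y\<in>S. f x\<^sub>2 = f y}"
      using C by meson
    have "f x\<^sub>1 = f x\<^sub>2"
      using eq unfolding x(2,4) F'[OF x(1)] F'[OF x(3)] .
    then show "C\<^sub>1 = C\<^sub>2" unfolding x(2,4) by simp
  qed
  moreover have "?F ` (S // R) = P"
  proof (intro equalityI subsetI)
    fix p assume "p \<in> ?F ` (S // R)"
    then obtain C' where C': "C' \<in> S // R" "p = ?F C'" by blast
    then obtain x where x: "x \<in> S" "C' = {y\<in>S. f x = f y}" using C by blast
    show "p \<in> P" unfolding C'(2) x(2) F'[OF x(1)] by (rule assms(1)[OF x(1)])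
  next
    fix p assume "p \<in> P"
    then obtain x where x: "x \<in> S" "f x = p" using assms(2) by blast
    show "p \<in> ?F ` (S // R)"
      using image_eqI[of p ?F, OF _ C'[OF x(1)]] F'[OF x(1)] x(2) by simp
  qed
  ultimately have "bij_betw ?F (S // R) P" unfolding bij_betw_def by blast
  then show ?thesis using F by blast
qed

text \<open>The form \<open>\<mu>\<close> described by the grading alone, without a choice of basis
  vectors: an element of degree \<open>t\<close> squares to \<open>d^2 \<mu> t\<close> times the
  unit for some real \<open>d\<close>, and \<open>c > 0\<close> excludes the zero element. In this
  form invariance under graded isomorphisms is immediate.\<close>

definition grading_sign :: "('g, 'k) monoid_scheme \<Rightarrow> (real, 'a, 'm) module_scheme \<Rightarrow> ('g \<Rightarrow> 'a set) \<Rightarrow>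
    'g \<Rightarrow> real" where
  "grading_sign G D \<Gamma> = (\<lambda>t\<in>support G D \<Gamma>.
     if \<exists>x\<in>\<Gamma> t. \<exists>c>0. x \<otimes>\<^bsub>D\<^esub> x = c \<odot>\<^bsub>D\<^esub> \<one>\<^bsub>D\<^esub> then 1 else -1)"

lemma (in central_sign_graded_algebra) one_nonzero: "\<one>\<^bsub>D\<^esub> \<noteq> \<zero>\<^bsub>D\<^esub>"
  using basis_vec_nonzero[OF T_closed(2)] basis_vec_one by simp

lemma (in central_sign_graded_algebra) square_in_grading_of:
  assumes t: "t \<in> T" and x: "x \<in> grading_of G D T \<kappa> t" "x \<noteq> \<zero>\<^bsub>D\<^esub>"
  shows "\<exists>c>0. x \<otimes>\<^bsub>D\<^esub> x = (c * square_sign t) \<odot>\<^bsub>D\<^esub> \<one>\<^bsub>D\<^esub>"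
proof -
  obtain d where d: "x = d \<odot>\<^bsub>D\<^esub> basis_vec t"
    using x(1) grading_of_line[OF t] by (auto simp: line_def)
  have "d \<noteq> 0" using x(2) d by auto
  then have pos: "d * d > 0" using not_real_square_gt_zero by blast
  have "x \<otimes>\<^bsub>D\<^esub> x = (d * d * square_sign t) \<odot>\<^bsub>D\<^esub> \<one>\<^bsub>D\<^esub>"
    using t by (simp add: d basis_vec_mult T_square basis_vec_one square_sign_def mult.assoc)
  then show ?thesis using pos by (intro exI[of _ "d * d"] conjI)
qed

lemma (in central_sign_graded_algebra) grading_sign_grading_of:
  "grading_sign G D (grading_of G D T \<kappa>) = square_sign"
proof -
  have "(if \<exists>x\<in>grading_of G D T \<kappa> t. \<exists>c>0. x \<otimes>\<^bsub>D\<^esub> x = c \<odot>\<^bsub>D\<^esub> \<one>\<^bsub>D\<^esub> then 1 else -1) = \<sigma> t t"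
    if t: "t \<in> T" for t
  proof (cases "\<sigma> t t = 1")
    case True
    have v: "basis_vec t \<in> grading_of G D T \<kappa> t" using t by (simp add: grading_of_def)
    have sq: "basis_vec t \<otimes>\<^bsub>D\<^esub> basis_vec t = 1 \<odot>\<^bsub>D\<^esub> \<one>\<^bsub>D\<^esub>"
      using t True by (simp add: basis_vec_mult T_square basis_vec_one)
    have "\<exists>x\<in>grading_of G D T \<kappa> t. \<exists>c>0. x \<otimes>\<^bsub>D\<^esub> x = c \<odot>\<^bsub>D\<^esub> \<one>\<^bsub>D\<^esub>"
      by (rule bexI[OF exI[of _ 1] v]) (use sq in simp)
    then show ?thesis using True by simp
  next
    case False
    then have m: "\<sigma> t t = -1" using sign[OF t t] by simp
    have "\<not> (\<exists>x\<in>grading_of G D T \<kappa> t. \<exists>c>0. x \<otimes>\<^bsub>D\<^esub> x = c \<odot>\<^bsub>D\<^esub> \<one>\<^bsub>D\<^esub>)"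
    proof
      assume "\<exists>x\<in>grading_of G D T \<kappa> t. \<exists>c>0. x \<otimes>\<^bsub>D\<^esub> x = c \<odot>\<^bsub>D\<^esub> \<one>\<^bsub>D\<^esub>"
      then obtain x c where x: "x \<in> grading_of G D T \<kappa> t" "c > 0" "x \<otimes>\<^bsub>D\<^esub> x = c \<odot>\<^bsub>D\<^esub> \<one>\<^bsub>D\<^esub>" by blast
      have "x \<noteq> \<zero>\<^bsub>D\<^esub>"
      proof
        assume "x = \<zero>\<^bsub>D\<^esub>"
        then have "c \<odot>\<^bsub>D\<^esub> \<one>\<^bsub>D\<^esub> = \<zero>\<^bsub>D\<^esub>" using x(3) by simp
        then show False using smult_eq_zero[of "\<one>\<^bsub>D\<^esub>" c] one_nonzero x(2) by auto
      qed
      then obtain d where "d > 0" "x \<otimes>\<^bsub>D\<^esub> x = (d * square_sign t) \<odot>\<^bsub>D\<^esub> \<one>\<^bsub>D\<^esub>"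
        using square_in_grading_of[OF t x(1)] by blast
      then have "c = d * square_sign t"
        using x(3) smult_right_cancel[of "\<one>\<^bsub>D\<^esub>" c "d * square_sign t"] one_nonzero by simp
      then show False using x(2) \<open>d > 0\<close> m t by (simp add: square_sign_def)
    qed
    then show ?thesis using m by simp
  qed
  then show ?thesis
    unfolding grading_sign_def support_grading_of square_sign_def by (intro restrict_ext) blast
qed

lemma central_trace_alg_one_nonzero:
  assumes "real_alg D" "central_trace_alg D K e"
  shows "\<one>\<^bsub>D\<^esub> \<noteq> \<zero>\<^bsub>D\<^esub>"
proof
  interpret real_algebra D by unfold_locales (rule assms)
  assume 1: "\<one>\<^bsub>D\<^esub> = \<zero>\<^bsub>D\<^esub>"
  obtain \<tau> where \<tau>: "linear_fn D \<tau>" "\<tau> \<one>\<^bsub>D\<^esub> > 0"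
    using assms(2) unfolding central_trace_alg_def by blast
  have "\<tau> (0 \<odot>\<^bsub>D\<^esub> \<zero>\<^bsub>D\<^esub>) = 0 * \<tau> \<zero>\<^bsub>D\<^esub>" using \<tau>(1) unfolding linear_fn_def by blast
  then show False using \<tau>(2) 1 by simp
qed

text \<open>Rescaling leaves the components unchanged, so a division grading is given by coordinates
  whose cocycle consists of signs.\<close>

lemma div_grading1_structure:
  assumes G: "comm_group G" and D: "real_alg D" and c: "central_trace_alg D K e"
    and \<Gamma>: "\<Gamma> \<in> div_gradings1 G D"
  obtains \<sigma> \<kappa> where "central_sign_graded_algebra D G (support G D \<Gamma>) \<sigma> \<kappa> K e"
    "\<Gamma> = grading_of G D (support G D \<Gamma>) \<kappa>"
proof -
  interpret real_algebra D by unfold_locales (rule D)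
  interpret G: comm_group G by (rule G)
  let ?T = "support G D \<Gamma>"
  obtain \<gamma> \<eta> \<xi> where "alg_coords D K \<gamma> \<eta> \<xi>" using c unfolding central_trace_alg_def by blast
  then obtain \<sigma> \<kappa> where gc: "graded_coords G D ?T \<sigma> \<kappa>" "\<Gamma> = grading_of G D ?T \<kappa>"
    by (rule div_grading1_coords[OF G.is_group _ central_trace_alg_one_nonzero[OF D c] \<Gamma>]) (rule that)
  interpret A: central_graded_algebra D G ?T \<sigma> \<kappa> K e
    by unfold_locales (rule gc c)+
  interpret E: elementary_graded_algebra D G ?T \<sigma> \<kappa>
    by unfold_locales (rule A.T_square)
  obtain \<sigma>' \<kappa>' where n: "graded_coords G D ?T \<sigma>' \<kappa>'" "grading_of G D ?T \<kappa>' = grading_of G D ?T \<kappa>"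
    "\<And>s t. s \<in> ?T \<Longrightarrow> t \<in> ?T \<Longrightarrow> \<sigma>' s t = 1 \<or> \<sigma>' s t = -1"
    using E.normalize by metis
  have "central_sign_graded_algebra D G ?T \<sigma>' \<kappa>' K e"
    by unfold_locales (rule n(1) c n(3); assumption?)+
  then show ?thesis using that n(2) gc(2) by metis
qed

lemma graded_isomorphic_support:
  assumes D: "real_alg D" and \<phi>: "\<phi> \<in> alg_iso D D" "\<And>g. g \<in> carrier G \<Longrightarrow> \<phi> ` \<Gamma> g = \<Gamma>' g"
    and sub: "\<And>g. g \<in> carrier G \<Longrightarrow> \<Gamma> g \<subseteq> carrier D"
  shows "support G D \<Gamma> = support G D \<Gamma>'" "grading_sign G D \<Gamma> = grading_sign G D \<Gamma>'"
proof -
  interpret real_algebra D by unfold_locales (rule D)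
  note i = alg_isoD[OF \<phi>(1)]
  have inj: "inj_on \<phi> (carrier D)" using i(1) by (simp add: bij_betw_def)
  have \<phi>0: "\<phi> \<zero>\<^bsub>D\<^esub> = \<zero>\<^bsub>D\<^esub>"
    using i(6)[of "\<zero>\<^bsub>D\<^esub>" 0] i(2)[of "\<zero>\<^bsub>D\<^esub>"] by simp
  have "\<Gamma>' g = {\<zero>\<^bsub>D\<^esub>} \<longleftrightarrow> \<Gamma> g = {\<zero>\<^bsub>D\<^esub>}" if g: "g \<in> carrier G" for g
  proof -
    have "\<Gamma>' g = {\<zero>\<^bsub>D\<^esub>} \<longleftrightarrow> \<phi> ` \<Gamma> g = \<phi> ` {\<zero>\<^bsub>D\<^esub>}" using \<phi>(2)[OF g] \<phi>0 by simp
    also have "\<dots> \<longleftrightarrow> \<Gamma> g = {\<zero>\<^bsub>D\<^esub>}"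
      by (rule inj_on_image_eq_iff[OF inj sub[OF g]]) simp
    finally show ?thesis .
  qed
  then show s: "support G D \<Gamma> = support G D \<Gamma>'" unfolding support_def by blast
  have "(\<exists>x\<in>\<Gamma> t. \<exists>c>0. x \<otimes>\<^bsub>D\<^esub> x = c \<odot>\<^bsub>D\<^esub> \<one>\<^bsub>D\<^esub>) \<longleftrightarrow> (\<exists>x\<in>\<Gamma>' t. \<exists>c>0. x \<otimes>\<^bsub>D\<^esub> x = c \<odot>\<^bsub>D\<^esub> \<one>\<^bsub>D\<^esub>)"
    if t: "t \<in> carrier G" for t
  proof -
    have "\<phi> x \<otimes>\<^bsub>D\<^esub> \<phi> x = c \<odot>\<^bsub>D\<^esub> \<one>\<^bsub>D\<^esub> \<longleftrightarrow> x \<otimes>\<^bsub>D\<^esub> x = c \<odot>\<^bsub>D\<^esub> \<one>\<^bsub>D\<^esub>" if "x \<in> \<Gamma> t" for x c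
    proof -
      have x: "x \<in> carrier D" using sub[OF t] that by blast
      have "\<phi> x \<otimes>\<^bsub>D\<^esub> \<phi> x = c \<odot>\<^bsub>D\<^esub> \<one>\<^bsub>D\<^esub> \<longleftrightarrow> \<phi> (x \<otimes>\<^bsub>D\<^esub> x) = \<phi> (c \<odot>\<^bsub>D\<^esub> \<one>\<^bsub>D\<^esub>)"
        using x i(4)[OF x x] i(5) i(6)[OF one_closed] by simp
      also have "\<dots> \<longleftrightarrow> x \<otimes>\<^bsub>D\<^esub> x = c \<odot>\<^bsub>D\<^esub> \<one>\<^bsub>D\<^esub>"
        using x by (intro inj_on_eq_iff[OF inj]) auto
      finally show ?thesis .
    qed
    then show ?thesis unfolding \<phi>(2)[OF t, symmetric] by (simp add: bex_simps)
  qed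
  then show "grading_sign G D \<Gamma> = grading_sign G D \<Gamma>'"
    unfolding grading_sign_def s by (intro restrict_ext) (auto simp: support_def)
qed

text \<open>Support and signs are invariants by their description. Conversely, if they agree, the
  identity of the common support is an isometry, and the isomorphism built from it preserves
  degrees.\<close>

lemma graded_isomorphic_iff:
  assumes G: "comm_group G" and D: "real_alg D" and c: "central_trace_alg D K e"
    and \<Gamma>: "\<Gamma> \<in> div_gradings1 G D" and \<Gamma>': "\<Gamma>' \<in> div_gradings1 G D"
  shows "graded_isomorphic G D \<Gamma> D \<Gamma>' \<longleftrightarrow>
    support G D \<Gamma> = support G D \<Gamma>' \<and> grading_sign G D \<Gamma> = grading_sign G D \<Gamma>'"
proof
  assume "graded_isomorphic G D \<Gamma> D \<Gamma>'"
  then obtain \<phi> where "\<phi> \<in> alg_iso D D" "\<And>g. g \<in> carrier G \<Longrightarrow> \<phi> ` \<Gamma> g = \<Gamma>' g"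
    unfolding graded_isomorphic_def by blast
  moreover have "\<Gamma> g \<subseteq> carrier D" if "g \<in> carrier G" for g
    using \<Gamma> that
    by (auto simp: div_gradings1_def division_grading_def grading_def lin_subspace_def PiE_iff)
  ultimately show "support G D \<Gamma> = support G D \<Gamma>' \<and> grading_sign G D \<Gamma> = grading_sign G D \<Gamma>'"
    using graded_isomorphic_support[OF D] by metis
next
  assume eq: "support G D \<Gamma> = support G D \<Gamma>' \<and> grading_sign G D \<Gamma> = grading_sign G D \<Gamma>'"
  let ?T = "support G D \<Gamma>"
  obtain \<sigma> \<kappa> where A: "central_sign_graded_algebra D G ?T \<sigma> \<kappa> K e" "\<Gamma> = grading_of G D ?T \<kappa>"
    using div_grading1_structure[OF G D c \<Gamma>] by metis
  obtain \<sigma>' \<kappa>' where B: "central_sign_graded_algebra D G ?T \<sigma>' \<kappa>' K e" "\<Gamma>' = grading_of G D ?T \<kappa>'"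
    using div_grading1_structure[OF G D c \<Gamma>'] eq by metis
  interpret A: central_sign_graded_algebra D G ?T \<sigma> \<kappa> K e by (rule A)
  interpret B: central_sign_graded_algebra D G ?T \<sigma>' \<kappa>' K e by (rule B)
  have ss: "A.square_sign = B.square_sign"
    using eq A.grading_sign_grading_of B.grading_sign_grading_of A(2) B(2) by simp
  have "\<sigma>' t t = \<sigma> t t" if "t \<in> ?T" for t
    using fun_cong[OF ss, of t] that by (simp add: A.square_sign_def B.square_sign_def)
  moreover have "(\<lambda>t. t) \<in> iso (G\<lparr>carrier := ?T\<rparr>) (G\<lparr>carrier := ?T\<rparr>)"
    by (auto simp: iso_def hom_def bij_betw_def)
  ultimately obtain \<phi> where \<phi>: "\<phi> \<in> alg_iso D D"
    "\<And>t. t \<in> ?T \<Longrightarrow> \<phi> ` grading_of G D ?T \<kappa> t = grading_of G D ?T \<kappa>' t"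
    using graded_algebra_iso[OF A.sign_graded_algebra_axioms B.sign_graded_algebra_axioms] by metis
  have "\<phi> \<zero>\<^bsub>D\<^esub> = \<zero>\<^bsub>D\<^esub>"
    using alg_isoD(6)[OF \<phi>(1), of "\<zero>\<^bsub>D\<^esub>" 0] alg_isoD(2)[OF \<phi>(1), of "\<zero>\<^bsub>D\<^esub>"] by simp
  then have "\<phi> ` \<Gamma> g = \<Gamma>' g" if "g \<in> carrier G" for g
    using \<phi>(2)[of g] A.grading_of_outside[OF that] B.grading_of_outside[OF that] A(2) B(2)
    by (cases "g \<in> ?T") (metis image_empty image_insert)+
  then show "graded_isomorphic G D \<Gamma> D \<Gamma>'" using \<phi>(1) unfolding graded_isomorphic_def by blast
qed

section \<open>Classification for a fixed dimension and signature\<close>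

lemma typeI_pairs_type_I_form:
  assumes "(T, \<mu>) \<in> typeI_pairs G k s"
  shows "type_I_form (G\<lparr>carrier := T\<rparr>) \<mu>" "card T = 2 ^ k"
proof -
  show card: "card T = 2 ^ k"
    using assms iso_same_card[of "G\<lparr>carrier := T\<rparr>" "Z2_power k"] card_Z2_power[of k] by (auto simp: typeI_pairs_def)
  then have "finite T" using card_ge_0_finite by force
  then show "type_I_form (G\<lparr>carrier := T\<rparr>) \<mu>"
    using assms by unfold_locales (auto simp: typeI_pairs_def)
qed

text \<open>\<open>K\<close> and \<open>e\<close> carry the dimension and the signature of the trace
  form. \<open>D\<close> and the model algebra are instances with the same \<open>K\<close> and
  \<open>e\<close>, and this is how their gradings are compared.\<close>

locale classification_setup =
  fixes G :: "('g, 'k) monoid_scheme" and D :: "(real, 'd, 'e) module_scheme"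
    and K :: "'i set" and e :: "'i \<Rightarrow> real"
  assumes G: "comm_group G" and D: "real_alg D" and central: "central_trace_alg D K e"
begin

lemma support_structure:
  assumes \<Gamma>: "\<Gamma> \<in> div_gradings1 G D"
  shows "subgroup (support G D \<Gamma>) G"
    and "type_I_form (G\<lparr>carrier := support G D \<Gamma>\<rparr>) (grading_sign G D \<Gamma>)"
    and "card (support G D \<Gamma>) = card K"
    and "(\<Sum>t\<in>support G D \<Gamma>. grading_sign G D \<Gamma> t) = (\<Sum>k\<in>K. sgn (e k))"
    and "t \<in> support G D \<Gamma> \<Longrightarrow> x \<in> \<Gamma> t - {\<zero>\<^bsub>D\<^esub>} \<Longrightarrow>
      \<exists>c>0. x \<otimes>\<^bsub>D\<^esub> x = (c * grading_sign G D \<Gamma> t) \<odot>\<^bsub>D\<^esub> \<one>\<^bsub>D\<^esub>"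
proof -
  let ?T = "support G D \<Gamma>"
  obtain \<sigma> \<kappa> where A: "central_sign_graded_algebra D G ?T \<sigma> \<kappa> K e" "\<Gamma> = grading_of G D ?T \<kappa>"
    using div_grading1_structure[OF G D central \<Gamma>] by metis
  interpret A: central_sign_graded_algebra D G ?T \<sigma> \<kappa> K e by (rule A)
  have ss: "grading_sign G D \<Gamma> = A.square_sign"
    using A.grading_sign_grading_of A(2) by simp
  show "subgroup ?T G" by (rule A.subgroup_T)
  show "type_I_form (G\<lparr>carrier := ?T\<rparr>) (grading_sign G D \<Gamma>)"
    unfolding ss by (rule A.type_I_form_square_sign)
  show "card ?T = card K" by (rule A.card_T)
  show "(\<Sum>t\<in>?T. grading_sign G D \<Gamma> t) = (\<Sum>k\<in>K. sgn (e k))"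
    unfolding ss by (rule A.sum_square_sign)
  assume "t \<in> ?T" "x \<in> \<Gamma> t - {\<zero>\<^bsub>D\<^esub>}"
  then show "\<exists>c>0. x \<otimes>\<^bsub>D\<^esub> x = (c * grading_sign G D \<Gamma> t) \<odot>\<^bsub>D\<^esub> \<one>\<^bsub>D\<^esub>"
    unfolding ss using A.square_in_grading_of[of t x] A(2) by auto
qed

lemma card_power_4:
  assumes \<Gamma>: "\<Gamma> \<in> div_gradings1 G D"
  shows "\<exists>r. card K = 4 ^ r \<and> G\<lparr>carrier := support G D \<Gamma>\<rparr> \<cong> Z2_power (2 * r)"
  using type_I_form.card_eq_power[OF support_structure(2)[OF \<Gamma>]] support_structure(3)[OF \<Gamma>] by simp

lemma support_sign_in_typeI_pairs:
  assumes \<Gamma>: "\<Gamma> \<in> div_gradings1 G D" and K: "card K = 4 ^ r" "(\<Sum>k\<in>K. sgn (e k)) = s * 2 ^ r"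
  shows "(support G D \<Gamma>, grading_sign G D \<Gamma>) \<in> typeI_pairs G (2 * r) s"
proof -
  note S = support_structure[OF \<Gamma>]
  interpret type_I_form "G\<lparr>carrier := support G D \<Gamma>\<rparr>" "grading_sign G D \<Gamma>" by (rule S(2))
  obtain r' where "card K = 4 ^ r'" "G\<lparr>carrier := support G D \<Gamma>\<rparr> \<cong> Z2_power (2 * r')"
    using card_power_4[OF \<Gamma>] by blast
  moreover from this have "r' = r" using K(1) by simp
  moreover have "Arf (G\<lparr>carrier := support G D \<Gamma>\<rparr>) (grading_sign G D \<Gamma>) = s"
    using Arf_eq[of r] S(3,4) K by simp
  ultimately show ?thesis
    using S(1) quadratic type_I by (simp add: typeI_pairs_def)
qed

text \<open>Orders and sums of both forms are fixed by \<open>K\<close> and \<open>e\<close>.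
  \<open>T\<close> is any set carrying such a form, so that the lemma serves both for the
  equivalence of gradings and for the realization of pairs.\<close>

lemma isometric_supports:
  assumes \<Gamma>: "\<Gamma> \<in> div_gradings1 GM M" and M: "classification_setup GM M K e"
    and L: "type_I_form (G\<lparr>carrier := T\<rparr>) \<mu>" "card T = card K" "(\<Sum>t\<in>T. \<mu> t) = (\<Sum>k\<in>K. sgn (e k))"
  obtains \<alpha> where "\<alpha> \<in> iso (G\<lparr>carrier := T\<rparr>) (GM\<lparr>carrier := support GM M \<Gamma>\<rparr>)"
    "\<And>t. t \<in> T \<Longrightarrow> grading_sign GM M \<Gamma> (\<alpha> t) = \<mu> t"
proof -
  interpret M: classification_setup GM M K e by (rule M)
  note S = M.support_structure[OF \<Gamma>]
  show ?thesis
    by (rule isometry[OF L(1) S(2)]) (use L(2,3) S(3,4) that in simp_all)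
qed

lemma graded_equivalentI:
  assumes \<Gamma>: "\<Gamma> \<in> div_gradings1 G D" and M: "classification_setup GM M K e"
    and \<Gamma>M: "\<Gamma>M \<in> div_gradings1 GM M"
  shows "graded_equivalent G D \<Gamma> GM M \<Gamma>M"
proof -
  interpret M: classification_setup GM M K e by (rule M)
  let ?T = "support G D \<Gamma>" and ?TM = "support GM M \<Gamma>M"
  note S = support_structure[OF \<Gamma>]
  obtain \<alpha> where \<alpha>: "\<alpha> \<in> iso (G\<lparr>carrier := ?T\<rparr>) (GM\<lparr>carrier := ?TM\<rparr>)"
    "\<And>t. t \<in> ?T \<Longrightarrow> grading_sign GM M \<Gamma>M (\<alpha> t) = grading_sign G D \<Gamma> t"
    using isometric_supports[OF \<Gamma>M M S(2,3,4)] by blast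
  obtain \<sigma> \<kappa> where A: "central_sign_graded_algebra D G ?T \<sigma> \<kappa> K e" "\<Gamma> = grading_of G D ?T \<kappa>"
    using div_grading1_structure[OF G D central \<Gamma>] by metis
  obtain \<sigma>' \<kappa>' where B: "central_sign_graded_algebra M GM ?TM \<sigma>' \<kappa>' K e" "\<Gamma>M = grading_of GM M ?TM \<kappa>'"
    using div_grading1_structure[OF M.G M.D M.central \<Gamma>M] by metis
  interpret A: central_sign_graded_algebra D G ?T \<sigma> \<kappa> K e by (rule A)
  interpret B: central_sign_graded_algebra M GM ?TM \<sigma>' \<kappa>' K e by (rule B)
  have ss: "grading_sign G D \<Gamma> = A.square_sign" "grading_sign GM M \<Gamma>M = B.square_sign"
    using A.grading_sign_grading_of B.grading_sign_grading_of A(2) B(2) by simp_all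
  have bij: "bij_betw \<alpha> ?T ?TM" using \<alpha>(1) by (simp add: iso_def)
  have "\<sigma>' (\<alpha> t) (\<alpha> t) = \<sigma> t t" if "t \<in> ?T" for t
    using \<alpha>(2)[OF that] that bij_betwE[OF bij] unfolding ss by (simp add: A.square_sign_def B.square_sign_def)
  then obtain \<phi> where "\<phi> \<in> alg_iso D M"
    "\<And>t. t \<in> ?T \<Longrightarrow> \<phi> ` grading_of G D ?T \<kappa> t = grading_of GM M ?TM \<kappa>' (\<alpha> t)"
    using graded_algebra_iso[OF A.sign_graded_algebra_axioms B.sign_graded_algebra_axioms \<alpha>(1)] by metis
  then show ?thesis
    unfolding graded_equivalent_def using bij A(2) B(2) by metis
qed

lemma typeI_pairs_realized:
  assumes K: "card K = 4 ^ r" "(\<Sum>k\<in>K. sgn (e k)) = s * 2 ^ r"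
    and M: "classification_setup GM M K e" and \<Gamma>M: "\<Gamma>M \<in> div_gradings1 GM M" and \<psi>: "\<psi> \<in> alg_iso D M"
    and T\<mu>: "(T, \<mu>) \<in> typeI_pairs G (2 * r) s"
  shows "\<exists>\<Gamma>\<in>div_gradings1 G D. (support G D \<Gamma>, grading_sign G D \<Gamma>) = (T, \<mu>)"
proof -
  interpret M: classification_setup GM M K e by (rule M)
  interpret G: comm_group G by (rule G)
  let ?TM = "support GM M \<Gamma>M"
  note L = typeI_pairs_type_I_form[OF T\<mu>]
  interpret L: type_I_form "G\<lparr>carrier := T\<rparr>" \<mu> by (rule L)
  have cT: "card T = 4 ^ r" using L(2) by (simp add: power_mult)
  have "(\<Sum>t\<in>T. \<mu> t) = 2 ^ r * Arf (G\<lparr>carrier := T\<rparr>) \<mu>" using L.Arf_eq[of r] cT by simp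
  also have "\<dots> = (\<Sum>k\<in>K. sgn (e k))" using T\<mu> K(2) by (simp add: typeI_pairs_def)
  finally obtain \<alpha> where \<alpha>: "\<alpha> \<in> iso (G\<lparr>carrier := T\<rparr>) (GM\<lparr>carrier := ?TM\<rparr>)"
    "\<And>t. t \<in> T \<Longrightarrow> grading_sign GM M \<Gamma>M (\<alpha> t) = \<mu> t"
    using isometric_supports[OF \<Gamma>M M L(1)] cT K(1) by metis
  obtain \<sigma> \<kappa> where B: "central_sign_graded_algebra M GM ?TM \<sigma> \<kappa> K e" "\<Gamma>M = grading_of GM M ?TM \<kappa>"
    using div_grading1_structure[OF M.G M.D M.central \<Gamma>M] by metis
  interpret B: central_sign_graded_algebra M GM ?TM \<sigma> \<kappa> K e by (rule B)
  have ss: "grading_sign GM M \<Gamma>M = B.square_sign"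
    using B.grading_sign_grading_of B(2) by simp
  have bij: "bij_betw \<alpha> T ?TM" using \<alpha>(1) by (simp add: iso_def)
  have hom: "\<alpha> (a \<otimes>\<^bsub>G\<^esub> b) = \<alpha> a \<otimes>\<^bsub>GM\<^esub> \<alpha> b" if "a \<in> T" "b \<in> T" for a b
    using \<alpha>(1) that by (simp add: iso_def hom_def)
  have \<alpha>T: "\<alpha> t \<in> ?TM" if "t \<in> T" for t using bij that by (rule bij_betw_apply)
  have \<alpha>eq: "\<alpha> a = \<alpha> b \<longleftrightarrow> a = b" if "a \<in> T" "b \<in> T" for a b
    using bij that by (meson bij_betw_def inj_on_eq_iff)
  have sub: "subgroup T G" using T\<mu> by (simp add: typeI_pairs_def)
  then have T1: "\<one>\<^bsub>G\<^esub> \<in> T" and Tm: "\<And>a b. a \<in> T \<Longrightarrow> b \<in> T \<Longrightarrow> a \<otimes>\<^bsub>G\<^esub> b \<in> T"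
    by (auto simp: subgroup_def)
  have \<alpha>1: "\<alpha> \<one>\<^bsub>G\<^esub> = \<one>\<^bsub>GM\<^esub>"
    using hom[OF T1 T1] \<alpha>T[OF T1] B.T_square[of "\<alpha> \<one>\<^bsub>G\<^esub>"] by simp
  \<comment> \<open>The coordinates of \<open>M\<close> are pulled back to \<open>D\<close> along
    \<open>\<psi>\<close>, and the degrees are renamed along \<open>\<alpha>\<close> from the
    support in \<open>GM\<close> to \<open>T\<close>.\<close>
  define \<sigma>' where "\<sigma>' a b = \<sigma> (\<alpha> a) (\<alpha> b)" for a b
  define \<kappa>' where "\<kappa>' = (\<lambda>x. \<lambda>t\<in>T. (\<kappa> \<circ> \<psi>) x (\<alpha> t))"
  have "alg_coords D T (graded_struct G \<sigma>') (graded_unit G) \<kappa>'"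
    unfolding \<kappa>'_def
  proof (rule alg_coords_rename[OF alg_coords_pullback[OF \<psi> B.alg_coords D] bij])
    show "graded_struct G \<sigma>' a b c = graded_struct GM \<sigma> (\<alpha> a) (\<alpha> b) (\<alpha> c)" if "a \<in> T" "b \<in> T" "c \<in> T" for a b c
      using \<alpha>eq[OF Tm[OF that(1,2)] that(3)] hom[OF that(1,2)] by (simp add: graded_struct_def \<sigma>'_def)
    show "graded_unit G t = graded_unit GM (\<alpha> t)" if "t \<in> T" for t
      using \<alpha>eq[OF that T1] \<alpha>1 by (simp add: graded_unit_def)
  qed
  then have gc: "graded_coords G D T \<sigma>' \<kappa>'"
    using sub B.sigma_nonzero \<alpha>T by (simp add: graded_coords_def \<sigma>'_def)
  interpret A: central_sign_graded_algebra D G T \<sigma>' \<kappa>' K e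
    by unfold_locales (use D gc central B.sign \<alpha>T in \<open>auto simp: \<sigma>'_def\<close>)
  have "A.square_sign t = \<mu> t" for t
  proof (cases "t \<in> T")
    case True
    then show ?thesis
      using \<alpha>(2)[OF True] \<alpha>T[OF True] unfolding ss by (simp add: A.square_sign_def B.square_sign_def \<sigma>'_def)
  next
    case False
    \<comment> \<open>Outside \<open>T\<close> both functions take the default value
      \<open>undefined\<close>, so the pair is recovered exactly.\<close>
    have "\<mu> \<in> extensional T" using T\<mu> by (simp add: typeI_pairs_def quadratic_form_def PiE_iff)
    then show ?thesis using False by (simp add: A.square_sign_def extensional_def)
  qed
  then have "A.square_sign = \<mu>" by (rule ext)
  then show ?thesis
    using A.grading_of_div_gradings1 A.support_grading_of A.grading_sign_grading_of
    by (intro bexI[of _ "grading_of G D T \<kappa>'"]) auto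
qed

lemma iso_classes1_bij:
  assumes K: "card K = 4 ^ r" "(\<Sum>k\<in>K. sgn (e k)) = s * 2 ^ r"
    and M: "classification_setup GM M K e" and \<Gamma>M: "\<Gamma>M \<in> div_gradings1 GM M" and \<psi>: "\<psi> \<in> alg_iso D M"
  shows "\<exists>F. bij_betw F (iso_classes1 G D) (typeI_pairs G (2 * r) s) \<and>
    (\<forall>C\<in>iso_classes1 G D. \<forall>\<Gamma>\<in>C. \<forall>T \<mu>. F C = (T, \<mu>) \<longrightarrow> T = support G D \<Gamma> \<and>
      (\<forall>t\<in>T. \<forall>x\<in>\<Gamma> t - {\<zero>\<^bsub>D\<^esub>}. \<exists>c>0. x \<otimes>\<^bsub>D\<^esub> x = (c * \<mu> t) \<odot>\<^bsub>D\<^esub> \<one>\<^bsub>D\<^esub>))"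
proof -
  let ?S = "div_gradings1 G D" and ?f = "\<lambda>\<Gamma>. (support G D \<Gamma>, grading_sign G D \<Gamma>)"
  let ?R = "{(\<Gamma>, \<Gamma>'). \<Gamma> \<in> ?S \<and> \<Gamma>' \<in> ?S \<and> graded_isomorphic G D \<Gamma> D \<Gamma>'}"
  have "?R = {(x, y). x \<in> ?S \<and> y \<in> ?S \<and> ?f x = ?f y}"
    using graded_isomorphic_iff[OF G D central] by auto
  then have "\<exists>F. bij_betw F (?S // ?R) (typeI_pairs G (2 * r) s) \<and>
      (\<forall>C\<in>?S // ?R. \<forall>x\<in>C. x \<in> ?S \<and> F C = ?f x)"
    by (rule ex_bij_betw_quotient[rotated 2])
      (use support_sign_in_typeI_pairs[OF _ K] typeI_pairs_realized[OF K M \<Gamma>M \<psi>] in auto)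
  then obtain F where F: "bij_betw F (iso_classes1 G D) (typeI_pairs G (2 * r) s)"
    "\<forall>C\<in>iso_classes1 G D. \<forall>x\<in>C. x \<in> ?S \<and> F C = ?f x"
    unfolding iso_classes1_def by blast
  show ?thesis
    using F support_structure(5) by (intro exI[of _ F]) auto
qed

end

section \<open>Specialization to matrices over R and H\<close>

lemma (in central_class_coords) classification_setup:
  assumes "comm_group G" "real_alg D" "alg_isomorphic D (mat_alg TYPE('a) n)" "n \<ge> 1"
  shows "classification_setup G D (mat_index n Q) trace_sign"
proof -
  obtain \<phi> where "\<phi> \<in> alg_iso D (mat_alg TYPE('a) n)"
    using assms(3) by (auto simp: alg_isomorphic_def)
  then show ?thesis
    using assms(1,2) central_trace_alg_iso central_trace_alg_mat[OF assms(4)]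
    by (intro classification_setup.intro) auto
qed

lemma alg_isomorphic_common:
  assumes "alg_isomorphic A C" "alg_isomorphic B C" "real_alg B"
  obtains \<psi> where "\<psi> \<in> alg_iso A B"
proof -
  obtain \<phi> \<phi>' where "\<phi> \<in> alg_iso A C" "\<phi>' \<in> alg_iso B C"
    using assms by (auto simp: alg_isomorphic_def)
  then show ?thesis
    using that alg_iso_trans alg_iso_inv[OF _ real_alg_closed[OF assms(3)]] by blast
qed

lemma trace_sign_real:
  "card (mat_index n {()}) = n ^ 2" "(\<Sum>k\<in>mat_index n {()}. sgn (real_coords.trace_sign k)) = n"
  using real_coords.sum_sgn_trace_sign[of n] by (simp_all add: card_cartesian_product power2_eq_square)

lemma trace_sign_quaternion:
  "card (mat_index n (carrier Z2_squared)) = (2 * n) ^ 2"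
  "(\<Sum>k\<in>mat_index n (carrier Z2_squared). sgn (quaternion_coords.trace_sign k)) = - 2 * n"
  using quaternion_coords.sum_sgn_trace_sign[of n]
  by (simp_all add: card_cartesian_product power2_eq_square carrier_Z2_squared)

text \<open>The dimension of \<open>D\<close> is \<open>n^2\<close> or \<open>(2 n)^2\<close> and
  equals \<open>4 ^ r\<close>; this is what makes \<open>n\<close> a power of two.\<close>

lemma square_eq_power_4: "(k::nat) ^ 2 = 4 ^ r \<longleftrightarrow> k = 2 ^ r"
proof -
  have "(4::nat) ^ r = (2 ^ r) ^ 2" by (simp add: power2_eq_square flip: power_mult_distrib)
  then show ?thesis by (simp add: power2_eq_iff_nonneg)
qed

theorem theorem15:
  fixes G :: "('g, 'k) monoid_scheme" and D :: "(real, 'd, 'e) module_scheme" and n :: nat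
  assumes "comm_group G" and "real_alg D" and "n \<ge> 1"
  shows
    "(alg_isomorphic D (mat_alg TYPE(real) n) \<longrightarrow>
       (\<forall>\<Gamma>\<in>div_gradings1 G D. \<exists>m. n = 2 ^ m \<and> subgroup (support G D \<Gamma>) G \<and>
          G\<lparr>carrier := support G D \<Gamma>\<rparr> \<cong> Z2_power (2 * m)) \<and>
       (\<forall>m. n = 2 ^ m \<longrightarrow>
          (\<exists>F. bij_betw F (iso_classes1 G D) (typeI_pairs G (2 * m) 1) \<and>
             (\<forall>C\<in>iso_classes1 G D. \<forall>\<Gamma>\<in>C. \<forall>T \<mu>. F C = (T, \<mu>) \<longrightarrow> T = support G D \<Gamma> \<and>
                (\<forall>t\<in>T. \<forall>x\<in>\<Gamma> t - {\<zero>\<^bsub>D\<^esub>}. \<exists>c>0. x \<otimes>\<^bsub>D\<^esub> x = (c * \<mu> t) \<odot>\<^bsub>D\<^esub> \<one>\<^bsub>D\<^esub>))) \<and>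
          real_alg (M2R_power m) \<and>
          alg_isomorphic (M2R_power m) (mat_alg TYPE(real) n) \<and>
          M2R_power_grading m \<in> div_gradings1 (M2R_power_group m) (M2R_power m) \<and>
          (\<forall>\<Gamma>\<in>div_gradings1 G D. graded_equivalent G D \<Gamma>
             (M2R_power_group m) (M2R_power m) (M2R_power_grading m))))
     \<and>
     (alg_isomorphic D (mat_alg TYPE(quaternion) n) \<longrightarrow>
       (\<forall>\<Gamma>\<in>div_gradings1 G D. \<exists>m. n = 2 ^ m \<and> subgroup (support G D \<Gamma>) G \<and>
          G\<lparr>carrier := support G D \<Gamma>\<rparr> \<cong> Z2_power (2 * m + 2)) \<and>
       (\<forall>m. n = 2 ^ m \<longrightarrow>
          (\<exists>F. bij_betw F (iso_classes1 G D) (typeI_pairs G (2 * m + 2) (-1)) \<and>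
             (\<forall>C\<in>iso_classes1 G D. \<forall>\<Gamma>\<in>C. \<forall>T \<mu>. F C = (T, \<mu>) \<longrightarrow> T = support G D \<Gamma> \<and>
                (\<forall>t\<in>T. \<forall>x\<in>\<Gamma> t - {\<zero>\<^bsub>D\<^esub>}. \<exists>c>0. x \<otimes>\<^bsub>D\<^esub> x = (c * \<mu> t) \<odot>\<^bsub>D\<^esub> \<one>\<^bsub>D\<^esub>))) \<and>
          real_alg (tensor (M2R_power m) HH) \<and>
          alg_isomorphic (tensor (M2R_power m) HH) (mat_alg TYPE(quaternion) n) \<and>
          tensor_grading (M2R_power_group m) (M2R_power m) (M2R_power_grading m)
              Z2_squared HH HH_grading
            \<in> div_gradings1 (M2R_power_group m \<times>\<times> Z2_squared) (tensor (M2R_power m) HH) \<and>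
          (\<forall>\<Gamma>\<in>div_gradings1 G D. graded_equivalent G D \<Gamma>
             (M2R_power_group m \<times>\<times> Z2_squared) (tensor (M2R_power m) HH)
             (tensor_grading (M2R_power_group m) (M2R_power m) (M2R_power_grading m)
                Z2_squared HH HH_grading))))"
proof (intro conjI impI allI)
  assume iso: "alg_isomorphic D (mat_alg TYPE(real) n)"
  interpret classification_setup G D "mat_index n {()}" real_coords.trace_sign
    by (rule real_coords.classification_setup[OF assms(1,2) iso assms(3)])
  show "\<forall>\<Gamma>\<in>div_gradings1 G D. \<exists>m. n = 2 ^ m \<and> subgroup (support G D \<Gamma>) G \<and>
      G\<lparr>carrier := support G D \<Gamma>\<rparr> \<cong> Z2_power (2 * m)"
    using card_power_4 support_structure(1) unfolding trace_sign_real(1) square_eq_power_4 by blast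
  fix m assume n: "n = 2 ^ m"
  note M = M2R_power_matrix_alg(1)[of m] M2R_power_matrix_alg(2)[of m, folded n]
  show "real_alg (M2R_power m)" by (rule M)
  show "alg_isomorphic (M2R_power m) (mat_alg TYPE(real) n)" by (rule M)
  show \<Gamma>M: "M2R_power_grading m \<in> div_gradings1 (M2R_power_group m) (M2R_power m)"
    by (rule M2R_power_grading_div_gradings1)
  note MS = real_coords.classification_setup[OF comm_group_M2R_power_group M assms(3), of m]
  show "\<forall>\<Gamma>\<in>div_gradings1 G D. graded_equivalent G D \<Gamma> (M2R_power_group m) (M2R_power m) (M2R_power_grading m)"
    using graded_equivalentI[OF _ MS \<Gamma>M] by blast
  obtain \<psi> where \<psi>: "\<psi> \<in> alg_iso D (M2R_power m)"
    using alg_isomorphic_common[OF iso M(2,1)] by blast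
  show "\<exists>F. bij_betw F (iso_classes1 G D) (typeI_pairs G (2 * m) 1) \<and>
      (\<forall>C\<in>iso_classes1 G D. \<forall>\<Gamma>\<in>C. \<forall>T \<mu>. F C = (T, \<mu>) \<longrightarrow> T = support G D \<Gamma> \<and>
        (\<forall>t\<in>T. \<forall>x\<in>\<Gamma> t - {\<zero>\<^bsub>D\<^esub>}. \<exists>c>0. x \<otimes>\<^bsub>D\<^esub> x = (c * \<mu> t) \<odot>\<^bsub>D\<^esub> \<one>\<^bsub>D\<^esub>))"
  proof (rule iso_classes1_bij[OF _ _ MS \<Gamma>M \<psi>])
    show "card (mat_index n {()}) = 4 ^ m" unfolding trace_sign_real(1) square_eq_power_4 by (rule n)
    show "(\<Sum>k\<in>mat_index n {()}. sgn (real_coords.trace_sign k)) = 1 * 2 ^ m"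
      unfolding trace_sign_real(2) by (simp add: n)
  qed
next
  let ?Q = "carrier Z2_squared"
  assume iso: "alg_isomorphic D (mat_alg TYPE(quaternion) n)"
  interpret classification_setup G D "mat_index n ?Q" quaternion_coords.trace_sign
    by (rule quaternion_coords.classification_setup[OF assms(1,2) iso assms(3)])
  show "\<forall>\<Gamma>\<in>div_gradings1 G D. \<exists>m. n = 2 ^ m \<and> subgroup (support G D \<Gamma>) G \<and>
      G\<lparr>carrier := support G D \<Gamma>\<rparr> \<cong> Z2_power (2 * m + 2)"
  proof
    fix \<Gamma> assume \<Gamma>: "\<Gamma> \<in> div_gradings1 G D"
    obtain r where r: "2 * n = 2 ^ r" "G\<lparr>carrier := support G D \<Gamma>\<rparr> \<cong> Z2_power (2 * r)"
      using card_power_4[OF \<Gamma>] unfolding trace_sign_quaternion(1) square_eq_power_4 by blast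
    \<comment> \<open>The factor 2 in \<open>2 * n = 2 ^ r\<close>, due to the quaternions, accounts
      for \<open>r = m + 1\<close> and hence for the rank \<open>2 * m + 2\<close>.\<close>
    have "r \<noteq> 0" using r(1) assms(3) by (intro notI) simp
    then obtain m where m: "r = Suc m" using not0_implies_Suc by blast
    then show "\<exists>m. n = 2 ^ m \<and> subgroup (support G D \<Gamma>) G \<and>
        G\<lparr>carrier := support G D \<Gamma>\<rparr> \<cong> Z2_power (2 * m + 2)"
      using r support_structure(1)[OF \<Gamma>] by (intro exI[of _ m]) (simp add: m)
  qed
  fix m assume n: "n = 2 ^ m"
  let ?M = "tensor (M2R_power m) HH" and ?GM = "M2R_power_group m \<times>\<times> Z2_squared"
    and ?\<Gamma>M = "tensor_grading (M2R_power_group m) (M2R_power m) (M2R_power_grading m) Z2_squared HH HH_grading"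
  note M = M2R_power_HH_matrix_alg(1)[of m] M2R_power_HH_matrix_alg(2)[of m, folded n]
  show "real_alg ?M" by (rule M)
  show "alg_isomorphic ?M (mat_alg TYPE(quaternion) n)" by (rule M)
  show \<Gamma>M: "?\<Gamma>M \<in> div_gradings1 ?GM ?M"
    by (rule M2R_power_HH_grading_div_gradings1)
  note MS = quaternion_coords.classification_setup[OF comm_group_M2R_power_HH_group M assms(3), of m]
  show "\<forall>\<Gamma>\<in>div_gradings1 G D. graded_equivalent G D \<Gamma> ?GM ?M ?\<Gamma>M"
    using graded_equivalentI[OF _ MS \<Gamma>M] by blast
  obtain \<psi> where \<psi>: "\<psi> \<in> alg_iso D ?M"
    using alg_isomorphic_common[OF iso M(2,1)] by blast
  have k: "2 * m + 2 = 2 * Suc m" by simp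
  show "\<exists>F. bij_betw F (iso_classes1 G D) (typeI_pairs G (2 * m + 2) (-1)) \<and>
      (\<forall>C\<in>iso_classes1 G D. \<forall>\<Gamma>\<in>C. \<forall>T \<mu>. F C = (T, \<mu>) \<longrightarrow> T = support G D \<Gamma> \<and>
        (\<forall>t\<in>T. \<forall>x\<in>\<Gamma> t - {\<zero>\<^bsub>D\<^esub>}. \<exists>c>0. x \<otimes>\<^bsub>D\<^esub> x = (c * \<mu> t) \<odot>\<^bsub>D\<^esub> \<one>\<^bsub>D\<^esub>))"
    unfolding k
  proof (rule iso_classes1_bij[OF _ _ MS \<Gamma>M \<psi>])
    show "card (mat_index n ?Q) = 4 ^ Suc m"
      unfolding trace_sign_quaternion(1) square_eq_power_4 by (simp add: n)
    \<comment> \<open>The signature \<open>-2 n\<close> is \<open>- 2 ^ Suc m\<close>, so with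
      \<open>r = Suc m\<close> the Arf invariant is -1.\<close>
    show "(\<Sum>k\<in>mat_index n ?Q. sgn (quaternion_coords.trace_sign k)) = -1 * 2 ^ Suc m"
      unfolding trace_sign_quaternion(2) by (simp add: n)
  qed
qed

end
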